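(* Let $p\ge 2$, $\beta>0$, $\gamma>0$ and $c<c_*=3(\beta^2\gamma/4)^{1/3}$. Let $\lambda>0$ and $$M_\lambda=\inf\{I(u;\beta,c,\gamma):\ u\in\mathcal X,\ K(u)=\lambda\}.$$ Let $(\psi_n)\subset\mathcal X$ be a sequence with $K(\psi_n)\to\lambda$ and $I(\psi_n;\beta,c,\gamma)\to M_\lambda$. Then there exist a subsequence (still denoted $\psi_n$), real numbers $y_n$ and $\psi\in\mathcal X$ such that $\psi_n(\cdot+y_n)\to\psi$ in $\mathcal X$. Moreover $K(\psi)=\lambda$ and $I(\psi;\beta,c,\gamma)=M_\lambda$.
   Context: Fix $p>1$ and a $C^2$ function $f:\mathbb R\to\mathbb R$ homogeneous of degree $p$, i.e. $f(\lambda s)=\lambda^p f(s)$ for all $\lambda>0$ and $s\in\mathbb R$. Let $F$ be the antiderivative of $f$ with $F(0)=0$, so that $sf(s)=(p+1)F(s)$. The operators are defined as follows. $\mathcal H$ is the Hilbert transform, $\mathcal Hu(x)=\mathrm{p.v.}\frac1\pi\int_{\mathbb R}\frac{u(z)}{x-z}dz$, with Fourier symbol $-i\,\mathrm{sgn}\,\xi$. $D_x^{1/2}$ is the Fourier multiplier with symbol $|\xi|^{1/2}$. $\partial_x^{-1}$ is the Fourier multiplier with symbol $(i\xi)^{-1}$, and $\partial_x^{-2}=(\partial_x^{-1})^2$. Let $\mathcal X=\{u\in H^{1/2}(\mathbb R):\partial_x^{-1}u\in L^2(\mathbb R)\}$, with norm $\|u\|_{\mathcal X}=\|u\|_{H^{1/2}}+\|\partial_x^{-1}u\|_{L^2}$.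 For $u\in\mathcal X$ define $$I(u;\beta,c,\gamma)=\int_{\mathbb R}\big(\beta(D_x^{1/2}u)^2-cu^2+\gamma(\partial_x^{-1}u)^2\big)dx,\qquad K(u)=-(p+1)\int_{\mathbb R}F(u)\,dx.$$ *)

theory Defs
  imports "HOL-Analysis.Analysis"
begin

definition L2fun :: "(real \<Rightarrow> 'a::{banach,second_countable_topology}) \<Rightarrow> bool" where
  "L2fun u \<longleftrightarrow> u \<in> borel_measurable lborel \<and> integrable lborel (\<lambda>x. (norm (u x))^2)"

definition trunc_fourier :: "(real \<Rightarrow> real) \<Rightarrow> real \<Rightarrow> real \<Rightarrow> complex" where
  "trunc_fourier u R \<xi> =
     set_lebesgue_integral lborel {-R..R} (\<lambda>x. complex_of_real (u x) * cis (- (x * \<xi>)))"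

definition fourier :: "(real \<Rightarrow> real) \<Rightarrow> real \<Rightarrow> complex" where
  "fourier u = (SOME g. L2fun g \<and>
      (\<forall>\<^sub>F R in at_top. integrable lborel (\<lambda>\<xi>. (cmod (g \<xi> - trunc_fourier u R \<xi>))^2)) \<and>
      ((\<lambda>R. LINT \<xi>|lborel. (cmod (g \<xi> - trunc_fourier u R \<xi>))^2) \<longlongrightarrow> 0) at_top)"

definition fourier_mult :: "(real \<Rightarrow> complex) \<Rightarrow> (real \<Rightarrow> real) \<Rightarrow> real \<Rightarrow> real" where
  "fourier_mult m u = (SOME v. L2fun v \<and> (AE \<xi> in lborel. fourier v \<xi> = m \<xi> * fourier u \<xi>))"

definition D_half :: "(real \<Rightarrow> real) \<Rightarrow> real \<Rightarrow> real" where
  "D_half u = fourier_mult (\<lambda>\<xi>. complex_of_real (sqrt \<bar>\<xi>\<bar>)) u"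

definition dx_inv_symbol :: "real \<Rightarrow> complex" where
  "dx_inv_symbol \<xi> = 1 / (\<i> * complex_of_real \<xi>)"

definition dx_inv :: "(real \<Rightarrow> real) \<Rightarrow> real \<Rightarrow> real" where
  "dx_inv u = fourier_mult dx_inv_symbol u"

definition H_half :: "(real \<Rightarrow> real) \<Rightarrow> bool" where
  "H_half u \<longleftrightarrow> L2fun u \<and>
     integrable lborel (\<lambda>\<xi>. sqrt (1 + \<xi>^2) * (cmod (fourier u \<xi>))^2)"

definition H_half_norm :: "(real \<Rightarrow> real) \<Rightarrow> real" where
  "H_half_norm u = sqrt ((1 / (2*pi)) * (LINT \<xi>|lborel. sqrt (1 + \<xi>^2) * (cmod (fourier u \<xi>))^2))"

definition Xspace :: "(real \<Rightarrow> real) \<Rightarrow> bool" where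
  "Xspace u \<longleftrightarrow> H_half u \<and>
     (\<exists>v::real \<Rightarrow> real. L2fun v \<and> (AE \<xi> in lborel. fourier v \<xi> = dx_inv_symbol \<xi> * fourier u \<xi>))"

definition Xnorm :: "(real \<Rightarrow> real) \<Rightarrow> real" where
  "Xnorm u = H_half_norm u + sqrt (LINT x|lborel. (dx_inv u x)^2)"

definition I_fun :: "real \<Rightarrow> real \<Rightarrow> real \<Rightarrow> (real \<Rightarrow> real) \<Rightarrow> real" where
  "I_fun \<beta> c \<gamma> u =
     (LINT x|lborel. \<beta> * (D_half u x)^2 - c * (u x)^2 + \<gamma> * (dx_inv u x)^2)"

definition K_fun :: "(real \<Rightarrow> real) \<Rightarrow> real \<Rightarrow> (real \<Rightarrow> real) \<Rightarrow> real" where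
  "K_fun F p u = - (p + 1) * (LINT x|lborel. F (u x))"

definition M_lam :: "real \<Rightarrow> real \<Rightarrow> real \<Rightarrow> (real \<Rightarrow> real) \<Rightarrow> real \<Rightarrow> real \<Rightarrow> real" where
  "M_lam \<beta> c \<gamma> F p lam = Inf {I_fun \<beta> c \<gamma> u | u. Xspace u \<and> K_fun F p u = lam}"

end

(* On the Fourier side I is the square of a Hilbert norm with weight
   beta |xi| - c + gamma / xi^2, which is coercive exactly because c < c_*.  Since K(psi_n) stays away from zero, the
   low-frequency parts of psi_n cannot be uniformly small, so suitable translates have a nonzero weak limit phi.
   I then splits exactly, and K splits up to o(1) by strong convergence on bounded intervals, between phi and the
   remainder.  Homogeneity gives M_t = t^(2/(p+1)) M_1, and strict subadditivity of this function leaves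
   K(phi) = lambda as the only possibility; then I(phi) = M_lambda and the remainder tends to zero in norm. *)
theory Submission
  imports Defs "HOL-Probability.Probability" "HOL-Complex_Analysis.Great_Picard"
begin


subsection \<open>Square integrable functions\<close>

text \<open>Two obstacles shape the argument. The operators in \<open>I_fun\<close> are nonlocal,
  and \<open>dx_inv\<close> of a function cut off in space need not be square integrable, so
  splitting a minimizing sequence by spatial cutoffs is unsuitable. Functions are therefore never
  cut inside \<open>I_fun\<close>: its splitting is the Hilbert space identity for a weak limit, and
  spatial windows enter only in \<open>K_fun\<close>, which is local. Secondly, H^(1/2) just fails
  to embed into the bounded functions. The part of u with frequencies in [-N,N] is bounded by a
  multiple of sqrt (ln (1+N)), and the rest has squared L2 norm of order 1/N; these two rates yield
  the L^q bounds for all finite q >= 2 and feed the exclusion of vanishing and the local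
  compactness. \<open>fourier\<close> is a chosen L2 limit, hence known only almost everywhere.
  Plancherel comes from Gaussian averaging, and surjectivity onto Hermitian functions from
  Plancherel and the multiplication formula; low-frequency parts are then defined by an honest
  integral, so that they have values at points.\<close>

definition l2sq :: "(real \<Rightarrow> 'a::euclidean_space) \<Rightarrow> real" where
  "l2sq f = (LINT x|lborel. (norm (f x))^2)"

text \<open>On complex values \<open>\<bullet>\<close> is the real inner product Re (z cnj w), so L2
  is treated as a real Hilbert space throughout, also for Fourier transforms.\<close>

definition l2ip :: "(real \<Rightarrow> 'a::euclidean_space) \<Rightarrow> (real \<Rightarrow> 'a) \<Rightarrow> real" where
  "l2ip f g = (LINT x|lborel. f x \<bullet> g x)"

lemma L2fun_measurable: "L2fun f \<Longrightarrow> f \<in> borel_measurable borel"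
  by (simp add: L2fun_def)

lemma L2fun_integrable: "L2fun f \<Longrightarrow> integrable lborel (\<lambda>x. (norm (f x))^2)"
  by (simp add: L2fun_def)

lemma L2funI:
  "f \<in> borel_measurable borel \<Longrightarrow> integrable lborel (\<lambda>x. (norm (f x))^2) \<Longrightarrow> L2fun f"
  by (simp add: L2fun_def)

lemma L2fun_bound:
  assumes "f \<in> borel_measurable borel" "integrable lborel g" "AE x in lborel. (norm (f x))^2 \<le> g x"
  shows "L2fun f"
proof (rule L2funI[OF assms(1)])
  show "integrable lborel (\<lambda>x. (norm (f x))^2)"
  proof (rule Bochner_Integration.integrable_bound[OF assms(2)])
    show "AE x in lborel. norm ((norm (f x))^2) \<le> norm (g x)"
      using assms(3) by eventually_elim auto
  qed (use assms(1) in measurable)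
qed

lemma l2sq_nonneg [simp]: "0 \<le> l2sq f"
  unfolding l2sq_def by (rule integral_nonneg_AE) auto

lemma l2sq_cong_AE:
  assumes "f \<in> borel_measurable borel" "g \<in> borel_measurable borel" "AE x in lborel. f x = g x"
  shows "l2sq f = l2sq g"
  unfolding l2sq_def
proof (rule integral_cong_AE)
  show "AE x in lborel. (norm (f x))^2 = (norm (g x))^2"
    using assms(3) by eventually_elim simp
qed (use assms in measurable)

lemma L2fun_cong_AE:
  assumes "L2fun f" "g \<in> borel_measurable borel" "AE x in lborel. f x = g x"
  shows "L2fun g"
proof (rule L2fun_bound[OF assms(2) L2fun_integrable[OF assms(1)]])
  show "AE x in lborel. (norm (g x))^2 \<le> (norm (f x))^2"
    using assms(3) by eventually_elim simp
qed

lemma L2fun_norm_mult: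
  fixes f :: "real \<Rightarrow> 'a::euclidean_space" and g :: "real \<Rightarrow> 'b::euclidean_space"
  assumes "L2fun f" "L2fun g"
  shows "integrable lborel (\<lambda>x. norm (f x) * norm (g x))"
proof (rule Bochner_Integration.integrable_bound)
  show "integrable lborel (\<lambda>x. (norm (f x))^2 + (norm (g x))^2)"
    using assms by (simp add: L2fun_def)
  have [measurable]: "f \<in> borel_measurable borel" "g \<in> borel_measurable borel"
    using assms by (auto simp: L2fun_def)
  show "(\<lambda>x. norm (f x) * norm (g x)) \<in> borel_measurable lborel" by measurable
  have "2 * (a * b) \<le> a^2 + b^2" for a b :: real
    using sum_squares_bound[of a b] by simp
  moreover have "0 \<le> norm (f x) * norm (g x)" for x by simp
  ultimately have "norm (f x) * norm (g x) \<le> (norm (f x))\<^sup>2 + (norm (g x))\<^sup>2" for x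
    by (smt (verit, best))
  then show "AE x in lborel. norm (norm (f x) * norm (g x)) \<le> norm ((norm (f x))\<^sup>2 + (norm (g x))\<^sup>2)"
    by simp
qed

lemma L2fun_inner_integrable:
  fixes f g :: "real \<Rightarrow> 'a::euclidean_space"
  assumes "L2fun f" "L2fun g"
  shows "integrable lborel (\<lambda>x. f x \<bullet> g x)"
proof (rule Bochner_Integration.integrable_bound[OF L2fun_norm_mult[OF assms]])
  have [measurable]: "f \<in> borel_measurable borel" "g \<in> borel_measurable borel"
    using assms by (auto simp: L2fun_def)
  show "(\<lambda>x. f x \<bullet> g x) \<in> borel_measurable lborel" by measurable
  show "AE x in lborel. norm (f x \<bullet> g x) \<le> norm (norm (f x) * norm (g x))"
    by (simp add: norm_mult Cauchy_Schwarz_ineq2)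
qed

lemma L2fun_mult_integrable:
  fixes f g :: "real \<Rightarrow> real"
  assumes "L2fun f" "L2fun g"
  shows "integrable lborel (\<lambda>x. f x * g x)"
  using L2fun_inner_integrable[OF assms] by simp

lemma L2fun_add:
  fixes f g :: "real \<Rightarrow> 'a::euclidean_space"
  assumes "L2fun f" "L2fun g" shows "L2fun (\<lambda>x. f x + g x)"
proof (rule L2funI)
  show "(\<lambda>x. f x + g x) \<in> borel_measurable borel"
    using assms by (auto simp: L2fun_def)
  have "integrable lborel (\<lambda>x. (norm (f x))^2 + 2 * (f x \<bullet> g x) + (norm (g x))^2)"
    using assms L2fun_inner_integrable[OF assms] by (simp add: L2fun_def)
  then show "integrable lborel (\<lambda>x. (norm (f x + g x))^2)"
    by (simp add: power2_norm_eq_inner inner_add_left inner_add_right inner_commute algebra_simps)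
qed

lemma L2fun_scaleR:
  fixes f :: "real \<Rightarrow> 'a::euclidean_space"
  assumes "L2fun f" shows "L2fun (\<lambda>x. c *\<^sub>R f x)"
  using assms by (auto simp: L2fun_def power_mult_distrib)

lemma L2fun_minus:
  fixes f :: "real \<Rightarrow> 'a::euclidean_space"
  assumes "L2fun f" shows "L2fun (\<lambda>x. - f x)"
  using assms by (auto simp: L2fun_def)

lemma L2fun_diff:
  fixes f g :: "real \<Rightarrow> 'a::euclidean_space"
  assumes "L2fun f" "L2fun g" shows "L2fun (\<lambda>x. f x - g x)"
  using L2fun_add[OF assms(1) L2fun_minus[OF assms(2)]] by simp

lemma l2ip_commute: "l2ip f g = l2ip g f"
  by (simp add: l2ip_def inner_commute)

lemma l2ip_self: "l2ip f f = l2sq f"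
  by (simp add: l2ip_def l2sq_def power2_norm_eq_inner)

lemma l2ip_add_left:
  "L2fun f \<Longrightarrow> L2fun g \<Longrightarrow> L2fun h \<Longrightarrow> l2ip (\<lambda>x. f x + g x) h = l2ip f h + l2ip g h"
  unfolding l2ip_def
  by (simp add: inner_add_left Bochner_Integration.integral_add L2fun_inner_integrable)

lemma l2ip_diff_left:
  "L2fun f \<Longrightarrow> L2fun g \<Longrightarrow> L2fun h \<Longrightarrow> l2ip (\<lambda>x. f x - g x) h = l2ip f h - l2ip g h"
  unfolding l2ip_def
  by (simp add: inner_diff_left Bochner_Integration.integral_diff L2fun_inner_integrable)

lemma l2ip_scaleR_left: "l2ip (\<lambda>x. c *\<^sub>R f x) h = c * l2ip f h"
  unfolding l2ip_def by simp

lemma l2sq_scaleR: "l2sq (\<lambda>x. c *\<^sub>R f x) = c^2 * l2sq f"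
  unfolding l2sq_def by (simp add: power_mult_distrib)

lemma l2sq_minus: "l2sq (\<lambda>x. - f x) = l2sq f"
  unfolding l2sq_def by simp

lemma l2sq_diff_commute: "l2sq (\<lambda>x. f x - g x) = l2sq (\<lambda>x. g x - f x)"
  unfolding l2sq_def by (simp add: norm_minus_commute)

lemma l2sq_add:
  assumes "L2fun f" "L2fun g"
  shows "l2sq (\<lambda>x. f x + g x) = l2sq f + 2 * l2ip f g + l2sq g"
proof -
  have "l2sq (\<lambda>x. f x + g x) = (LINT x|lborel. (norm (f x))^2 + 2 * (f x \<bullet> g x) + (norm (g x))^2)"
    unfolding l2sq_def
    by (rule Bochner_Integration.integral_cong)
       (auto simp add: power2_norm_eq_inner inner_add_left inner_add_right inner_commute algebra_simps)
  then show ?thesis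
    using assms L2fun_inner_integrable[OF assms] by (simp add: l2sq_def l2ip_def L2fun_def)
qed

lemma l2sq_diff:
  assumes "L2fun f" "L2fun g"
  shows "l2sq (\<lambda>x. f x - g x) = l2sq f - 2 * l2ip f g + l2sq g"
  using l2sq_add[OF assms(1) L2fun_minus[OF assms(2)]]
  by (simp add: l2sq_minus) (simp add: l2ip_def)

text \<open>For a > 0 evaluate at the vertex s = b/a. For a = 0 the function is affine, and the
  chosen s would give it the value -1 unless b = 0.\<close>

lemma quadratic_nonneg_discriminant:
  fixes a b d :: real
  assumes "\<And>s. 0 \<le> s^2 * a - 2 * s * b + d" "0 \<le> a"
  shows "b^2 \<le> a * d"
proof (cases "a = 0")
  case True
  have "b = 0"
  proof (rule ccontr)
    assume "b \<noteq> 0"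
    then show False using assms(1)[of "(d+1)/(2*b)"] True by (simp add: field_simps)
  qed
  then show ?thesis using True by simp
next
  case False
  then have "a > 0" using assms by simp
  have "0 \<le> (b/a)^2 * a - 2 * (b/a) * b + d" by (rule assms)
  also have "\<dots> = (a * d - b^2) / a" using \<open>a > 0\<close> by (simp add: field_simps power2_eq_square)
  finally show ?thesis using \<open>a > 0\<close> by (simp add: zero_le_divide_iff)
qed

lemma L2fun_norm:
  fixes f :: "real \<Rightarrow> 'a::euclidean_space"
  shows "L2fun f \<Longrightarrow> L2fun (\<lambda>x. norm (f x))" and "l2sq (\<lambda>x. norm (f x)) = l2sq f"
  by (auto simp: L2fun_def l2sq_def)

lemma l2ip_le:
  assumes "L2fun f" "L2fun g" shows "\<bar>l2ip f g\<bar> \<le> sqrt (l2sq f) * sqrt (l2sq g)"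
proof -
  have "0 \<le> s^2 * l2sq f - 2 * s * l2ip f g + l2sq g" for s
  proof -
    have "0 \<le> l2sq (\<lambda>x. s *\<^sub>R f x - g x)" by simp
    also have "\<dots> = s^2 * l2sq f - 2 * s * l2ip f g + l2sq g"
      using assms by (simp add: l2sq_diff L2fun_scaleR l2sq_scaleR l2ip_scaleR_left)
    finally show ?thesis .
  qed
  then have "(l2ip f g)^2 \<le> l2sq f * l2sq g" by (rule quadratic_nonneg_discriminant) simp
  then have "sqrt ((l2ip f g)^2) \<le> sqrt (l2sq f * l2sq g)" by (rule real_sqrt_le_mono)
  then show ?thesis by (simp add: real_sqrt_mult)
qed

text \<open>Applying \<open>l2ip_le\<close> to the pointwise norms allows different target spaces
  and puts the absolute values under the integral.\<close>

lemma L2_Cauchy_Schwarz: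
  fixes f :: "real \<Rightarrow> 'a::euclidean_space" and g :: "real \<Rightarrow> 'b::euclidean_space"
  assumes "L2fun f" "L2fun g"
  shows "(LINT x|lborel. norm (f x) * norm (g x)) \<le> sqrt (l2sq f) * sqrt (l2sq g)"
  using l2ip_le[OF L2fun_norm(1)[OF assms(1)] L2fun_norm(1)[OF assms(2)]]
  unfolding L2fun_norm(2) by (simp add: l2ip_def)

lemma l2norm_triangle:
  assumes "L2fun f" "L2fun g"
  shows "sqrt (l2sq (\<lambda>x. f x + g x)) \<le> sqrt (l2sq f) + sqrt (l2sq g)"
proof (rule real_le_lsqrt)
  have "l2sq (\<lambda>x. f x + g x) \<le> l2sq f + 2 * (sqrt (l2sq f) * sqrt (l2sq g)) + l2sq g"
    using l2ip_le[OF assms] by (simp add: l2sq_add assms)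
  also have "\<dots> = (sqrt (l2sq f) + sqrt (l2sq g))^2" by (simp add: power2_sum)
  finally show "l2sq (\<lambda>x. f x + g x) \<le> (sqrt (l2sq f) + sqrt (l2sq g))^2" .
qed auto

lemma l2norm_triangle_diff:
  assumes "L2fun f" "L2fun g"
  shows "\<bar>sqrt (l2sq f) - sqrt (l2sq g)\<bar> \<le> sqrt (l2sq (\<lambda>x. f x - g x))"
  using l2norm_triangle[OF L2fun_diff[OF assms] assms(2)]
        l2norm_triangle[OF L2fun_diff[OF assms(2,1)] assms(1)]
  by (simp add: l2sq_diff_commute[of g f])

lemma l2sq_eq_0_iff:
  assumes "L2fun f" shows "l2sq f = 0 \<longleftrightarrow> (AE x in lborel. f x = 0)"
  unfolding l2sq_def
  by (subst integral_nonneg_eq_0_iff_AE) (use assms in \<open>auto simp: L2fun_def\<close>)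

section \<open>Fatou's lemma and completeness of L2\<close>

lemma nn_integral_l2sq:
  "L2fun f \<Longrightarrow> (\<integral>\<^sup>+x. ennreal ((norm (f x))^2) \<partial>lborel) = ennreal (l2sq f)"
  unfolding l2sq_def by (rule nn_integral_eq_integral) (auto simp: L2fun_def)

lemma L2fun_nn_integral:
  fixes f :: "real \<Rightarrow> 'a::euclidean_space"
  assumes [measurable]: "f \<in> borel_measurable borel"
    and le: "(\<integral>\<^sup>+x. ennreal ((norm (f x))^2) \<partial>lborel) \<le> ennreal e" and "0 \<le> e"
  shows "L2fun f" and "l2sq f \<le> e"
proof -
  show L: "L2fun f"
  proof (rule L2funI)
    show "integrable lborel (\<lambda>x. (norm (f x))^2)"
      by (rule integrableI_bounded) (use le ennreal_less_top[of e] in \<open>auto intro: le_less_trans\<close>)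
  qed fact
  show "l2sq f \<le> e"
    using le nn_integral_l2sq[OF L] \<open>0 \<le> e\<close> by simp
qed

text \<open>Lower semicontinuity of the norm under almost everywhere convergence. Membership of the
  limit is part of the conclusion; this is how limits are first shown to be square
  integrable.\<close>

lemma L2_Fatou:
  fixes f :: "nat \<Rightarrow> real \<Rightarrow> 'a::euclidean_space"
  assumes L: "\<And>n. L2fun (f n)" and [measurable]: "g \<in> borel_measurable borel"
    and lim: "AE x in lborel. (\<lambda>n. f n x) \<longlonglongrightarrow> g x"
    and le: "\<forall>\<^sub>F n in sequentially. l2sq (f n) \<le> e"
  shows "L2fun g" and "l2sq g \<le> e"
proof -
  have [measurable]: "f n \<in> borel_measurable borel" for n using L by (rule L2fun_measurable)
  have e: "0 \<le> e"
  proof -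
    obtain n where "l2sq (f n) \<le> e" using eventually_happens[OF le] by auto
    then show ?thesis using l2sq_nonneg[of "f n"] by linarith
  qed
  have "(\<integral>\<^sup>+x. ennreal ((norm (g x))^2) \<partial>lborel)
      = (\<integral>\<^sup>+x. liminf (\<lambda>n. ennreal ((norm (f n x))^2)) \<partial>lborel)"
  proof (rule nn_integral_cong_AE)
    show "AE x in lborel. ennreal ((norm (g x))^2) = liminf (\<lambda>n. ennreal ((norm (f n x))^2))"
      using lim
    proof eventually_elim
      case (elim x)
      then have "(\<lambda>n. ennreal ((norm (f n x))^2)) \<longlonglongrightarrow> ennreal ((norm (g x))^2)"
        by (intro tendsto_intros tendsto_ennrealI)
      then show ?case by (rule lim_imp_Liminf[OF sequentially_bot, symmetric])
    qed
  qed
  also have "\<dots> \<le> liminf (\<lambda>n. \<integral>\<^sup>+x. ennreal ((norm (f n x))^2) \<partial>lborel)"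
    by (rule nn_integral_liminf) measurable
  also have "\<dots> = liminf (\<lambda>n. ennreal (l2sq (f n)))"
    by (simp add: nn_integral_l2sq L)
  also have "\<dots> \<le> ennreal e"
  proof (rule Liminf_le)
    show "\<forall>\<^sub>F n in sequentially. ennreal (l2sq (f n)) \<le> ennreal e"
      using le by eventually_elim (simp add: e)
  qed simp
  finally have *: "(\<integral>\<^sup>+x. ennreal ((norm (g x))^2) \<partial>lborel) \<le> ennreal e" .
  show "L2fun g" "l2sq g \<le> e"
    using L2fun_nn_integral[OF _ * e] by auto
qed

text \<open>Riesz-Fischer. Along a subsequence whose squared increments \<open>d k\<close> have
  integral at most 8^-k, the series of 2^k (d k)^2 has finite integral, so it converges almost
  everywhere. Since d <= 2^-k + 2^k d^2 (either d <= 2^-k or 1 <= 2^k d), the increments themselves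
  are summable there.\<close>

theorem L2_complete:
  fixes f :: "nat \<Rightarrow> real \<Rightarrow> 'a::euclidean_space"
  assumes L: "\<And>n. L2fun (f n)"
    and C: "\<And>e. e > 0 \<Longrightarrow> \<exists>N. \<forall>m\<ge>N. \<forall>n\<ge>N. l2sq (\<lambda>x. f m x - f n x) \<le> e"
  obtains g where "L2fun g" "(\<lambda>n. l2sq (\<lambda>x. f n x - g x)) \<longlonglongrightarrow> 0"
proof -
  have [measurable]: "f n \<in> borel_measurable borel" for n using L by (rule L2fun_measurable)
  have "\<forall>k. \<exists>N. \<forall>m\<ge>N. \<forall>n\<ge>N. l2sq (\<lambda>x. f m x - f n x) \<le> (1/8)^k"
    using C by simp
  then obtain N where N: "\<And>k m n. m \<ge> N k \<Longrightarrow> n \<ge> N k \<Longrightarrow> l2sq (\<lambda>x. f m x - f n x) \<le> (1/8)^k"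
    by metis
  \<comment> \<open>Adding \<open>k\<close> to the partial sums of \<open>N\<close> makes
    \<open>r\<close> increasing and larger than both \<open>N k\<close> and
    \<open>k\<close>.\<close>
  define r where "r k = (\<Sum>i\<le>k. N i) + k" for k
  have rN: "N k \<le> r k" for k
    unfolding r_def using member_le_sum[of k "{..k}" N] by simp
  have rS: "r k \<le> r (Suc k)" for k by (simp add: r_def)
  have rk: "k \<le> r k" for k by (simp add: r_def)
  define d where "d k x = norm (f (r (Suc k)) x - f (r k) x)" for k x
  have [measurable]: "d k \<in> borel_measurable borel" for k unfolding d_def by measurable
  have dL: "(\<integral>\<^sup>+x. ennreal (2^k * (d k x)^2) \<partial>lborel) \<le> ennreal ((1/4)^k)" for k
  proof -
    have "(\<integral>\<^sup>+x. ennreal (2^k * (d k x)^2) \<partial>lborel) = ennreal (2^k) * (\<integral>\<^sup>+x. ennreal ((d k x)^2) \<partial>lborel)"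
      by (subst nn_integral_cmult[symmetric]) (auto simp: ennreal_mult)
    also have "\<dots> = ennreal (2^k * l2sq (\<lambda>x. f (r (Suc k)) x - f (r k) x))"
      unfolding d_def by (simp add: nn_integral_l2sq L2fun_diff L ennreal_mult)
    also have "\<dots> \<le> ennreal (2^k * (1/8)^k)"
      using N[OF order_trans[OF rN rS] rN] by (intro ennreal_leI mult_left_mono) auto
    also have "(2::real)^k * (1/8)^k = (1/4)^k" by (simp flip: power_mult_distrib)
    finally show ?thesis .
  qed
  have "(\<integral>\<^sup>+x. (\<Sum>k. ennreal (2^k * (d k x)^2)) \<partial>lborel) = (\<Sum>k. \<integral>\<^sup>+x. ennreal (2^k * (d k x)^2) \<partial>lborel)"
    by (rule nn_integral_suminf) measurable
  also have "\<dots> \<le> (\<Sum>k. ennreal ((1/4)^k))" by (intro suminf_le dL) auto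
  also have "\<dots> = ennreal (\<Sum>k. (1/4)^k)" by (rule suminf_ennreal2) (auto intro: summable_geometric)
  finally have "(\<integral>\<^sup>+x. (\<Sum>k. ennreal (2^k * (d k x)^2)) \<partial>lborel) \<noteq> \<infinity>"
    by (rule neq_top_trans[rotated, unfolded infinity_ennreal_def[symmetric]]) simp
  then have "AE x in lborel. (\<Sum>k. ennreal (2^k * (d k x)^2)) \<noteq> \<infinity>"
    by (intro nn_integral_PInf_AE) auto
  then have conv: "AE x in lborel. convergent (\<lambda>k. f (r k) x)"
  proof eventually_elim
    case (elim x)
    then have s: "summable (\<lambda>k. 2^k * (d k x)^2)"
      by (intro summable_suminf_not_top) auto
    have "summable (\<lambda>k. (1/2)^k + 2^k * (d k x)^2)"
      by (intro summable_add s summable_geometric) simp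
    then have "summable (\<lambda>k. norm (f (r (Suc k)) x - f (r k) x))"
    proof (rule summable_comparison_test'[where N=0])
      fix k
      have "d k x \<le> (1/2)^k + 2^k * (d k x)^2"
      proof (cases "d k x \<le> (1/2)^k")
        case False
        then have "1 \<le> 2^k * d k x" by (simp add: field_simps)
        then have "d k x * 1 \<le> d k x * (2^k * d k x)" by (intro mult_left_mono) (auto simp: d_def)
        then have "d k x \<le> 2^k * (d k x)^2" by (simp add: power2_eq_square algebra_simps)
        moreover have "(0::real) \<le> (1/2)^k" by simp
        ultimately show ?thesis by linarith
      next
        case True
        moreover have "0 \<le> 2^k * (d k x)^2" by simp
        ultimately show ?thesis by linarith
      qed
      then show "norm (norm (f (r (Suc k)) x - f (r k) x)) \<le> (1/2)^k + 2^k * (d k x)^2"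
        by (simp add: d_def)
    qed
    then have "summable (\<lambda>k. f (r (Suc k)) x - f (r k) x)" by (rule summable_norm_cancel)
    then have "convergent (\<lambda>n. \<Sum>k<n. f (r (Suc k)) x - f (r k) x)"
      by (simp add: summable_iff_convergent)
    then have "convergent (\<lambda>n. f (r n) x - f (r 0) x)"
      by (simp add: sum_lessThan_telescope[of "\<lambda>k. f (r k) x"])
    then show ?case by (simp add: convergent_diff_const_right_iff)
  qed
  define g where "g x = lim (\<lambda>k. f (r k) x)" for x
  have [measurable]: "g \<in> borel_measurable borel"
    unfolding g_def by measurable
  have lim: "AE x in lborel. (\<lambda>k. f (r k) x) \<longlonglongrightarrow> g x"
    using conv unfolding g_def by eventually_elim (simp add: convergent_LIMSEQ_iff)
  \<comment> \<open>Fatou along the subsequence turns the Cauchy bound between members into a bound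
    for the distance to \<open>g\<close>, and this for every late index of the full
    sequence.\<close>
  have key: "L2fun (\<lambda>x. f n x - g x) \<and> l2sq (\<lambda>x. f n x - g x) \<le> e"
    if M: "\<And>m n. m \<ge> M \<Longrightarrow> n \<ge> M \<Longrightarrow> l2sq (\<lambda>x. f m x - f n x) \<le> e" and n: "n \<ge> M" for e M n
  proof -
    have a: "AE x in lborel. (\<lambda>k. f n x - f (r k) x) \<longlonglongrightarrow> f n x - g x"
      using lim by eventually_elim (intro tendsto_intros)
    have b: "\<forall>\<^sub>F k in sequentially. l2sq (\<lambda>x. f n x - f (r k) x) \<le> e"
      using eventually_ge_at_top[of M]
    proof eventually_elim
      case (elim k)
      show ?case by (rule M[OF n order_trans[OF elim rk]])
    qed
    show ?thesis
      using L2_Fatou[OF L2fun_diff[OF L L] _ a b] by auto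
  qed
  obtain M where "\<And>m n. m \<ge> M \<Longrightarrow> n \<ge> M \<Longrightarrow> l2sq (\<lambda>x. f m x - f n x) \<le> 1"
    using C[of 1] by auto
  then have "L2fun (\<lambda>x. f M x - g x)" using key by blast
  from L2fun_diff[OF L[of M] this] have "L2fun g" by simp
  moreover have "(\<lambda>n. l2sq (\<lambda>x. f n x - g x)) \<longlonglongrightarrow> 0"
  proof (rule LIMSEQ_I)
    fix e :: real assume "e > 0"
    then obtain M where "\<And>m n. m \<ge> M \<Longrightarrow> n \<ge> M \<Longrightarrow> l2sq (\<lambda>x. f m x - f n x) \<le> e/2"
      using C[of "e/2"] by auto
    then have "\<forall>n\<ge>M. l2sq (\<lambda>x. f n x - g x) \<le> e/2" using key by blast
    then show "\<exists>no. \<forall>n\<ge>no. norm (l2sq (\<lambda>x. f n x - g x) - 0) < e"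
      using \<open>e > 0\<close> by (intro exI[of _ M]) fastforce
  qed
  ultimately show ?thesis by (rule that)
qed

lemma l2_dominated:
  fixes f :: "nat \<Rightarrow> real \<Rightarrow> 'a::euclidean_space"
  assumes [measurable]: "\<And>n. f n \<in> borel_measurable borel" and w: "integrable lborel w"
    and lim: "AE x in lborel. (\<lambda>n. f n x) \<longlonglongrightarrow> 0"
    and le: "\<And>n. AE x in lborel. (norm (f n x))^2 \<le> w x"
  shows "(\<lambda>n. l2sq (f n)) \<longlonglongrightarrow> 0"
proof -
  have "(\<lambda>n. l2sq (f n)) \<longlonglongrightarrow> (LINT (x::real)|lborel. (0::real))"
    unfolding l2sq_def
  proof (rule integral_dominated_convergence[where w=w])
    show "AE x in lborel. (\<lambda>n. (norm (f n x))^2) \<longlonglongrightarrow> 0"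
      using lim
    proof eventually_elim
      case (elim x)
      then have "(\<lambda>n. (norm (f n x))^2) \<longlonglongrightarrow> (norm (0::'a))^2" by (intro tendsto_intros)
      then show ?case by simp
    qed
    show "AE x in lborel. norm ((norm (f n x))^2) \<le> w x" for n
      using le[of n] by eventually_elim simp
  qed (use w in auto)
  then show ?thesis by simp
qed


section \<open>Translations and reflections of the line\<close>

lemma integral_shift:
  fixes f :: "real \<Rightarrow> 'a::{banach,second_countable_topology}"
  shows "(LINT x|lborel. f (x + t)) = (LINT x|lborel. f x)"
  using lborel_integral_real_affine[of 1 f t] by (simp add: add.commute)

lemma integrable_shift:
  fixes f :: "real \<Rightarrow> 'a::{banach,second_countable_topology}"
  assumes "integrable lborel f" shows "integrable lborel (\<lambda>x. f (x + t))"
  using lborel_integrable_real_affine[OF assms, of 1 t] by (simp add: add.commute)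

lemma integral_reflect:
  fixes f :: "real \<Rightarrow> 'a::{banach,second_countable_topology}"
  shows "(LINT x|lborel. f (- x)) = (LINT x|lborel. f x)"
  using lborel_integral_real_affine[of "-1" f 0] by simp

lemma integrable_reflect:
  fixes f :: "real \<Rightarrow> 'a::{banach,second_countable_topology}"
  assumes "integrable lborel f" shows "integrable lborel (\<lambda>x. f (- x))"
  using lborel_integrable_real_affine[OF assms, of "-1" 0] by simp

lemma L2fun_shift: "L2fun f \<Longrightarrow> L2fun (\<lambda>x. f (x + t))"
  unfolding L2fun_def using integrable_shift[of "\<lambda>x. (norm (f x))\<^sup>2" t] by auto

lemma l2sq_shift: "l2sq (\<lambda>x. f (x + t)) = l2sq f"
  unfolding l2sq_def by (rule integral_shift[of "\<lambda>x. (norm (f x))\<^sup>2"])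

lemma L2fun_reflect: "L2fun f \<Longrightarrow> L2fun (\<lambda>x. f (- x))"
  unfolding L2fun_def using integrable_reflect[of "\<lambda>x. (norm (f x))\<^sup>2"] by auto

lemma l2sq_reflect: "l2sq (\<lambda>x. f (- x)) = l2sq f"
  unfolding l2sq_def by (rule integral_reflect[of "\<lambda>x. (norm (f x))\<^sup>2"])

lemma AE_reflect:
  assumes "AE x in lborel. P x" shows "AE x::real in lborel. P (- x)"
proof -
  obtain N where N: "N \<in> null_sets lborel" "{x. \<not> P x} \<subseteq> N"
    using assms unfolding eventually_ae_filter by auto
  have [measurable]: "N \<in> sets borel" using N(1) by auto
  have "emeasure lborel (uminus -` N) = emeasure (distr lborel borel uminus) N"
    by (subst emeasure_distr) auto
  also have "\<dots> = 0" using N(1) lborel_distr_uminus by (auto simp: null_sets_def)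
  finally have "uminus -` N \<in> null_sets lborel"
    using measurable_sets[of uminus borel borel N] by (auto simp: null_sets_def)
  then show ?thesis using N(2) unfolding eventually_ae_filter by (intro bexI[of _ "uminus -` N"]) auto
qed

lemma integrable_indicator_interval:
  fixes a b c :: real shows "integrable lborel (\<lambda>x. indicator {a..b} x * c)"
  by (intro integrable_mult_left integrable_real_indicator) (auto simp: emeasure_lborel_Icc_eq)

subsection \<open>Continuity of translations\<close>

definition clamp1 :: "real \<Rightarrow> real \<Rightarrow> real" where "clamp1 n y = max (- n) (min n y)"

lemma clamp1_abs_le: "0 \<le> n \<Longrightarrow> \<bar>clamp1 n y\<bar> \<le> n" "0 \<le> n \<Longrightarrow> \<bar>clamp1 n y\<bar> \<le> \<bar>y\<bar>"
  by (auto simp: clamp1_def max_def min_def)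

lemma clamp1_id: "\<bar>y\<bar> \<le> n \<Longrightarrow> clamp1 n y = y"
  by (auto simp: clamp1_def max_def min_def)

lemma continuous_on_clamp1 [continuous_intros]:
  "continuous_on S f \<Longrightarrow> continuous_on S (\<lambda>x. clamp1 n (f x))"
  unfolding clamp1_def by (intro continuous_intros)

lemma L2_truncation:
  assumes L: "L2fun (g::real\<Rightarrow>real)"
  defines "G \<equiv> \<lambda>(n::nat) x. indicator {-real n..real n} x * clamp1 (real n) (g x)"
  shows "(\<lambda>n. l2sq (\<lambda>x. G n x - g x)) \<longlonglongrightarrow> 0"
proof (rule l2_dominated)
  have [measurable]: "g \<in> borel_measurable borel" by (rule L2fun_measurable[OF L])
  show "(\<lambda>x. G n x - g x) \<in> borel_measurable borel" for n
    unfolding G_def clamp1_def by measurable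
  show "integrable lborel (\<lambda>x. 4 * (norm (g x))^2)" using L by (simp add: L2fun_def)
  show "AE x in lborel. (\<lambda>n. G n x - g x) \<longlonglongrightarrow> 0"
  proof (rule AE_I2)
    fix x
    obtain N :: nat where N: "\<bar>x\<bar> + \<bar>g x\<bar> \<le> real N" using real_arch_simple by blast
    have "\<forall>\<^sub>F n in sequentially. G n x - g x = 0"
      using eventually_ge_at_top[of N]
    proof eventually_elim
      case (elim n)
      then have "\<bar>x\<bar> \<le> real n" "\<bar>g x\<bar> \<le> real n" using N by auto
      then show ?case by (auto simp: G_def clamp1_id indicator_def abs_le_iff)
    qed
    then show "(\<lambda>n. G n x - g x) \<longlonglongrightarrow> 0" by (rule tendsto_eventually)
  qed
  show "AE x in lborel. (norm (G n x - g x))^2 \<le> 4 * (norm (g x))^2" for n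
  proof (rule AE_I2)
    fix x
    have "\<bar>G n x\<bar> \<le> \<bar>g x\<bar>" using clamp1_abs_le(2)[of "real n" "g x"] by (auto simp: G_def indicator_def)
    then have "\<bar>G n x - g x\<bar> \<le> 2 * \<bar>g x\<bar>" by linarith
    then have "\<bar>G n x - g x\<bar>^2 \<le> (2 * \<bar>g x\<bar>)^2" by (intro power_mono) auto
    then show "(norm (G n x - g x))^2 \<le> 4 * (norm (g x))^2" by (simp add: power_mult_distrib)
  qed
qed

text \<open>The truncation \<open>G n\<close> is bounded with bounded support. Being measurable, it
  is an almost everywhere limit of continuous functions; after clamping their values and multiplying
  by a tent, dominated convergence makes the limit hold in L2.\<close>

lemma L2_dense_continuous:
  assumes L: "L2fun (g::real\<Rightarrow>real)" and "e > 0"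
  obtains k R C where "continuous_on UNIV k" "\<And>x. \<bar>x\<bar> > R \<Longrightarrow> k x = 0" "\<And>x. \<bar>k x\<bar> \<le> C"
    "L2fun k" "sqrt (l2sq (\<lambda>x. g x - k x)) < e"
proof -
  have [measurable]: "g \<in> borel_measurable borel" by (rule L2fun_measurable[OF L])
  define G where "G = (\<lambda>(n::nat) x. indicator {-real n..real n} x * clamp1 (real n) (g x))"
  have "(\<lambda>n. sqrt (l2sq (\<lambda>x. G n x - g x))) \<longlonglongrightarrow> sqrt 0"
    unfolding G_def by (intro tendsto_intros L2_truncation L)
  then have "\<forall>\<^sub>F n in sequentially. sqrt (l2sq (\<lambda>x. G n x - g x)) < e/2"
    using \<open>e > 0\<close> by (intro order_tendstoD) auto
  then obtain n where n: "sqrt (l2sq (\<lambda>x. G n x - g x)) < e/2"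
    using eventually_happens'[OF sequentially_bot] by blast
  have [measurable]: "G n \<in> borel_measurable borel" unfolding G_def clamp1_def by measurable
  have LG: "L2fun (G n)"
  proof (rule L2fun_bound[OF _ L2fun_integrable[OF L]])
    show "AE x in lborel. (norm (G n x))^2 \<le> (norm (g x))^2"
      by (rule AE_I2) (auto simp: G_def indicator_def abs_le_square_iff[symmetric] clamp1_abs_le)
  qed measurable
  have "G n \<in> borel_measurable lebesgue"
    by (rule measurable_completion) measurable
  then have "G n measurable_on UNIV"
    by (simp add: measurable_on_iff_borel_measurable)
  then obtain N k where N: "negligible N" and k: "\<And>m. continuous_on UNIV (k m)"
    and lim: "\<And>x. x \<notin> N \<Longrightarrow> (\<lambda>m. k m x) \<longlonglongrightarrow> G n x"
    unfolding measurable_on_def by auto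
  have "AE x in lebesgue. x \<notin> N"
    using N by (intro AE_not_in) (simp add: negligible_iff_null_sets)
  then have aeN: "AE x in lborel. x \<notin> N" by (simp add: AE_completion_iff)
  \<comment> \<open>The tent is 1 on [-n,n], where \<open>G n\<close> lives, so it does not disturb
    the limit; it vanishes beyond n+1, which supplies the integrable majorant.\<close>
  define cut where "cut x = max 0 (min 1 (real n + 1 - \<bar>x\<bar>))" for x :: real
  have cut: "0 \<le> cut x" "cut x \<le> 1" "\<bar>x\<bar> \<le> real n \<Longrightarrow> cut x = 1" "\<bar>x\<bar> > real n + 1 \<Longrightarrow> cut x = 0" for x
    by (auto simp: cut_def)
  define q where "q m x = cut x * clamp1 (real n) (k m x)" for m x
  have cq: "continuous_on UNIV (q m)" for m
    unfolding q_def cut_def by (intro continuous_intros k)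
  then have [measurable]: "q m \<in> borel_measurable borel" for m
    by (rule borel_measurable_continuous_onI)
  have qn: "\<bar>q m x\<bar> \<le> real n" for m x
    unfolding q_def abs_mult
    using mult_mono[OF _ clamp1_abs_le(1)[of "real n" "k m x"], of "\<bar>cut x\<bar>" 1] cut[of x] by simp
  have "(\<lambda>m. l2sq (\<lambda>x. q m x - G n x)) \<longlonglongrightarrow> 0"
  proof (rule l2_dominated)
    show "integrable lborel (\<lambda>x. indicator {-(real n+1)..real n+1} x * (2 * real n)^2 :: real)"
      by (rule integrable_indicator_interval)
    show "AE x in lborel. (\<lambda>m. q m x - G n x) \<longlonglongrightarrow> 0"
      using aeN
    proof eventually_elim
      case (elim x)
      have "(\<lambda>m. q m x) \<longlonglongrightarrow> cut x * clamp1 (real n) (G n x)"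
        unfolding q_def clamp1_def by (intro tendsto_intros lim elim)
      also have "clamp1 (real n) (G n x) = G n x"
        by (rule clamp1_id) (auto simp: G_def indicator_def clamp1_abs_le)
      also have "cut x * G n x = G n x"
        using cut(3)[of x] by (auto simp: G_def indicator_def abs_le_iff)
      finally show ?case by (simp add: LIM_zero_iff)
    qed
    fix m
    show "AE x in lborel. (norm (q m x - G n x))^2 \<le> indicator {-(real n+1)..real n+1} x * (2 * real n)^2"
    proof (rule AE_I2)
      fix x
      have "\<bar>G n x\<bar> \<le> real n" by (auto simp: G_def indicator_def clamp1_abs_le)
      then have "\<bar>q m x - G n x\<bar> \<le> 2 * real n" using qn[of m x] by linarith
      then have "\<bar>q m x - G n x\<bar>^2 \<le> (2 * real n)^2" by (intro power_mono) auto
      moreover have "q m x - G n x = 0" if "x \<notin> {-(real n+1)..real n+1}"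
      proof -
        have "\<bar>x\<bar> > real n + 1" using that by auto
        then show ?thesis using cut(4)[of x] by (auto simp: q_def G_def indicator_def)
      qed
      ultimately show "(norm (q m x - G n x))^2 \<le> indicator {-(real n+1)..real n+1} x * (2 * real n)^2"
        by (auto simp: indicator_def)
    qed
  qed measurable
  then have "(\<lambda>m. sqrt (l2sq (\<lambda>x. q m x - G n x))) \<longlonglongrightarrow> sqrt 0" by (intro tendsto_intros)
  then have "\<forall>\<^sub>F m in sequentially. sqrt (l2sq (\<lambda>x. q m x - G n x)) < e/2"
    using \<open>e > 0\<close> by (intro order_tendstoD) auto
  then obtain m where m: "sqrt (l2sq (\<lambda>x. q m x - G n x)) < e/2"
    using eventually_happens'[OF sequentially_bot] by blast
  have q0: "q m x = 0" if "\<bar>x\<bar> > real n + 1" for x using cut(4)[OF that] by (simp add: q_def)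
  have Lq: "L2fun (q m)"
  proof (rule L2fun_bound)
    show "integrable lborel (\<lambda>x. indicator {-(real n+1)..real n+1} x * (real n)^2 :: real)"
      by (rule integrable_indicator_interval)
    show "AE x in lborel. (norm (q m x))^2 \<le> indicator {-(real n+1)..real n+1} x * (real n)^2"
    proof (rule AE_I2)
      fix x
      have "\<bar>q m x\<bar>^2 \<le> (real n)^2" using qn[of m x] by (intro power_mono) auto
      then show "(norm (q m x))^2 \<le> indicator {-(real n+1)..real n+1} x * (real n)^2"
        using q0[of x] by (auto simp: indicator_def)
    qed
  qed measurable
  have "sqrt (l2sq (\<lambda>x. (g x - G n x) + (G n x - q m x))) \<le>
      sqrt (l2sq (\<lambda>x. g x - G n x)) + sqrt (l2sq (\<lambda>x. G n x - q m x))"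
    by (intro l2norm_triangle L2fun_diff L LG Lq)
  also have "\<dots> < e" using n m unfolding l2sq_diff_commute[of g "G n"] l2sq_diff_commute[of "G n" "q m"] by linarith
  finally have "sqrt (l2sq (\<lambda>x. g x - q m x)) < e" by simp
  then show ?thesis using that[OF cq q0 qn Lq] by blast
qed

text \<open>For a continuous function of bounded support this is dominated convergence, on an
  interval enlarged by a bound for the shifts. The general case is a three-epsilon argument: the
  approximation error has the same norm after translation.\<close>

lemma L2_shift_continuous:
  assumes L: "L2fun (g::real\<Rightarrow>real)" and t: "t \<longlonglongrightarrow> 0"
  shows "(\<lambda>n. l2sq (\<lambda>x. g (x + t n) - g x)) \<longlonglongrightarrow> 0"
proof -
  have "(\<lambda>n. sqrt (l2sq (\<lambda>x. g (x + t n) - g x))) \<longlonglongrightarrow> 0"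
  proof (rule LIMSEQ_I)
    fix e :: real assume "e > 0"
    then have "e/3 > 0" by simp
    from L2_dense_continuous[OF L this] obtain k R C where k: "continuous_on UNIV k"
      "\<And>x. \<bar>x\<bar> > R \<Longrightarrow> k x = 0" "\<And>x. \<bar>k x\<bar> \<le> C" "L2fun k" "sqrt (l2sq (\<lambda>x. g x - k x)) < e/3" by blast
    have [measurable]: "k \<in> borel_measurable borel" by (rule L2fun_measurable[OF k(4)])
    obtain B where B: "\<And>n. \<bar>t n\<bar> \<le> B"
      using convergent_imp_Bseq[OF convergentI[OF t]] by (auto simp: Bseq_def)
    have "(\<lambda>n. l2sq (\<lambda>x. k (x + t n) - k x)) \<longlonglongrightarrow> 0"
    proof (rule l2_dominated)
      show "integrable lborel (\<lambda>x. indicator {-(R+B)..R+B} x * (2*C)^2 :: real)"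
        by (rule integrable_indicator_interval)
      show "AE x in lborel. (\<lambda>n. k (x + t n) - k x) \<longlonglongrightarrow> 0"
      proof (rule AE_I2)
        fix x
        have "isCont k x" using k(1) by (simp add: continuous_on_eq_continuous_at)
        moreover have "(\<lambda>n. x + t n) \<longlonglongrightarrow> x" using tendsto_add[OF tendsto_const t, of x] by simp
        ultimately have "(\<lambda>n. k (x + t n)) \<longlonglongrightarrow> k x" by (rule isCont_tendsto_compose)
        then show "(\<lambda>n. k (x + t n) - k x) \<longlonglongrightarrow> 0" by (simp add: LIM_zero_iff)
      qed
      fix n
      show "AE x in lborel. (norm (k (x + t n) - k x))^2 \<le> indicator {-(R+B)..R+B} x * (2*C)^2"
      proof (rule AE_I2)
        fix x
        have "\<bar>k (x + t n) - k x\<bar> \<le> 2*C" using k(3)[of x] k(3)[of "x + t n"] by linarith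
        then have "\<bar>k (x + t n) - k x\<bar>^2 \<le> (2*C)^2" by (intro power_mono) auto
        moreover have "k (x + t n) - k x = 0" if "x \<notin> {-(R+B)..R+B}"
        proof -
          have "\<bar>x\<bar> > R + B" "\<bar>x + t n\<bar> > R" using that B[of n] by auto
          moreover have "0 \<le> B" using B[of 0] by linarith
          ultimately show ?thesis using k(2)[of x] k(2)[of "x + t n"] by auto
        qed
        ultimately show "(norm (k (x + t n) - k x))^2 \<le> indicator {-(R+B)..R+B} x * (2*C)^2"
          by (auto simp: indicator_def)
      qed
    qed measurable
    then have "(\<lambda>n. sqrt (l2sq (\<lambda>x. k (x + t n) - k x))) \<longlonglongrightarrow> sqrt 0" by (intro tendsto_intros)
    then have "\<forall>\<^sub>F n in sequentially. sqrt (l2sq (\<lambda>x. k (x + t n) - k x)) < e/3"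
      using \<open>e > 0\<close> by (intro order_tendstoD) auto
    then have "\<forall>\<^sub>F n in sequentially. sqrt (l2sq (\<lambda>x. g (x + t n) - g x)) < e"
    proof eventually_elim
      case (elim n)
      have La: "L2fun (\<lambda>x. g (x + t n) - k (x + t n))" by (intro L2fun_diff L2fun_shift L k)
      have Lb: "L2fun (\<lambda>x. k (x + t n) - k x)" by (intro L2fun_diff L2fun_shift L k)
      have Lc: "L2fun (\<lambda>x. k x - g x)" by (intro L2fun_diff L2fun_shift L k)
      have a: "l2sq (\<lambda>x. g (x + t n) - k (x + t n)) = l2sq (\<lambda>x. g x - k x)"
        by (rule l2sq_shift[of "\<lambda>x. g x - k x"])
      have "sqrt (l2sq (\<lambda>x. ((g (x + t n) - k (x + t n)) + (k (x + t n) - k x)) + (k x - g x)))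
        \<le> (sqrt (l2sq (\<lambda>x. g (x + t n) - k (x + t n))) + sqrt (l2sq (\<lambda>x. k (x + t n) - k x)))
          + sqrt (l2sq (\<lambda>x. k x - g x))"
        using l2norm_triangle[OF L2fun_add[OF La Lb] Lc] l2norm_triangle[OF La Lb] by linarith
      also have "\<dots> < e" using elim k(5) unfolding a l2sq_diff_commute[of k g] by linarith
      finally show ?case by simp
    qed
    then show "\<exists>no. \<forall>n\<ge>no. norm (sqrt (l2sq (\<lambda>x. g (x + t n) - g x)) - 0) < e"
      by (auto simp: eventually_sequentially)
  qed
  from tendsto_power[OF this, of 2] show ?thesis by simp
qed

text \<open>Identifies the limit of the Gaussian averages of the autocorrelation in the proof of
  Plancherel.\<close>

lemma autocorrelation_continuous:
  assumes L: "L2fun (g::real\<Rightarrow>real)" and t: "t \<longlonglongrightarrow> 0"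
  shows "(\<lambda>n. LINT x|lborel. g x * g (x + t n)) \<longlonglongrightarrow> l2sq g"
proof -
  have "(\<lambda>n. sqrt (l2sq g) * sqrt (l2sq (\<lambda>x. g (x + t n) - g x))) \<longlonglongrightarrow> sqrt (l2sq g) * sqrt 0"
    by (intro tendsto_intros L2_shift_continuous assms)
  then have lim: "(\<lambda>n. sqrt (l2sq g) * sqrt (l2sq (\<lambda>x. g (x + t n) - g x))) \<longlonglongrightarrow> 0" by simp
  have "(\<lambda>n. l2ip g (\<lambda>x. g (x + t n) - g x)) \<longlonglongrightarrow> 0"
    by (rule Lim_null_comparison[OF _ lim])
       (use l2ip_le[OF L L2fun_diff[OF L2fun_shift[OF L] L]] in simp)
  moreover have "l2ip g (\<lambda>x. g (x + t n) - g x) = (LINT x|lborel. g x * g (x + t n)) - l2sq g" for n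
  proof -
    have "l2ip g (\<lambda>x. g (x + t n) - g x) = l2ip (\<lambda>x. g (x + t n)) g - l2ip g g"
      using l2ip_diff_left[OF L2fun_shift[OF L] L L, of "t n"] by (simp add: l2ip_commute)
    then show ?thesis by (simp add: l2ip_self l2ip_commute) (simp add: l2ip_def)
  qed
  ultimately show ?thesis by (simp add: LIM_zero_iff)
qed


subsection \<open>The Plancherel identity for integrable functions\<close>

definition ft :: "(real \<Rightarrow> complex) \<Rightarrow> real \<Rightarrow> complex" where
  "ft h \<xi> = (LINT x|lborel. h x * cis (- (x * \<xi>)))"

lemma borel_measurable_cis [measurable (raw)]:
  "f \<in> borel_measurable M \<Longrightarrow> (\<lambda>x. cis (f x)) \<in> borel_measurable M"
  unfolding cis_conv_exp by measurable

lemma borel_measurable_cnj [measurable (raw)]: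
  "f \<in> borel_measurable M \<Longrightarrow> (\<lambda>x. cnj (f x)) \<in> borel_measurable M"
  by (rule borel_measurable_continuous_on[where f=cnj]) (intro continuous_intros)

lemma integrable_mult_cis:
  assumes "integrable lborel h" "t \<in> borel_measurable borel"
  shows "integrable lborel (\<lambda>x. h x * cis (t x))"
proof (rule Bochner_Integration.integrable_bound[OF assms(1)])
  have [measurable]: "h \<in> borel_measurable borel" "t \<in> borel_measurable borel"
    using assms by auto
  show "(\<lambda>x. h x * cis (t x)) \<in> borel_measurable lborel" by measurable
qed (simp add: norm_mult)

lemma ft_measurable [measurable (raw)]:
  assumes "h \<in> borel_measurable borel"
  shows "ft h \<in> borel_measurable borel"
proof -
  note [measurable] = assms
  have "(\<lambda>\<xi>. LINT x|lborel. h x * cis (- (x * \<xi>))) \<in> borel_measurable borel"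
    by (rule lborel.borel_measurable_lebesgue_integral) measurable
  then show ?thesis unfolding ft_def[abs_def] .
qed

lemma norm_ft_le: "norm (ft h \<xi>) \<le> (LINT x|lborel. norm (h x))"
proof -
  have "norm (ft h \<xi>) \<le> (LINT x|lborel. norm (h x * cis (- (x * \<xi>))))"
    unfolding ft_def by (rule integral_norm_bound)
  then show ?thesis by (simp add: norm_mult)
qed

lemma integrable_pair_mult_cis:
  assumes a: "integrable lborel a" and b: "integrable lborel b"
  shows "integrable (lborel \<Otimes>\<^sub>M lborel) (\<lambda>(x, \<xi>). a x * cis (- (x * \<xi>)) * b \<xi>)"
proof (rule lborel_pair.Fubini_integrable)
  have [measurable]: "a \<in> borel_measurable borel" "b \<in> borel_measurable borel" using a b by auto
  show "(\<lambda>(x, \<xi>). a x * cis (- (x * \<xi>)) * b \<xi>) \<in> borel_measurable (lborel \<Otimes>\<^sub>M lborel)"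
    by measurable
  show "integrable lborel (\<lambda>x. LINT y|lborel. norm (case (x, y) of (x, \<xi>) \<Rightarrow> a x * cis (- (x * \<xi>)) * b \<xi>))"
    using a by (simp add: norm_mult)
  show "AE x in lborel. integrable lborel (\<lambda>y. case (x, y) of (x, \<xi>) \<Rightarrow> a x * cis (- (x * \<xi>)) * b \<xi>)"
  proof (rule AE_I2)
    fix x
    have "integrable lborel (\<lambda>y. a x * (b y * cis (- (x * y))))"
      by (intro integrable_mult_right integrable_mult_cis b) measurable
    then show "integrable lborel (\<lambda>y. case (x, y) of (x, \<xi>) \<Rightarrow> a x * cis (- (x * \<xi>)) * b \<xi>)"
      by (simp add: mult_ac)
  qed
qed

text \<open>The multiplication formula, by Fubini. It drives both Plancherel and the adjoint
  relation from which surjectivity follows.\<close>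

lemma ft_exchange:
  assumes a: "integrable lborel a" and b: "integrable lborel b"
  shows "(LINT \<xi>|lborel. ft a \<xi> * b \<xi>) = (LINT x|lborel. a x * ft b x)"
proof -
  have "(LINT \<xi>|lborel. ft a \<xi> * b \<xi>) = (LINT \<xi>|lborel. LINT x|lborel. a x * cis (- (x * \<xi>)) * b \<xi>)"
    unfolding ft_def by simp
  also have "\<dots> = (LINT x|lborel. LINT \<xi>|lborel. a x * cis (- (x * \<xi>)) * b \<xi>)"
    by (rule lborel_pair.Fubini_integral[OF integrable_pair_mult_cis[OF a b]])
  also have "\<dots> = (LINT x|lborel. LINT \<xi>|lborel. a x * (b \<xi> * cis (- (\<xi> * x))))"
    by (simp add: mult_ac)
  also have "\<dots> = (LINT x|lborel. a x * ft b x)"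
    unfolding ft_def by simp
  finally show ?thesis .
qed

text \<open>The characteristic function of the standard normal law, rescaled;
  \<open>std_normal_density\<close> carries the normalisation that leaves no constant in front of
  the exponential.\<close>

lemma ft_gaussian:
  assumes "e > 0"
  shows "ft (\<lambda>x. complex_of_real (std_normal_density (e * x))) t = complex_of_real (exp (- ((t/e)^2/2)) / e)"
proof -
  have [measurable]: "std_normal_density \<in> borel_measurable borel" by measurable
  have "complex_of_real (exp (- ((-t/e)^2/2))) = char std_normal_distribution (-t/e)"
    by (simp add: char_std_normal_distribution)
  also have "\<dots> = (LINT x|lborel. std_normal_density x *\<^sub>R iexp (-t/e * x))"
    unfolding char_def by (subst integral_density) (auto simp: normal_density_nonneg)
  also have "\<dots> = \<bar>e\<bar> *\<^sub>R (LINT x|lborel. std_normal_density (0 + e * x) *\<^sub>R iexp (-t/e * (0 + e * x)))"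
    using assms by (intro lborel_integral_real_affine) auto
  also have "(LINT x|lborel. std_normal_density (0 + e * x) *\<^sub>R iexp (-t/e * (0 + e * x)))
      = ft (\<lambda>x. complex_of_real (std_normal_density (e * x))) t"
    unfolding ft_def using assms by (intro Bochner_Integration.integral_cong) (auto simp: scaleR_conv_of_real cis_conv_exp mult_ac)
  finally show ?thesis using assms by (simp add: scaleR_conv_of_real field_simps)
qed

lemma integrable_gaussian_scaled:
  assumes "e > 0" shows "integrable lborel (\<lambda>x. complex_of_real (std_normal_density (e * x)))"
  using lborel_integrable_real_affine[OF integrable_normal_density[of 1 0], of e 0] assms
  by (intro integrable_of_real) simp

lemma integrable_gaussian: "integrable lborel (\<lambda>z::real. exp (- (z^2/2)))"
  and integral_gaussian: "(LINT z|lborel. exp (- (z^2/2))) = sqrt (2*pi)"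
proof -
  have *: "exp (- (z^2/2)) = sqrt (2*pi) * std_normal_density z" for z :: real
    by (simp add: std_normal_density_def)
  show "integrable lborel (\<lambda>z::real. exp (- (z^2/2)))" unfolding * by simp
  show "(LINT z|lborel. exp (- (z^2/2))) = sqrt (2*pi)" unfolding * by simp
qed

lemma ft_real_reflect:
  "ft (\<lambda>x. complex_of_real (g x)) (- \<xi>) = cnj (ft (\<lambda>x. complex_of_real (g x)) \<xi>)"
proof -
  have "cnj (ft (\<lambda>x. complex_of_real (g x)) \<xi>) = (LINT x|lborel. cnj (complex_of_real (g x) * cis (- (x * \<xi>))))"
    unfolding ft_def by (simp only: Bochner_Integration.integral_cnj)
  then show ?thesis by (simp add: ft_def cis_cnj)
qed

text \<open>The Gaussian weight makes the left integral finite before the transform is known to be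
  square integrable. The multiplication formula moves one transform onto cnj (ft g) times the
  Gaussian; the transform of that product is a Gaussian average of translates of g, and Fubini
  leaves an average of the autocorrelation at lag e z.\<close>

lemma plancherel_regularized:
  fixes g :: "real \<Rightarrow> real"
  assumes g: "integrable lborel g" and L: "L2fun g" and e: "e > 0"
  shows "complex_of_real (LINT \<xi>|lborel. (norm (ft (\<lambda>x. of_real (g x)) \<xi>))^2 * std_normal_density (e * \<xi>))
     = complex_of_real (LINT z|lborel. exp (- (z^2/2)) * (LINT x|lborel. g x * g (x + e * z)))"
proof -
  define G where "G x = complex_of_real (g x)" for x
  define E where "E x = complex_of_real (std_normal_density (e * x))" for x
  have G: "integrable lborel G" unfolding G_def using g by simp
  have E: "integrable lborel E" unfolding E_def using integrable_gaussian_scaled[OF e] .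
  have [measurable]: "g \<in> borel_measurable borel" "G \<in> borel_measurable borel" "E \<in> borel_measurable borel"
    using g G E by auto
  have E_even: "E (- x) = E x" for x by (simp add: E_def std_normal_density_def)
  have int_FE: "integrable lborel (\<lambda>\<xi>. cnj (ft G \<xi>) * E \<xi>)"
  proof (rule Bochner_Integration.integrable_bound)
    show "integrable lborel (\<lambda>\<xi>. (LINT x|lborel. norm (G x)) * norm (E \<xi>))" using E by simp
    show "AE x in lborel. norm (cnj (ft G x) * E x) \<le> norm ((LINT x|lborel. norm (G x)) * norm (E x))"
      using norm_ft_le[of G] by (auto simp: norm_mult intro!: mult_right_mono order_trans[OF _ abs_ge_self])
    show "(\<lambda>\<xi>. cnj (ft G \<xi>) * E \<xi>) \<in> borel_measurable lborel" 
      by (intro borel_measurable_times borel_measurable_cnj) (auto intro: ft_measurable)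
  qed
  have inner: "ft (\<lambda>\<xi>. cnj (ft G \<xi>) * E \<xi>) x = complex_of_real (LINT z|lborel. g (x + e * z) * exp (- (z^2/2)))" for x
  proof -
    have iE: "integrable lborel (\<lambda>\<xi>. E \<xi> * cis (\<xi> * x))"
      by (rule integrable_mult_cis[OF E]) measurable
    \<comment> \<open>For real g, reflection is conjugation of the transform, so substituting -xi
      removes the conjugate and leaves a form to which \<open>ft_exchange\<close> applies.\<close>
    have "ft (\<lambda>\<xi>. cnj (ft G \<xi>) * E \<xi>) x = (LINT \<xi>|lborel. cnj (ft G (- \<xi>)) * E (- \<xi>) * cis (- ((- \<xi>) * x)))"
      unfolding ft_def[of "\<lambda>\<xi>. cnj (ft G \<xi>) * E \<xi>"]
      by (rule integral_reflect[symmetric])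
    also have "\<dots> = (LINT \<xi>|lborel. ft G \<xi> * (E \<xi> * cis (\<xi> * x)))"
      unfolding G_def ft_real_reflect E_even by (simp add: mult_ac)
    also have "\<dots> = (LINT y|lborel. G y * ft (\<lambda>\<xi>. E \<xi> * cis (\<xi> * x)) y)"
      by (rule ft_exchange[OF G iE])
    also have "(\<lambda>y. ft (\<lambda>\<xi>. E \<xi> * cis (\<xi> * x)) y) = (\<lambda>y. ft E (y - x))"
      by (auto simp: ft_def mult.assoc cis_mult algebra_simps fun_eq_iff)
    also have "(LINT y|lborel. G y * ft E (y - x)) = (LINT y|lborel. complex_of_real (g y * (exp (- (((y-x)/e)^2/2)) / e)))"
      unfolding E_def[abs_def] G_def ft_gaussian[OF e] by simp
    also have "\<dots> = complex_of_real (LINT y|lborel. g y * (exp (- (((y-x)/e)^2/2)) / e))"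
      by (rule integral_complex_of_real)
    \<comment> \<open>Substitution y = x + e z; the Jacobian e cancels the factor 1/e of the
      transformed Gaussian.\<close>
    also have "(LINT y|lborel. g y * (exp (- (((y-x)/e)^2/2)) / e))
        = \<bar>e\<bar> *\<^sub>R (LINT z|lborel. g (x + e * z) * (exp (- (((x + e * z - x)/e)^2/2)) / e))"
      using e by (intro lborel_integral_real_affine) auto
    also have "\<dots> = (LINT z|lborel. g (x + e * z) * exp (- (z^2/2)))"
      using e by simp
    finally show ?thesis .
  qed
  have Ga: "L2fun (\<lambda>x. g (x + e * z))" for z by (rule L2fun_shift[OF L])
  have int_pair: "integrable (lborel \<Otimes>\<^sub>M lborel) (\<lambda>(z, x). g x * (g (x + e * z) * exp (- (z^2/2))))"
  proof (rule lborel_pair.Fubini_integrable)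
    show "(\<lambda>(z, x). g x * (g (x + e * z) * exp (- (z^2/2)))) \<in> borel_measurable (lborel \<Otimes>\<^sub>M lborel)"
      by measurable
    show "AE z in lborel. integrable lborel (\<lambda>x. case (z, x) of (z, x) \<Rightarrow> g x * (g (x + e * z) * exp (- (z^2/2))))"
      using L2fun_mult_integrable[OF L Ga] by (auto simp: mult.assoc[symmetric])
    show "integrable lborel (\<lambda>z. LINT x|lborel. norm (case (z, x) of (z, x) \<Rightarrow> g x * (g (x + e * z) * exp (- (z^2/2)))))"
    proof (rule Bochner_Integration.integrable_bound)
      show "integrable lborel (\<lambda>z. l2sq g * exp (- (z^2/2)))" using integrable_gaussian by simp
      show "(\<lambda>z. LINT x|lborel. norm (case (z, x) of (z, x) \<Rightarrow> g x * (g (x + e * z) * exp (- (z^2/2)))))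
          \<in> borel_measurable lborel"
        by measurable
      show "AE z in lborel. norm (LINT x|lborel. norm (case (z, x) of (z, x) \<Rightarrow> g x * (g (x + e * z) * exp (- (z^2/2)))))
         \<le> norm (l2sq g * exp (- (z^2/2)))"
      proof (rule AE_I2)
        fix z
        have "(LINT x|lborel. norm (case (z, x) of (z, x) \<Rightarrow> g x * (g (x + e * z) * exp (- (z^2/2)))))
          = (LINT x|lborel. norm (g x) * norm (g (x + e * z))) * exp (- (z^2/2))"
          by (simp add: abs_mult mult.assoc[symmetric])
        also have "\<dots> \<le> (sqrt (l2sq g) * sqrt (l2sq (\<lambda>x. g (x + e * z)))) * exp (- (z^2/2))"
          by (intro mult_right_mono L2_Cauchy_Schwarz L Ga) auto
        also have "\<dots> = l2sq g * exp (- (z^2/2))" by (simp add: l2sq_shift)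
        finally show "norm (LINT x|lborel. norm (case (z, x) of (z, x) \<Rightarrow> g x * (g (x + e * z) * exp (- (z^2/2)))))
         \<le> norm (l2sq g * exp (- (z^2/2)))" by (auto simp: abs_of_nonneg integral_nonneg_AE)
      qed
    qed
  qed
  have "complex_of_real (LINT \<xi>|lborel. (norm (ft G \<xi>))^2 * std_normal_density (e * \<xi>))
     = (LINT \<xi>|lborel. complex_of_real ((norm (ft G \<xi>))^2 * std_normal_density (e * \<xi>)))"
    by (rule integral_complex_of_real[symmetric])
  also have "\<dots> = (LINT \<xi>|lborel. ft G \<xi> * (cnj (ft G \<xi>) * E \<xi>))"
    by (simp add: E_def complex_norm_square mult.assoc del: of_real_power)
  also have "\<dots> = (LINT x|lborel. G x * ft (\<lambda>\<xi>. cnj (ft G \<xi>) * E \<xi>) x)"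
    by (rule ft_exchange[OF G int_FE])
  also have "\<dots> = (LINT x|lborel. complex_of_real (g x * (LINT z|lborel. g (x + e * z) * exp (- (z^2/2)))))"
    unfolding inner by (simp add: G_def)
  also have "\<dots> = complex_of_real (LINT x|lborel. g x * (LINT z|lborel. g (x + e * z) * exp (- (z^2/2))))"
    by (rule integral_complex_of_real)
  also have "(LINT x|lborel. g x * (LINT z|lborel. g (x + e * z) * exp (- (z^2/2))))
    = (LINT x|lborel. LINT z|lborel. g x * (g (x + e * z) * exp (- (z^2/2))))" by simp
  also have "\<dots> = (LINT z|lborel. LINT x|lborel. g x * (g (x + e * z) * exp (- (z^2/2))))"
    by (rule lborel_pair.Fubini_integral[OF int_pair])
  also have "\<dots> = (LINT z|lborel. exp (- (z^2/2)) * (LINT x|lborel. g x * g (x + e * z)))"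
    by (simp add: mult_ac flip: integral_mult_right_zero)
  finally show ?thesis unfolding G_def .
qed

text \<open>Let e tend to 0 in \<open>plancherel_regularized\<close>. The left side tends to 1/sqrt
  (2 pi) times the squared norm of the transform, the right side to sqrt (2 pi) times that of g; the
  quotient of the constants is 2 pi.\<close>

theorem plancherel_integrable:
  fixes g :: "real \<Rightarrow> real"
  assumes g: "integrable lborel g" and L: "L2fun g"
  shows "L2fun (ft (\<lambda>x. of_real (g x)))" and "l2sq (ft (\<lambda>x. of_real (g x))) = 2 * pi * l2sq g"
proof -
  define H where "H = ft (\<lambda>x. complex_of_real (g x))"
  define e where "e n = 1 / real (Suc n)" for n
  have e: "e n > 0" "e n \<le> 1" for n by (auto simp: e_def)
  have e0: "e \<longlonglongrightarrow> 0" unfolding e_def by (rule LIMSEQ_Suc[OF lim_1_over_n])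
  have [measurable]: "g \<in> borel_measurable borel" using g by auto
  have [measurable]: "H \<in> borel_measurable borel" unfolding H_def by measurable
  define J where "J n = (LINT z|lborel. exp (- (z^2/2)) * (LINT x|lborel. g x * g (x + e n * z)))" for n
  have reg: "(LINT \<xi>|lborel. (norm (H \<xi>))^2 * std_normal_density (e n * \<xi>)) = J n" for n
    using plancherel_regularized[OF g L e(1)] unfolding H_def J_def of_real_eq_iff .
  have J: "J \<longlonglongrightarrow> (LINT z|lborel. exp (- (z^2/2)) * l2sq g)"
    unfolding J_def
  proof (rule integral_dominated_convergence)
    show "integrable lborel (\<lambda>z. exp (- (z^2/2)) * l2sq g)" using integrable_gaussian by simp
    show "AE z in lborel. (\<lambda>n. exp (- (z^2/2)) * (LINT x|lborel. g x * g (x + e n * z))) \<longlonglongrightarrow> exp (- (z^2/2)) * l2sq g"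
    proof (rule AE_I2)
      fix z :: real
      have "(\<lambda>n. e n * z) \<longlonglongrightarrow> 0" using tendsto_mult_right[OF e0, of z] by simp
      then show "(\<lambda>n. exp (- (z^2/2)) * (LINT x|lborel. g x * g (x + e n * z))) \<longlonglongrightarrow> exp (- (z^2/2)) * l2sq g"
        by (intro tendsto_intros autocorrelation_continuous L)
    qed
    fix n
    show "AE z in lborel. norm (exp (- (z^2/2)) * (LINT x|lborel. g x * g (x + e n * z))) \<le> exp (- (z^2/2)) * l2sq g"
    proof (rule AE_I2)
      fix z :: real
      have "\<bar>LINT x|lborel. g x * g (x + e n * z)\<bar> \<le> l2sq g"
        using l2ip_le[OF L L2fun_shift[OF L, of "e n * z"]] by (simp add: l2sq_shift l2ip_def)
      then show "norm (exp (- (z^2/2)) * (LINT x|lborel. g x * g (x + e n * z))) \<le> exp (- (z^2/2)) * l2sq g"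
        by (simp add: abs_mult)
    qed
  qed measurable
  then have J': "J \<longlonglongrightarrow> sqrt (2*pi) * l2sq g" by (simp add: integral_gaussian)
  obtain B where B: "\<And>n. \<bar>J n\<bar> \<le> B"
    using convergent_imp_Bseq[OF convergentI[OF J]] by (auto simp: Bseq_def)
  have E0: "std_normal_density (e n * x) \<le> 1 / sqrt (2*pi)" for n x
    by (simp add: std_normal_density_def divide_right_mono)
  have Elim: "(\<lambda>n. std_normal_density (e n * x)) \<longlonglongrightarrow> 1 / sqrt (2*pi)" for x
  proof -
    have "(\<lambda>n. 1 / sqrt (2*pi) * exp (- ((e n * x)^2) / 2)) \<longlonglongrightarrow> 1 / sqrt (2*pi) * exp (- ((0 * x)^2) / 2)"
      by (intro tendsto_intros e0) auto
    then show ?thesis unfolding std_normal_density_def by simp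
  qed
  \<comment> \<open>The square root of the Gaussian factor gives \<open>l2sq (f n) = J n\<close>, a
    bounded sequence. Fatou then shows that \<open>H\<close> is square integrable, which the
    dominated convergence on the left side presupposes.\<close>
  define f where "f n \<xi> = sqrt (std_normal_density (e n * \<xi>)) *\<^sub>R H \<xi>" for n \<xi>
  have [measurable]: "f n \<in> borel_measurable borel" for n unfolding f_def by measurable
  have f2: "(norm (f n \<xi>))^2 = (norm (H \<xi>))^2 * std_normal_density (e n * \<xi>)" for n \<xi>
    by (simp add: f_def power_mult_distrib mult.commute)
  have fL: "L2fun (f n)" for n
  proof (rule L2funI)
    show "integrable lborel (\<lambda>x. (norm (f n x))^2)"
    proof (rule Bochner_Integration.integrable_bound)
      show "integrable lborel (\<lambda>\<xi>. (LINT x|lborel. norm (complex_of_real (g x)))^2 * norm (complex_of_real (std_normal_density (e n * \<xi>))))"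
        using integrable_gaussian_scaled[OF e(1)[of n]] by (intro integrable_mult_right integrable_norm) 
      show "AE \<xi> in lborel. norm ((norm (f n \<xi>))^2) \<le> norm ((LINT x|lborel. norm (complex_of_real (g x)))^2 * norm (complex_of_real (std_normal_density (e n * \<xi>))))"
        unfolding f2 using norm_ft_le[of "\<lambda>x. complex_of_real (g x)"]
        by (auto simp: H_def intro!: mult_right_mono power_mono AE_I2)
    qed measurable
  qed measurable
  have fJ: "l2sq (f n) = J n" for n unfolding l2sq_def f2 reg ..
  have L': "L2fun (\<lambda>\<xi>. sqrt (1 / sqrt (2*pi)) *\<^sub>R H \<xi>)"
  proof (rule L2_Fatou(1)[OF fL])
    show "AE x in lborel. (\<lambda>n. f n x) \<longlonglongrightarrow> sqrt (1 / sqrt (2*pi)) *\<^sub>R H x"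
      unfolding f_def by (intro AE_I2 tendsto_intros Elim)
    show "\<forall>\<^sub>F n in sequentially. l2sq (f n) \<le> B"
      using B fJ by (auto intro!: always_eventually) (metis abs_le_iff)
  qed measurable
  from L2fun_scaleR[OF this, of "1 / sqrt (1 / sqrt (2*pi))"] have LH: "L2fun H" by simp
  then show "L2fun (ft (\<lambda>x. of_real (g x)))" unfolding H_def .
  have "(\<lambda>n. LINT \<xi>|lborel. (norm (H \<xi>))^2 * std_normal_density (e n * \<xi>)) \<longlonglongrightarrow> (LINT \<xi>|lborel. (norm (H \<xi>))^2 * (1 / sqrt (2*pi)))"
  proof (rule integral_dominated_convergence)
    show "integrable lborel (\<lambda>\<xi>. (norm (H \<xi>))^2 * (1 / sqrt (2*pi)))" using LH by (simp add: L2fun_def)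
    show "AE x in lborel. (\<lambda>i. (cmod (H x))\<^sup>2 * std_normal_density (e i * x)) \<longlonglongrightarrow> (cmod (H x))\<^sup>2 * (1 / sqrt (2 * pi))"
      by (intro AE_I2 tendsto_intros Elim)
    show "AE x in lborel. norm ((cmod (H x))\<^sup>2 * std_normal_density (e i * x)) \<le> (cmod (H x))\<^sup>2 * (1 / sqrt (2 * pi))" for i
    proof (rule AE_I2)
      fix x
      show "norm ((cmod (H x))\<^sup>2 * std_normal_density (e i * x)) \<le> (cmod (H x))\<^sup>2 * (1 / sqrt (2 * pi))"
        using mult_left_mono[OF E0, of "(cmod (H x))\<^sup>2"] by (simp add: abs_mult)
    qed
  qed measurable
  then have "J \<longlonglongrightarrow> l2sq H * (1 / sqrt (2*pi))" unfolding reg l2sq_def by simp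
  then have "l2sq H * (1 / sqrt (2*pi)) = sqrt (2*pi) * l2sq g" using J' by (rule LIMSEQ_unique)
  then have "l2sq H = (sqrt (2*pi) * sqrt (2*pi)) * l2sq g" by (simp add: field_simps)
  then show "l2sq (ft (\<lambda>x. of_real (g x))) = 2 * pi * l2sq g" unfolding H_def by simp
qed


subsection \<open>The Fourier transform on square integrable functions\<close>

definition cutoff :: "real \<Rightarrow> (real \<Rightarrow> real) \<Rightarrow> real \<Rightarrow> real" where
  "cutoff R u x = indicator {-R..R} x * u x"

lemma trunc_fourier_eq_ft: "trunc_fourier u R = ft (\<lambda>x. complex_of_real (cutoff R u x))"
  unfolding trunc_fourier_def ft_def cutoff_def set_lebesgue_integral_def
  by (auto simp: fun_eq_iff scaleR_conv_of_real mult.assoc)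

lemma cutoff_le: "\<bar>cutoff R u x\<bar> \<le> \<bar>u x\<bar>" "\<bar>cutoff R u x - u x\<bar> \<le> \<bar>u x\<bar>"
  by (auto simp: cutoff_def indicator_def)

lemma cutoff_measurable [measurable (raw)]:
  "u \<in> borel_measurable borel \<Longrightarrow> cutoff R u \<in> borel_measurable borel"
  unfolding cutoff_def[abs_def] by measurable

lemma L2fun_cutoff:
  assumes "L2fun u" shows "L2fun (cutoff R u)"
proof (rule L2fun_bound[OF _ L2fun_integrable[OF assms]])
  show "cutoff R u \<in> borel_measurable borel"
    using L2fun_measurable[OF assms] by (rule cutoff_measurable)
qed (auto simp: abs_le_square_iff[symmetric] cutoff_le)

lemma integrable_cutoff:
  assumes "L2fun u" shows "integrable lborel (cutoff R u)"
proof -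
  have i: "L2fun (\<lambda>x. indicator {-R..R} x :: real)"
  proof (rule L2fun_bound)
    show "integrable lborel (\<lambda>x. indicator {-R..R} x * 1 :: real)" by (rule integrable_indicator_interval)
  qed (auto simp: indicator_def)
  show ?thesis using L2fun_mult_integrable[OF i assms] unfolding cutoff_def[abs_def] .
qed

lemma cutoff_tendsto:
  assumes L: "L2fun u"
  shows "((\<lambda>R. l2sq (\<lambda>x. cutoff R u x - u x)) \<longlongrightarrow> 0) at_top"
proof (rule tendsto_at_topI_sequentially)
  fix X :: "nat \<Rightarrow> real" assume X: "filterlim X at_top sequentially"
  have [measurable]: "u \<in> borel_measurable borel" by (rule L2fun_measurable[OF L])
  show "(\<lambda>n. l2sq (\<lambda>x. cutoff (X n) u x - u x)) \<longlonglongrightarrow> 0"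
  proof (rule l2_dominated[OF _ L2fun_integrable[OF L]])
    show "AE x in lborel. (\<lambda>n. cutoff (X n) u x - u x) \<longlonglongrightarrow> 0"
    proof (rule AE_I2)
      fix x
      have "\<forall>\<^sub>F n in sequentially. \<bar>x\<bar> \<le> X n" using X by (simp add: filterlim_at_top)
      then have "\<forall>\<^sub>F n in sequentially. cutoff (X n) u x - u x = 0"
        by eventually_elim (auto simp: cutoff_def indicator_def)
      then show "(\<lambda>n. cutoff (X n) u x - u x) \<longlonglongrightarrow> 0" by (rule tendsto_eventually)
    qed
  qed (auto simp: abs_le_square_iff[symmetric] cutoff_le)
qed

lemma cutoff_tendsto_seq:
  assumes L: "L2fun u"
  shows "(\<lambda>n. l2sq (\<lambda>x. cutoff (real n) u x - u x)) \<longlonglongrightarrow> 0"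
  using filterlim_compose[OF cutoff_tendsto[OF L] filterlim_real_sequentially] .

lemma ft_add:
  assumes "integrable lborel a" "integrable lborel b"
  shows "ft (\<lambda>x. a x + b x) \<xi> = ft a \<xi> + ft b \<xi>"
proof -
  have "integrable lborel (\<lambda>x. a x * cis (- (x * \<xi>)))" "integrable lborel (\<lambda>x. b x * cis (- (x * \<xi>)))"
    using assms by (auto intro!: integrable_mult_cis)
  then show ?thesis by (simp add: ft_def ring_distribs)
qed

lemma ft_diff:
  assumes "integrable lborel a" "integrable lborel b"
  shows "ft (\<lambda>x. a x - b x) \<xi> = ft a \<xi> - ft b \<xi>"
proof -
  have "integrable lborel (\<lambda>x. a x * cis (- (x * \<xi>)))" "integrable lborel (\<lambda>x. b x * cis (- (x * \<xi>)))"
    using assms by (auto intro!: integrable_mult_cis)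
  then show ?thesis by (simp add: ft_def ring_distribs)
qed

lemma ft_cmult: "ft (\<lambda>x. c * a x) \<xi> = c * ft a \<xi>"
  by (simp add: ft_def mult.assoc)

lemma l2sq_ft_diff:
  fixes a b :: "real \<Rightarrow> real"
  assumes "integrable lborel a" "integrable lborel b" "L2fun a" "L2fun b"
  shows "l2sq (\<lambda>\<xi>. ft (\<lambda>x. of_real (a x)) \<xi> - ft (\<lambda>x. of_real (b x)) \<xi>) = 2 * pi * l2sq (\<lambda>x. a x - b x)"
proof -
  have "(\<lambda>\<xi>. ft (\<lambda>x. of_real (a x)) \<xi> - ft (\<lambda>x. of_real (b x)) \<xi>) = ft (\<lambda>x. of_real (a x - b x))"
    using assms by (simp add: ft_diff fun_eq_iff)
  then show ?thesis
    using plancherel_integrable(2)[of "\<lambda>x. a x - b x"] assms by (simp add: L2fun_diff)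
qed

lemma L2fun_trunc_fourier: "L2fun u \<Longrightarrow> L2fun (trunc_fourier u R)"
  unfolding trunc_fourier_eq_ft by (intro plancherel_integrable integrable_cutoff L2fun_cutoff)

lemma l2sq_trunc_diff:
  "L2fun u \<Longrightarrow> l2sq (\<lambda>\<xi>. trunc_fourier u R \<xi> - trunc_fourier u S \<xi>) = 2 * pi * l2sq (\<lambda>x. cutoff R u x - cutoff S u x)"
  unfolding trunc_fourier_eq_ft by (intro l2sq_ft_diff integrable_cutoff L2fun_cutoff)

lemma l2norm_triangle3:
  assumes "L2fun f" "L2fun g" "L2fun h"
  shows "sqrt (l2sq (\<lambda>x. f x - h x)) \<le> sqrt (l2sq (\<lambda>x. f x - g x)) + sqrt (l2sq (\<lambda>x. g x - h x))"
  using l2norm_triangle[OF L2fun_diff[OF assms(1,2)] L2fun_diff[OF assms(2,3)]] by simp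

text \<open>Integer truncations are Cauchy by Plancherel for integrable functions. The estimate is
  proved for every real \<open>R\<close>, since the definition of \<open>fourier\<close> asks for a
  limit along real radii.\<close>

lemma ex_fourier:
  assumes L: "L2fun u"
  obtains g where "L2fun g" "\<And>R. sqrt (l2sq (\<lambda>\<xi>. g \<xi> - trunc_fourier u R \<xi>)) \<le> sqrt (2 * pi * l2sq (\<lambda>x. cutoff R u x - u x))"
proof -
  define T where "T n = trunc_fourier u (real n)" for n
  have LT: "L2fun (T n)" for n unfolding T_def by (rule L2fun_trunc_fourier[OF L])
  have C0: "(\<lambda>n. sqrt (l2sq (\<lambda>x. cutoff (real n) u x - u x))) \<longlonglongrightarrow> sqrt 0"
    by (intro tendsto_intros cutoff_tendsto_seq L)
  have "\<exists>N. \<forall>m\<ge>N. \<forall>n\<ge>N. l2sq (\<lambda>x. T m x - T n x) \<le> e" if "e > 0" for e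
  proof -
    have "sqrt (e / (2*pi)) / 2 > 0" using that by simp
    with C0 have "\<forall>\<^sub>F n in sequentially. sqrt (l2sq (\<lambda>x. cutoff (real n) u x - u x)) < sqrt (e / (2*pi)) / 2"
      by (intro order_tendstoD) auto
    then obtain N where N: "\<And>n. n \<ge> N \<Longrightarrow> sqrt (l2sq (\<lambda>x. cutoff (real n) u x - u x)) < sqrt (e / (2*pi)) / 2"
      by (auto simp: eventually_sequentially)
    have "l2sq (\<lambda>x. T m x - T n x) \<le> e" if "m \<ge> N" "n \<ge> N" for m n
    proof -
      have "sqrt (l2sq (\<lambda>x. cutoff (real m) u x - cutoff (real n) u x)) \<le>
          sqrt (l2sq (\<lambda>x. cutoff (real m) u x - u x)) + sqrt (l2sq (\<lambda>x. u x - cutoff (real n) u x))"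
        by (intro l2norm_triangle3 L2fun_cutoff L)
      also have "\<dots> \<le> sqrt (e / (2*pi))"
        using N[OF that(1)] N[OF that(2)] unfolding l2sq_diff_commute[of u] by linarith
      finally have "l2sq (\<lambda>x. cutoff (real m) u x - cutoff (real n) u x) \<le> e / (2*pi)" by simp
      then show ?thesis unfolding T_def l2sq_trunc_diff[OF L] by (simp add: field_simps)
    qed
    then show ?thesis by blast
  qed
  from L2_complete[OF LT this] obtain g where g: "L2fun g" "(\<lambda>n. l2sq (\<lambda>x. T n x - g x)) \<longlonglongrightarrow> 0" by blast
  show ?thesis
  proof (rule that[OF g(1)])
    fix R
    define b where "b n = sqrt (l2sq (\<lambda>x. T n x - g x)) + sqrt (2*pi) * (sqrt (l2sq (\<lambda>x. cutoff (real n) u x - u x))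
      + sqrt (l2sq (\<lambda>x. cutoff R u x - u x)))" for n
    have "b \<longlonglongrightarrow> sqrt 0 + sqrt (2*pi) * (sqrt 0 + sqrt (l2sq (\<lambda>x. cutoff R u x - u x)))"
      unfolding b_def by (intro tendsto_intros g(2) cutoff_tendsto_seq L)
    then have "b \<longlonglongrightarrow> sqrt (2 * pi * l2sq (\<lambda>x. cutoff R u x - u x))" by (simp add: real_sqrt_mult)
    moreover have "sqrt (l2sq (\<lambda>\<xi>. g \<xi> - trunc_fourier u R \<xi>)) \<le> b n" for n
    proof -
      have "sqrt (l2sq (\<lambda>\<xi>. g \<xi> - trunc_fourier u R \<xi>)) \<le> sqrt (l2sq (\<lambda>\<xi>. g \<xi> - T n \<xi>)) + sqrt (l2sq (\<lambda>\<xi>. T n \<xi> - trunc_fourier u R \<xi>))"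
        by (intro l2norm_triangle3 g LT L2fun_trunc_fourier L)
      moreover have "sqrt (l2sq (\<lambda>\<xi>. T n \<xi> - trunc_fourier u R \<xi>)) = sqrt (2*pi) * sqrt (l2sq (\<lambda>x. cutoff (real n) u x - cutoff R u x))"
        unfolding T_def l2sq_trunc_diff[OF L] by (simp add: real_sqrt_mult)
      moreover have "sqrt (l2sq (\<lambda>x. cutoff (real n) u x - cutoff R u x)) \<le>
          sqrt (l2sq (\<lambda>x. cutoff (real n) u x - u x)) + sqrt (l2sq (\<lambda>x. u x - cutoff R u x))"
        by (intro l2norm_triangle3 L2fun_cutoff L)
      ultimately show ?thesis unfolding b_def l2sq_diff_commute[of g] l2sq_diff_commute[of u]
        by (smt (verit) mult_left_mono real_sqrt_ge_zero pi_ge_zero)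
    qed
    ultimately show "sqrt (l2sq (\<lambda>\<xi>. g \<xi> - trunc_fourier u R \<xi>)) \<le> sqrt (2 * pi * l2sq (\<lambda>x. cutoff R u x - u x))"
      by (intro LIMSEQ_le_const) auto
  qed
qed

text \<open>Discharges the choice in \<open>fourier\<close>: the function of
  \<open>ex_fourier\<close> satisfies the defining predicate, so the chosen one does too.\<close>

lemma fourier_spec:
  assumes L: "L2fun u"
  shows L2fun_fourier: "L2fun (fourier u)"
    and fourier_limit: "((\<lambda>R. l2sq (\<lambda>\<xi>. fourier u \<xi> - trunc_fourier u R \<xi>)) \<longlongrightarrow> 0) at_top"
proof -
  let ?P = "\<lambda>g. L2fun g \<and>
      (\<forall>\<^sub>F R in at_top. integrable lborel (\<lambda>\<xi>. (cmod (g \<xi> - trunc_fourier u R \<xi>))^2)) \<and>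
      ((\<lambda>R. LINT \<xi>|lborel. (cmod (g \<xi> - trunc_fourier u R \<xi>))^2) \<longlongrightarrow> 0) at_top"
  obtain g where g: "L2fun g" "\<And>R. sqrt (l2sq (\<lambda>\<xi>. g \<xi> - trunc_fourier u R \<xi>)) \<le> sqrt (2 * pi * l2sq (\<lambda>x. cutoff R u x - u x))"
    using ex_fourier[OF L] by blast
  have "((\<lambda>R. l2sq (\<lambda>\<xi>. g \<xi> - trunc_fourier u R \<xi>)) \<longlongrightarrow> 0) at_top"
  proof (rule Lim_null_comparison)
    show "\<forall>\<^sub>F R in at_top. norm (l2sq (\<lambda>\<xi>. g \<xi> - trunc_fourier u R \<xi>)) \<le> 2 * pi * l2sq (\<lambda>x. cutoff R u x - u x)"
      using g(2) by (intro always_eventually) auto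
    show "((\<lambda>R. 2 * pi * l2sq (\<lambda>x. cutoff R u x - u x)) \<longlongrightarrow> 0) at_top"
      using tendsto_mult_left[OF cutoff_tendsto[OF L], of "2*pi"] by simp
  qed
  then have "?P g"
    using g(1) L2fun_integrable[OF L2fun_diff[OF g(1) L2fun_trunc_fourier[OF L]]] by (simp add: l2sq_def)
  then have "?P (fourier u)" unfolding fourier_def by (rule someI[of ?P])
  then show "L2fun (fourier u)" "((\<lambda>R. l2sq (\<lambda>\<xi>. fourier u \<xi> - trunc_fourier u R \<xi>)) \<longlongrightarrow> 0) at_top"
    by (auto simp: l2sq_def)
qed

lemma fourier_limit_seq:
  "L2fun u \<Longrightarrow> (\<lambda>n. l2sq (\<lambda>\<xi>. fourier u \<xi> - trunc_fourier u (real n) \<xi>)) \<longlonglongrightarrow> 0"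
  using filterlim_compose[OF fourier_limit filterlim_real_sequentially] .

lemma L2_limit_unique:
  assumes "L2fun f" "L2fun g" "\<And>n. L2fun (h n)"
    "(\<lambda>n. l2sq (\<lambda>x. f x - h n x)) \<longlonglongrightarrow> 0" "(\<lambda>n. l2sq (\<lambda>x. g x - h n x)) \<longlonglongrightarrow> 0"
  shows "AE x in lborel. f x = g x"
proof -
  have "(\<lambda>n. sqrt (l2sq (\<lambda>x. f x - h n x)) + sqrt (l2sq (\<lambda>x. g x - h n x))) \<longlonglongrightarrow> sqrt 0 + sqrt 0"
    by (intro tendsto_intros assms)
  moreover have "sqrt (l2sq (\<lambda>x. f x - g x)) \<le> sqrt (l2sq (\<lambda>x. f x - h n x)) + sqrt (l2sq (\<lambda>x. g x - h n x))" for n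
    using l2norm_triangle3[OF assms(1) assms(3)[of n] assms(2)] unfolding l2sq_diff_commute[of "h n" g] .
  ultimately have "sqrt (l2sq (\<lambda>x. f x - g x)) \<le> sqrt 0 + sqrt 0"
    by (intro LIMSEQ_le_const) auto
  then have "l2sq (\<lambda>x. f x - g x) \<le> 0" by simp
  then have "l2sq (\<lambda>x. f x - g x) = 0" using l2sq_nonneg by (intro antisym)
  then show ?thesis by (simp add: l2sq_eq_0_iff L2fun_diff assms)
qed

text \<open>The means of computing transforms: exhibit an L2 function to which the integer
  truncations converge.\<close>

lemma fourier_unique:
  assumes "L2fun u" "L2fun g" "(\<lambda>n. l2sq (\<lambda>\<xi>. g \<xi> - trunc_fourier u (real n) \<xi>)) \<longlonglongrightarrow> 0"
  shows "AE \<xi> in lborel. fourier u \<xi> = g \<xi>"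
  using L2_limit_unique[OF L2fun_fourier[OF assms(1)] assms(2) L2fun_trunc_fourier[OF assms(1)] fourier_limit_seq[OF assms(1)] assms(3)] .

lemma l2norm_tendsto:
  assumes "L2fun f" "\<And>n. L2fun (h n)" "(\<lambda>n. l2sq (\<lambda>x. f x - h n x)) \<longlonglongrightarrow> 0"
  shows "(\<lambda>n. sqrt (l2sq (h n))) \<longlonglongrightarrow> sqrt (l2sq f)"
proof (rule Lim_transform2[OF tendsto_const])
  have "(\<lambda>n. sqrt (l2sq (\<lambda>x. f x - h n x))) \<longlonglongrightarrow> sqrt 0" by (intro tendsto_intros assms)
  then have *: "(\<lambda>n. sqrt (l2sq (\<lambda>x. f x - h n x))) \<longlonglongrightarrow> 0" by simp
  show "(\<lambda>n. sqrt (l2sq f) - sqrt (l2sq (h n))) \<longlonglongrightarrow> 0"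
    by (rule Lim_null_comparison[OF _ *]) (use l2norm_triangle_diff[OF assms(1,2)] in simp)
qed

theorem plancherel:
  assumes L: "L2fun u" shows "l2sq (fourier u) = 2 * pi * l2sq u"
proof -
  have "(\<lambda>n. sqrt (l2sq (trunc_fourier u (real n)))) \<longlonglongrightarrow> sqrt (l2sq (fourier u))"
    by (rule l2norm_tendsto[OF L2fun_fourier[OF L] L2fun_trunc_fourier[OF L] fourier_limit_seq[OF L]])
  moreover have "sqrt (l2sq (trunc_fourier u (real n))) = sqrt (2*pi) * sqrt (l2sq (cutoff (real n) u))" for n
    unfolding trunc_fourier_eq_ft
    by (simp add: plancherel_integrable(2) integrable_cutoff L2fun_cutoff L real_sqrt_mult)
  ultimately have 1: "(\<lambda>n. sqrt (2*pi) * sqrt (l2sq (cutoff (real n) u))) \<longlonglongrightarrow> sqrt (l2sq (fourier u))"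
    by simp
  have 2: "(\<lambda>n. sqrt (2*pi) * sqrt (l2sq (cutoff (real n) u))) \<longlonglongrightarrow> sqrt (2*pi) * sqrt (l2sq u)"
    by (intro tendsto_intros l2norm_tendsto[OF L L2fun_cutoff[OF L]])
       (use cutoff_tendsto_seq[OF L] in \<open>simp add: l2sq_diff_commute[of u]\<close>)
  have "sqrt (l2sq (fourier u)) = sqrt (2*pi) * sqrt (l2sq u)"
    by (rule LIMSEQ_unique[OF 1 2])
  then show ?thesis by (metis real_sqrt_eq_iff real_sqrt_mult)
qed

text \<open>Equality of functions, not merely almost everywhere: the truncated transforms agree at
  every point, so both choices are made from the same predicate.\<close>

lemma fourier_cong_AE:
  assumes "u \<in> borel_measurable borel" "v \<in> borel_measurable borel" "AE x in lborel. u x = v x"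
  shows "fourier u = fourier v"
proof -
  have "trunc_fourier u R \<xi> = trunc_fourier v R \<xi>" for R \<xi>
    unfolding trunc_fourier_eq_ft ft_def
  proof (rule integral_cong_AE)
    show "AE x in lborel. complex_of_real (cutoff R u x) * cis (- (x * \<xi>)) = complex_of_real (cutoff R v x) * cis (- (x * \<xi>))"
      using assms(3) by eventually_elim (simp add: cutoff_def)
  qed (use assms(1,2) in measurable)
  then show ?thesis unfolding fourier_def by simp
qed

section \<open>Rules for the L2 Fourier transform: linearity, reflection, translation\<close>

lemma fourier_add:
  assumes "L2fun u" "L2fun v"
  shows "AE \<xi> in lborel. fourier (\<lambda>x. u x + v x) \<xi> = fourier u \<xi> + fourier v \<xi>"
proof (rule fourier_unique)
  show "(\<lambda>n. l2sq (\<lambda>\<xi>. fourier u \<xi> + fourier v \<xi> - trunc_fourier (\<lambda>x. u x + v x) (real n) \<xi>)) \<longlonglongrightarrow> 0"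
  proof (rule Lim_null_comparison)
    show "(\<lambda>n. (sqrt (l2sq (\<lambda>\<xi>. fourier u \<xi> - trunc_fourier u (real n) \<xi>)) + sqrt (l2sq (\<lambda>\<xi>. fourier v \<xi> - trunc_fourier v (real n) \<xi>)))^2) \<longlonglongrightarrow> 0"
      by (rule tendsto_eq_intros fourier_limit_seq assms refl | simp)+
    have t: "trunc_fourier (\<lambda>x. u x + v x) R \<xi> = trunc_fourier u R \<xi> + trunc_fourier v R \<xi>" for R \<xi>
      unfolding trunc_fourier_eq_ft
      by (subst ft_add[symmetric])
         (intro integrable_of_real integrable_cutoff assms, intro integrable_of_real integrable_cutoff assms,
          simp add: cutoff_def ring_distribs)
    have "sqrt (l2sq (\<lambda>\<xi>. (fourier u \<xi> - trunc_fourier u R \<xi>) + (fourier v \<xi> - trunc_fourier v R \<xi>)))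
      \<le> sqrt (l2sq (\<lambda>\<xi>. fourier u \<xi> - trunc_fourier u R \<xi>)) + sqrt (l2sq (\<lambda>\<xi>. fourier v \<xi> - trunc_fourier v R \<xi>))" for R
      by (intro l2norm_triangle L2fun_diff L2fun_fourier L2fun_trunc_fourier assms)
    moreover have "(\<lambda>\<xi>. (fourier u \<xi> - trunc_fourier u R \<xi>) + (fourier v \<xi> - trunc_fourier v R \<xi>))
      = (\<lambda>\<xi>. fourier u \<xi> + fourier v \<xi> - trunc_fourier (\<lambda>x. u x + v x) R \<xi>)" for R
      unfolding t by (simp add: algebra_simps)
    ultimately show "\<forall>\<^sub>F n in sequentially. norm (l2sq (\<lambda>\<xi>. fourier u \<xi> + fourier v \<xi> - trunc_fourier (\<lambda>x. u x + v x) (real n) \<xi>))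
      \<le> (sqrt (l2sq (\<lambda>\<xi>. fourier u \<xi> - trunc_fourier u (real n) \<xi>)) + sqrt (l2sq (\<lambda>\<xi>. fourier v \<xi> - trunc_fourier v (real n) \<xi>)))^2"
      by (intro always_eventually allI) (auto intro: sqrt_le_D)
  qed
qed (intro L2fun_add L2fun_fourier assms)+

lemma fourier_scale:
  assumes "L2fun u"
  shows "AE \<xi> in lborel. fourier (\<lambda>x. c * u x) \<xi> = of_real c * fourier u \<xi>"
proof (rule fourier_unique)
  have t: "trunc_fourier (\<lambda>x. c * u x) R \<xi> = of_real c * trunc_fourier u R \<xi>" for R \<xi>
    unfolding trunc_fourier_eq_ft ft_cmult[symmetric] by (simp add: cutoff_def mult_ac)
  have "(\<lambda>n. c^2 * l2sq (\<lambda>\<xi>. fourier u \<xi> - trunc_fourier u (real n) \<xi>)) \<longlonglongrightarrow> c^2 * 0"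
    by (intro tendsto_intros fourier_limit_seq assms)
  then show "(\<lambda>n. l2sq (\<lambda>\<xi>. of_real c * fourier u \<xi> - trunc_fourier (\<lambda>x. c * u x) (real n) \<xi>)) \<longlonglongrightarrow> 0"
    unfolding t l2sq_scaleR[symmetric] by (simp add: scaleR_conv_of_real right_diff_distrib)
  show "L2fun (\<lambda>x. c * u x)" using L2fun_scaleR[OF assms, of c] by simp
  show "L2fun (\<lambda>\<xi>. of_real c * fourier u \<xi>)"
    using L2fun_scaleR[OF L2fun_fourier[OF assms], of c] by (simp add: scaleR_conv_of_real)
qed

lemma fourier_diff:
  assumes "L2fun u" "L2fun v"
  shows "AE \<xi> in lborel. fourier (\<lambda>x. u x - v x) \<xi> = fourier u \<xi> - fourier v \<xi>"
  using fourier_add[OF assms(1) L2fun_minus[OF assms(2)]] fourier_scale[OF assms(2), of "-1"]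
  by eventually_elim simp

lemma l2sq_fourier_diff:
  assumes "L2fun u" "L2fun v"
  shows "l2sq (\<lambda>\<xi>. fourier u \<xi> - fourier v \<xi>) = 2 * pi * l2sq (\<lambda>x. u x - v x)"
proof -
  have "l2sq (\<lambda>\<xi>. fourier u \<xi> - fourier v \<xi>) = l2sq (fourier (\<lambda>x. u x - v x))"
    using fourier_diff[OF assms]
    by (intro l2sq_cong_AE L2fun_measurable[OF L2fun_diff] L2fun_measurable[OF L2fun_fourier] L2fun_fourier L2fun_diff assms)
       (auto elim: eventually_mono)
  then show ?thesis by (simp add: plancherel L2fun_diff assms)
qed

lemma fourier_eq_ft:
  assumes "L2fun u" "integrable lborel u"
  shows "AE \<xi> in lborel. fourier u \<xi> = ft (\<lambda>x. of_real (u x)) \<xi>"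
proof (rule fourier_unique)
  have "(\<lambda>n. 2 * pi * l2sq (\<lambda>x. cutoff (real n) u x - u x)) \<longlonglongrightarrow> 2 * pi * 0"
    by (intro tendsto_intros cutoff_tendsto_seq assms)
  then show "(\<lambda>n. l2sq (\<lambda>\<xi>. ft (\<lambda>x. of_real (u x)) \<xi> - trunc_fourier u (real n) \<xi>)) \<longlonglongrightarrow> 0"
    unfolding trunc_fourier_eq_ft
    by (simp add: l2sq_ft_diff assms integrable_cutoff L2fun_cutoff l2sq_diff_commute[of u])
qed (use assms plancherel_integrable in auto)

lemma fourier_reflect:
  assumes L: "L2fun u"
  shows "AE \<xi> in lborel. fourier (\<lambda>x. u (- x)) \<xi> = fourier u (- \<xi>)"
proof (rule fourier_unique)
  have "trunc_fourier (\<lambda>x. u (- x)) R \<xi> = trunc_fourier u R (- \<xi>)" for R \<xi>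
    unfolding trunc_fourier_eq_ft ft_def
    by (subst integral_reflect[symmetric]) (auto simp: cutoff_def indicator_def intro!: Bochner_Integration.integral_cong)
  then have t: "l2sq (\<lambda>\<xi>. fourier u (- \<xi>) - trunc_fourier (\<lambda>x. u (- x)) R \<xi>) = l2sq (\<lambda>\<xi>. fourier u \<xi> - trunc_fourier u R \<xi>)" for R
    using l2sq_reflect[of "\<lambda>\<xi>. fourier u \<xi> - trunc_fourier u R \<xi>"] by simp
  show "(\<lambda>n. l2sq (\<lambda>\<xi>. fourier u (- \<xi>) - trunc_fourier (\<lambda>x. u (- x)) (real n) \<xi>)) \<longlonglongrightarrow> 0"
    unfolding t by (rule fourier_limit_seq[OF L])
qed (intro L2fun_reflect L2fun_fourier L)+

text \<open>Truncated transforms of a real function are Hermitian, and conjugate reflection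
  preserves L2 distances, so the reflected conjugate of \<open>fourier u\<close> is a limit of the
  same truncations.\<close>

lemma fourier_hermitian:
  assumes L: "L2fun u"
  shows "AE \<xi> in lborel. fourier u (- \<xi>) = cnj (fourier u \<xi>)"
proof -
  have "L2fun (\<lambda>\<xi>. cnj (fourier u (- \<xi>)))"
    using L2fun_reflect[OF L2fun_fourier[OF L]] by (auto simp: L2fun_def intro: borel_measurable_cnj)
  moreover have "l2sq (\<lambda>\<xi>. cnj (fourier u (- \<xi>)) - trunc_fourier u R \<xi>) = l2sq (\<lambda>\<xi>. fourier u \<xi> - trunc_fourier u R \<xi>)" for R
  proof -
    have "norm (cnj (fourier u (- \<xi>)) - trunc_fourier u R \<xi>) = norm (fourier u (- \<xi>) - trunc_fourier u R (- \<xi>))" for \<xi>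
      unfolding trunc_fourier_eq_ft ft_real_reflect
      by (metis complex_cnj_cnj complex_cnj_diff complex_mod_cnj)
    then have "l2sq (\<lambda>\<xi>. cnj (fourier u (- \<xi>)) - trunc_fourier u R \<xi>) = l2sq (\<lambda>\<xi>. fourier u (- \<xi>) - trunc_fourier u R (- \<xi>))"
      by (simp add: l2sq_def)
    then show ?thesis by (simp add: l2sq_reflect[of "\<lambda>\<xi>. fourier u \<xi> - trunc_fourier u R \<xi>"])
  qed
  ultimately have "AE \<xi> in lborel. fourier u \<xi> = cnj (fourier u (- \<xi>))"
    using L by (intro fourier_unique) (auto intro: fourier_limit_seq)
  then show ?thesis by eventually_elim (metis complex_cnj_cnj)
qed

text \<open>Translation does not preserve the window [-n,n]. Both sides are therefore compared with
  cis (y xi) times the truncated transform, which is the transform of the translated cutoff;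
  Plancherel bounds its distance from the left side.\<close>

lemma fourier_shift:
  assumes L: "L2fun u"
  shows "AE \<xi> in lborel. fourier (\<lambda>x. u (x + y)) \<xi> = cis (y * \<xi>) * fourier u \<xi>"
proof (rule L2_limit_unique[where h="\<lambda>n \<xi>. cis (y * \<xi>) * trunc_fourier u (real n) \<xi>"])
  have cisL: "L2fun (\<lambda>\<xi>. cis (y * \<xi>) * f \<xi>)" if "L2fun f" for f
    using that by (auto simp: L2fun_def norm_mult)
  show "L2fun (fourier (\<lambda>x. u (x + y)))" "L2fun (\<lambda>\<xi>. cis (y * \<xi>) * fourier u \<xi>)"
    "L2fun (\<lambda>\<xi>. cis (y * \<xi>) * trunc_fourier u (real n) \<xi>)" for n
    by (intro cisL L2fun_fourier L2fun_shift L2fun_trunc_fourier L)+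
  have "l2sq (\<lambda>x. cis (y * x) * fourier u x - cis (y * x) * trunc_fourier u (real n) x) = l2sq (\<lambda>\<xi>. fourier u \<xi> - trunc_fourier u (real n) \<xi>)" for n
    unfolding l2sq_def right_diff_distrib[symmetric] by (simp add: norm_mult)
  then show "(\<lambda>n. l2sq (\<lambda>x. cis (y * x) * fourier u x - cis (y * x) * trunc_fourier u (real n) x)) \<longlonglongrightarrow> 0"
    using fourier_limit_seq[OF L] by simp
  have "l2sq (\<lambda>x. fourier (\<lambda>x. u (x + y)) x - cis (y * x) * trunc_fourier u (real n) x) = 2 * pi * l2sq (\<lambda>x. cutoff (real n) u x - u x)" for n
  proof -
    define c where "c = cutoff (real n) u"
    have c: "L2fun c" "integrable lborel c" unfolding c_def by (intro L2fun_cutoff integrable_cutoff L)+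
    have s: "L2fun (\<lambda>x. c (x + y))" "integrable lborel (\<lambda>x. c (x + y))"
      by (intro L2fun_shift integrable_shift c)+
    have "ft (\<lambda>x. of_real (c (x + y))) \<xi> = cis (y * \<xi>) * ft (\<lambda>x. of_real (c x)) \<xi>" for \<xi>
    proof -
      have "ft (\<lambda>x. of_real (c (x + y))) \<xi> = (LINT x|lborel. of_real (c (x + y)) * cis (- ((x + y) * \<xi>) + y * \<xi>))"
        unfolding ft_def by (simp add: algebra_simps)
      also have "\<dots> = (LINT x|lborel. of_real (c x) * cis (- (x * \<xi>) + y * \<xi>))"
        by (rule integral_shift[of "\<lambda>x. of_real (c x) * cis (- (x * \<xi>) + y * \<xi>)"])
      also have "\<dots> = (LINT x|lborel. cis (y * \<xi>) * (of_real (c x) * cis (- (x * \<xi>))))"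
        unfolding cis_mult[symmetric] by (simp only: mult_ac)
      finally show ?thesis by (simp add: ft_def)
    qed
    with fourier_eq_ft[OF s] have "AE \<xi> in lborel. fourier (\<lambda>x. u (x + y)) \<xi> - cis (y * \<xi>) * trunc_fourier u (real n) \<xi>
        = fourier (\<lambda>x. u (x + y)) \<xi> - fourier (\<lambda>x. c (x + y)) \<xi>"
      unfolding trunc_fourier_eq_ft c_def by (auto elim!: eventually_mono)
    then have "l2sq (\<lambda>x. fourier (\<lambda>x. u (x + y)) x - cis (y * x) * trunc_fourier u (real n) x)
       = l2sq (\<lambda>\<xi>. fourier (\<lambda>x. u (x + y)) \<xi> - fourier (\<lambda>x. c (x + y)) \<xi>)"
      by (intro l2sq_cong_AE L2fun_measurable[OF L2fun_diff] cisL L2fun_fourier L2fun_shift L2fun_trunc_fourier L c)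
    also have "\<dots> = 2 * pi * l2sq (\<lambda>x. u (x + y) - c (x + y))"
      by (intro l2sq_fourier_diff L2fun_shift L c)
    also have "l2sq (\<lambda>x. u (x + y) - c (x + y)) = l2sq (\<lambda>x. u x - c x)"
      by (rule l2sq_shift[of "\<lambda>x. u x - c x"])
    finally show ?thesis unfolding c_def l2sq_diff_commute[of u] .
  qed
  then show "(\<lambda>n. l2sq (\<lambda>x. fourier (\<lambda>x. u (x + y)) x - cis (y * x) * trunc_fourier u (real n) x)) \<longlonglongrightarrow> 0"
    using tendsto_mult_left[OF cutoff_tendsto_seq[OF L], of "2*pi"] by simp
qed


subsection \<open>Fourier inversion\<close>

lemma l2ip_tendsto:
  assumes "L2fun f" "L2fun g" "\<And>n. L2fun (a n)" "\<And>n. L2fun (b n)"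
    "(\<lambda>n. l2sq (\<lambda>x. a n x - f x)) \<longlonglongrightarrow> 0" "(\<lambda>n. l2sq (\<lambda>x. b n x - g x)) \<longlonglongrightarrow> 0"
  shows "(\<lambda>n. l2ip (a n) (b n)) \<longlonglongrightarrow> l2ip f g"
proof -
  have "(\<lambda>n. sqrt (l2sq (\<lambda>x. a n x - f x)) * sqrt (l2sq (b n)) + sqrt (l2sq f) * sqrt (l2sq (\<lambda>x. b n x - g x)))
    \<longlonglongrightarrow> sqrt 0 * sqrt (l2sq g) + sqrt (l2sq f) * sqrt 0"
    by (intro tendsto_intros assms l2norm_tendsto) (use assms(6) in \<open>simp add: l2sq_diff_commute[of g]\<close>)
  then have lim: "(\<lambda>n. sqrt (l2sq (\<lambda>x. a n x - f x)) * sqrt (l2sq (b n)) + sqrt (l2sq f) * sqrt (l2sq (\<lambda>x. b n x - g x))) \<longlonglongrightarrow> 0"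
    by simp
  have "(\<lambda>n. l2ip (a n) (b n) - l2ip f g) \<longlonglongrightarrow> 0"
  proof (rule Lim_null_comparison[OF _ lim], intro always_eventually allI)
    fix n
    have "l2ip (a n) (b n) - l2ip f g = l2ip (\<lambda>x. a n x - f x) (b n) + l2ip (\<lambda>x. b n x - g x) f"
      using l2ip_diff_left[OF assms(3)[of n] assms(1) assms(4)[of n]] l2ip_diff_left[OF assms(4)[of n] assms(2) assms(1)]
        l2ip_commute[of "b n" f] l2ip_commute[of g f] by linarith
    moreover have "\<bar>l2ip (\<lambda>x. a n x - f x) (b n)\<bar> \<le> sqrt (l2sq (\<lambda>x. a n x - f x)) * sqrt (l2sq (b n))"
      by (intro l2ip_le L2fun_diff assms)
    moreover have "\<bar>l2ip (\<lambda>x. b n x - g x) f\<bar> \<le> sqrt (l2sq (\<lambda>x. b n x - g x)) * sqrt (l2sq f)"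
      by (intro l2ip_le L2fun_diff assms)
    ultimately show "norm (l2ip (a n) (b n) - l2ip f g) \<le> sqrt (l2sq (\<lambda>x. a n x - f x)) * sqrt (l2sq (b n)) + sqrt (l2sq f) * sqrt (l2sq (\<lambda>x. b n x - g x))"
      by (simp add: mult.commute)
  qed
  then show ?thesis by (simp add: LIM_zero_iff)
qed

lemma L2fun_complex_parts:
  assumes "L2fun (f :: real \<Rightarrow> complex)"
  shows "L2fun (\<lambda>x. Re (z * f x))" and "l2sq (\<lambda>x. Re (z * f x)) \<le> (norm z)^2 * l2sq f"
proof -
  have [measurable]: "f \<in> borel_measurable borel" by (rule L2fun_measurable[OF assms])
  have le: "(norm (Re (z * f x)))^2 \<le> (norm z)^2 * (norm (f x))^2" for x
    using abs_Re_le_cmod[of "z * f x"] by (simp add: norm_mult abs_le_square_iff flip: power_mult_distrib)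
       (metis abs_le_square_iff abs_mult abs_norm_cancel)
  have i: "integrable lborel (\<lambda>x. (norm z)^2 * (norm (f x))^2)" using assms by (simp add: L2fun_def)
  show L: "L2fun (\<lambda>x. Re (z * f x))"
    by (rule L2fun_bound[OF _ i]) (use le in auto)
  have "l2sq (\<lambda>x. Re (z * f x)) \<le> (LINT x|lborel. (norm z)^2 * (norm (f x))^2)"
    unfolding l2sq_def by (rule integral_mono[OF L2fun_integrable[OF L] i]) (rule le)
  then show "l2sq (\<lambda>x. Re (z * f x)) \<le> (norm z)^2 * l2sq f" by (simp add: l2sq_def)
qed

lemma L2fun_Re: "L2fun f \<Longrightarrow> L2fun (\<lambda>x. Re (f x))"
  using L2fun_complex_parts(1)[of f 1] by simp

lemma L2fun_Im: "L2fun f \<Longrightarrow> L2fun (\<lambda>x. Im (f x))"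
  using L2fun_complex_parts(1)[of f "- \<i>"] by simp

text \<open>The multiplication formula, extended to L2 by truncation. The factor \<open>z\<close>
  covers real parts (z = 1) and imaginary parts (z = -i) at once.\<close>

lemma fourier_adjoint:
  assumes u: "L2fun u" and v: "L2fun v"
  shows "l2ip (\<lambda>x. Re (z * fourier u x)) v = l2ip u (\<lambda>x. Re (z * fourier v x))"
proof -
  define T where "T w n x = Re (z * trunc_fourier w (real n) x)" for w :: "real \<Rightarrow> real" and n x
  have LT: "L2fun (T w n)" if "L2fun w" for w n
    unfolding T_def by (intro L2fun_complex_parts L2fun_trunc_fourier that)
  have lim: "(\<lambda>n. l2sq (\<lambda>x. T w n x - Re (z * fourier w x))) \<longlonglongrightarrow> 0" if "L2fun w" for w
  proof (rule Lim_null_comparison)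
    show "(\<lambda>n. (norm z)^2 * l2sq (\<lambda>\<xi>. fourier w \<xi> - trunc_fourier w (real n) \<xi>)) \<longlonglongrightarrow> 0"
      using tendsto_mult_left[OF fourier_limit_seq[OF that], of "(norm z)^2"] by simp
    have "l2sq (\<lambda>x. T w n x - Re (z * fourier w x)) = l2sq (\<lambda>x. Re (z * (trunc_fourier w (real n) x - fourier w x)))" for n
      unfolding T_def by (simp add: algebra_simps)
    moreover have "l2sq (\<lambda>x. Re (z * (trunc_fourier w (real n) x - fourier w x))) \<le> (norm z)^2 * l2sq (\<lambda>x. trunc_fourier w (real n) x - fourier w x)" for n
      by (intro L2fun_complex_parts L2fun_diff L2fun_trunc_fourier L2fun_fourier that)
    ultimately show "\<forall>\<^sub>F n in sequentially. norm (l2sq (\<lambda>x. T w n x - Re (z * fourier w x)))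
      \<le> (norm z)^2 * l2sq (\<lambda>\<xi>. fourier w \<xi> - trunc_fourier w (real n) \<xi>)"
      by (simp add: l2sq_diff_commute[of "fourier w"])
  qed
  have eq: "l2ip (T u n) (cutoff (real n) v) = l2ip (cutoff (real n) u) (T v n)" for n
  proof -
    define a where "a x = complex_of_real (cutoff (real n) u x)" for x
    define b where "b x = complex_of_real (cutoff (real n) v x)" for x
    have ia: "integrable lborel a" and ib: "integrable lborel b"
      unfolding a_def b_def by (intro integrable_of_real integrable_cutoff u v)+
    have m: "a \<in> borel_measurable borel" "b \<in> borel_measurable borel" using ia ib by auto
    have bdd: "integrable lborel (\<lambda>x. ft h x * k x)" if h: "h \<in> borel_measurable borel" and k: "integrable lborel k" for h k
    proof (rule Bochner_Integration.integrable_bound)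
      show "integrable lborel (\<lambda>x. (LINT x|lborel. norm (h x)) * norm (k x))" using k by simp
      show "(\<lambda>x. ft h x * k x) \<in> borel_measurable lborel"
        using ft_measurable[OF h] borel_measurable_integrable[OF k] by simp
      show "AE x in lborel. norm (ft h x * k x) \<le> norm ((LINT x|lborel. norm (h x)) * norm (k x))"
        using norm_ft_le[of h] by (auto simp: norm_mult intro!: mult_right_mono order_trans[OF _ abs_ge_self])
    qed
    have i1: "integrable lborel (\<lambda>x. z * (ft a x * b x))" using bdd[OF m(1) ib] by simp
    have i2: "integrable lborel (\<lambda>x. z * (ft b x * a x))" using bdd[OF m(2) ia] by simp
    have "l2ip (T u n) (cutoff (real n) v) = (LINT x|lborel. Re (z * (ft a x * b x)))"
      unfolding l2ip_def T_def trunc_fourier_eq_ft a_def b_def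
      by (intro Bochner_Integration.integral_cong) (auto simp: algebra_simps)
    also have "\<dots> = Re (z * (LINT x|lborel. ft a x * b x))"
      unfolding integral_Re[OF i1] by simp
    also have "(LINT x|lborel. ft a x * b x) = (LINT x|lborel. ft b x * a x)"
      using ft_exchange[OF ia ib] by (simp add: mult.commute)
    also have "Re (z * (LINT x|lborel. ft b x * a x)) = (LINT x|lborel. Re (z * (ft b x * a x)))"
      unfolding integral_Re[OF i2] by simp
    also have "\<dots> = l2ip (cutoff (real n) u) (T v n)"
      unfolding l2ip_def T_def trunc_fourier_eq_ft a_def b_def
      by (intro Bochner_Integration.integral_cong) (auto simp: algebra_simps)
    finally show ?thesis .
  qed
  have "(\<lambda>n. l2ip (T u n) (cutoff (real n) v)) \<longlonglongrightarrow> l2ip (\<lambda>x. Re (z * fourier u x)) v"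
    by (intro l2ip_tendsto L2fun_complex_parts L2fun_fourier u v LT L2fun_cutoff lim cutoff_tendsto_seq)
  moreover have "(\<lambda>n. l2ip (T u n) (cutoff (real n) v)) \<longlonglongrightarrow> l2ip u (\<lambda>x. Re (z * fourier v x))"
    unfolding eq by (intro l2ip_tendsto L2fun_complex_parts L2fun_fourier u v LT L2fun_cutoff lim cutoff_tendsto_seq)
  ultimately show ?thesis by (rule LIMSEQ_unique)
qed

lemma l2ip_odd:
  fixes f g :: "real \<Rightarrow> real"
  assumes "f \<in> borel_measurable borel" "g \<in> borel_measurable borel"
    "AE x in lborel. f (- x) = f x" "AE x in lborel. g (- x) = - g x"
  shows "l2ip f g = 0"
proof -
  have "(LINT x|lborel. f x * g x) = (LINT x|lborel. f (-x) * g (-x))" by (rule integral_reflect[symmetric])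
  also have "\<dots> = (LINT x|lborel. - (f x * g x))"
  proof (rule integral_cong_AE)
    show "AE x in lborel. f (-x) * g (-x) = - (f x * g x)" using assms(3,4) by eventually_elim simp
  qed (use assms(1,2) in measurable)
  finally show ?thesis by (simp add: l2ip_def)
qed

text \<open>\<open>v\<close> is the inverse transform of \<open>G\<close>, written with forward
  transforms of real functions because \<open>fourier\<close> accepts no others. Hermitian symmetry
  makes Re G even and Im G odd, so their transforms are real and even, respectively imaginary and
  odd. The cross term thus vanishes, which gives norm (G)^2 = 2 pi norm (v)^2.\<close>

theorem fourier_surj:
  assumes G: "L2fun (G :: real \<Rightarrow> complex)" and herm: "AE \<xi> in lborel. G (- \<xi>) = cnj (G \<xi>)"
  defines "v \<equiv> \<lambda>x. (Re (fourier (\<lambda>\<xi>. Re (G \<xi>)) x) + Im (fourier (\<lambda>\<xi>. Im (G \<xi>)) x)) / (2*pi)"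
  shows "L2fun v" and "AE \<xi> in lborel. fourier v \<xi> = G \<xi>"
proof -
  define A where "A x = Re (G x)" for x
  define B where "B x = Im (G x)" for x
  have LA: "L2fun A" and LB: "L2fun B" unfolding A_def[abs_def] B_def[abs_def] by (intro L2fun_Re L2fun_Im G)+
  define TA where "TA = fourier A"
  define TB where "TB = fourier B"
  have LTA: "L2fun TA" and LTB: "L2fun TB" unfolding TA_def TB_def by (intro L2fun_fourier LA LB)+
  have refl: "fourier (\<lambda>x. A (- x)) = TA" "fourier (\<lambda>x. - B (- x)) = TB"
    unfolding TA_def TB_def
    using herm L2fun_measurable[OF LA] L2fun_measurable[OF LB] L2fun_measurable[OF L2fun_reflect[OF LA]] L2fun_measurable[OF L2fun_reflect[OF LB]]
    by (auto intro!: fourier_cong_AE elim!: eventually_mono simp: A_def B_def)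
  have hA: "AE \<xi> in lborel. TA (- \<xi>) = cnj (TA \<xi>)" and hB: "AE \<xi> in lborel. TB (- \<xi>) = cnj (TB \<xi>)"
    unfolding TA_def TB_def by (intro fourier_hermitian LA LB)+
  have eA: "AE \<xi> in lborel. TA \<xi> = TA (- \<xi>)"
    using fourier_reflect[OF LA] unfolding refl(1) by (simp add: TA_def)
  have eB: "AE \<xi> in lborel. TB \<xi> = - TB (- \<xi>)"
    using fourier_reflect[OF L2fun_minus[OF LB]] fourier_scale[OF LB, of "-1"] AE_reflect[OF fourier_scale[OF LB, of "-1"]]
    unfolding refl(2) by (simp add: TB_def) (auto elim: eventually_elim2)
  have rA: "AE \<xi> in lborel. Im (TA \<xi>) = 0" using hA eA by eventually_elim (metis Reals_cnj_iff complex_is_Real_iff)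
  have rB: "AE \<xi> in lborel. Re (TB \<xi>) = 0"
    using hB eB by eventually_elim (metis add_cancel_right_right add_eq_0_iff cnj.simps(1) complex_Re_numeral equal_neg_zero uminus_complex.simps(1))
  have L1: "L2fun (\<lambda>x. Re (TA x))" and L2: "L2fun (\<lambda>x. Im (TB x))" by (intro L2fun_Re L2fun_Im LTA LTB)+
  have n1: "l2sq (\<lambda>x. Re (TA x)) = 2 * pi * l2sq A"
  proof -
    have "l2sq (\<lambda>x. Re (TA x)) = l2sq TA" unfolding l2sq_def
    proof (rule integral_cong_AE)
      show "AE x in lborel. (norm (Re (TA x)))^2 = (norm (TA x))^2"
        using rA by eventually_elim (simp add: cmod_power2)
    qed (use L2fun_measurable[OF LTA] in measurable)
    then show ?thesis by (simp add: TA_def plancherel LA)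
  qed
  have n2: "l2sq (\<lambda>x. Im (TB x)) = 2 * pi * l2sq B"
  proof -
    have "l2sq (\<lambda>x. Im (TB x)) = l2sq TB" unfolding l2sq_def
    proof (rule integral_cong_AE)
      show "AE x in lborel. (norm (Im (TB x)))^2 = (norm (TB x))^2"
        using rB by eventually_elim (simp add: cmod_power2)
    qed (use L2fun_measurable[OF LTB] in measurable)
    then show ?thesis by (simp add: TB_def plancherel LB)
  qed
  have cross: "l2ip (\<lambda>x. Re (TA x)) (\<lambda>x. Im (TB x)) = 0"
  proof (rule l2ip_odd)
    show "AE x in lborel. Re (TA (- x)) = Re (TA x)" using hA by eventually_elim simp
    show "AE x in lborel. Im (TB (- x)) = - Im (TB x)" using hB by eventually_elim simp
  qed (use L2fun_measurable[OF L1] L2fun_measurable[OF L2] in auto)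
  have v: "v = (\<lambda>x. (1/(2*pi)) *\<^sub>R (Re (TA x) + Im (TB x)))"
    unfolding v_def TA_def TB_def A_def[abs_def] B_def[abs_def] by simp
  show Lv: "L2fun v" unfolding v by (intro L2fun_scaleR L2fun_add L1 L2)
  have sumL: "L2fun (\<lambda>x. Re (TA x) + Im (TB x))" by (intro L2fun_add L1 L2)
  have G2: "l2sq G = l2sq A + l2sq B"
    using LA LB by (simp add: l2sq_def cmod_power2 A_def B_def L2fun_def)
  have nv: "l2sq v = l2sq G / (2*pi)"
    unfolding v l2sq_scaleR l2sq_add[OF L1 L2] cross n1 n2 G2 by (simp add: field_simps power2_eq_square)
  \<comment> \<open>Inversion is obtained from norms: the pairing of \<open>fourier v\<close> with
    \<open>G\<close>, the squared norm of \<open>fourier v\<close> and that of \<open>G\<close> all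
    equal 2 pi times \<open>l2sq v\<close>, so the difference has norm 0.\<close>
  have "l2ip (fourier v) G = l2ip (\<lambda>x. Re (1 * fourier v x)) A + l2ip (\<lambda>x. Re (- \<i> * fourier v x)) B"
    using L2fun_inner_integrable[OF L2fun_Re[OF L2fun_fourier[OF Lv]] LA] L2fun_inner_integrable[OF L2fun_Im[OF L2fun_fourier[OF Lv]] LB]
    by (simp add: l2ip_def inner_complex_def A_def B_def)
  also have "\<dots> = l2ip v (\<lambda>x. Re (TA x)) + l2ip v (\<lambda>x. Im (TB x))"
    unfolding fourier_adjoint[OF Lv LA] fourier_adjoint[OF Lv LB] by (simp add: TA_def TB_def)
  also have "\<dots> = l2ip (\<lambda>x. Re (TA x) + Im (TB x)) v"
    unfolding l2ip_commute[of v] by (rule l2ip_add_left[OF L1 L2 Lv, symmetric])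
  also have "\<dots> = 2 * pi * l2ip (\<lambda>x. (1/(2*pi)) *\<^sub>R (Re (TA x) + Im (TB x))) v"
    unfolding l2ip_scaleR_left by simp
  also have "\<dots> = 2 * pi * l2sq v" unfolding v[symmetric] l2ip_self ..
  finally have "l2sq (\<lambda>\<xi>. fourier v \<xi> - G \<xi>) = 0"
    by (simp add: l2sq_diff L2fun_fourier Lv G plancherel nv)
  then show "AE \<xi> in lborel. fourier v \<xi> = G \<xi>"
    by (simp add: l2sq_eq_0_iff L2fun_diff L2fun_fourier Lv G)
qed

text \<open>The inverse transform as an absolutely convergent integral when \<open>G\<close> is
  integrable: unlike a representative chosen in L2 it has meaningful values at every point.\<close>

definition ift :: "(real \<Rightarrow> complex) \<Rightarrow> real \<Rightarrow> real" where
  "ift G x = Re (LINT \<xi>|lborel. G \<xi> * cis (x * \<xi>)) / (2*pi)"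

text \<open>On integrable functions \<open>fourier\<close> agrees almost everywhere with
  \<open>ft\<close>, so \<open>ift G\<close> agrees with the preimage constructed in
  \<open>fourier_surj\<close>.\<close>

theorem fourier_ift:
  assumes G: "L2fun G" and int: "integrable lborel G" and herm: "AE \<xi> in lborel. G (- \<xi>) = cnj (G \<xi>)"
  shows "L2fun (ift G)" and "AE \<xi> in lborel. fourier (ift G) \<xi> = G \<xi>"
proof -
  define v where "v x = (Re (fourier (\<lambda>\<xi>. Re (G \<xi>)) x) + Im (fourier (\<lambda>\<xi>. Im (G \<xi>)) x)) / (2*pi)" for x
  note surj = fourier_surj[OF G herm, folded v_def[abs_def]]
  have [measurable]: "G \<in> borel_measurable borel" using int by auto
  have iR: "integrable lborel (\<lambda>x. Re (G x))" and iI: "integrable lborel (\<lambda>x. Im (G x))" using int by auto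
  have eq: "ift G x = (Re (ft (\<lambda>\<xi>. of_real (Re (G \<xi>))) x) + Im (ft (\<lambda>\<xi>. of_real (Im (G \<xi>))) x)) / (2*pi)" for x
  proof -
    have a: "integrable lborel (\<lambda>\<xi>. complex_of_real (Re (G \<xi>)) * cis (- (\<xi> * x)))"
      "integrable lborel (\<lambda>\<xi>. complex_of_real (Im (G \<xi>)) * cis (- (\<xi> * x)))"
      "integrable lborel (\<lambda>\<xi>. G \<xi> * cis (x * \<xi>))"
      using int by (auto intro!: integrable_mult_cis)
    have r: "Re (ft (\<lambda>\<xi>. of_real (Re (G \<xi>))) x) = (LINT \<xi>|lborel. Re (of_real (Re (G \<xi>)) * cis (- (\<xi> * x))))"
      unfolding ft_def using integral_Re[OF a(1)] by simp
    have i: "Im (ft (\<lambda>\<xi>. of_real (Im (G \<xi>))) x) = (LINT \<xi>|lborel. Im (of_real (Im (G \<xi>)) * cis (- (\<xi> * x))))"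
      unfolding ft_def using integral_Im[OF a(2)] by simp
    have "Re (ft (\<lambda>\<xi>. of_real (Re (G \<xi>))) x) + Im (ft (\<lambda>\<xi>. of_real (Im (G \<xi>))) x)
      = (LINT \<xi>|lborel. Re (of_real (Re (G \<xi>)) * cis (- (\<xi> * x))) + Im (of_real (Im (G \<xi>)) * cis (- (\<xi> * x))))"
      unfolding r i by (rule Bochner_Integration.integral_add[symmetric]) (intro integrable_Re integrable_Im a)+
    also have "\<dots> = (LINT \<xi>|lborel. Re (G \<xi> * cis (x * \<xi>)))"
      by (intro Bochner_Integration.integral_cong) (auto simp: algebra_simps)
    also have "\<dots> = Re (LINT \<xi>|lborel. G \<xi> * cis (x * \<xi>))" by (rule integral_Re[OF a(3)])
    finally show ?thesis by (simp add: ift_def)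
  qed
  have "AE x in lborel. v x = ift G x"
    using fourier_eq_ft[OF L2fun_Re[OF G] iR] fourier_eq_ft[OF L2fun_Im[OF G] iI]
    by eventually_elim (simp add: v_def eq)
  moreover have m: "ift G \<in> borel_measurable borel"
  proof -
    have [measurable]: "ft (\<lambda>\<xi>. of_real (Re (G \<xi>))) \<in> borel_measurable borel" "ft (\<lambda>\<xi>. of_real (Im (G \<xi>))) \<in> borel_measurable borel"
      by (intro ft_measurable; measurable)+
    show ?thesis unfolding eq[abs_def] by measurable
  qed
  ultimately show "L2fun (ift G)" and "AE \<xi> in lborel. fourier (ift G) \<xi> = G \<xi>"
    using surj L2fun_cong_AE[OF surj(1) m] fourier_cong_AE[OF L2fun_measurable[OF surj(1)] m] by auto
qed


subsection \<open>Weak sequential compactness\<close>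

text \<open>Convex combinations, with dyadic weights, of the members of index at least k. Midpoints
  are all that the parallelogram identity needs, and strong limits from these hulls produce
  candidates for weak limits without a representation theorem.\<close>

inductive midpoint_hull :: "(nat \<Rightarrow> real \<Rightarrow> 'a::euclidean_space) \<Rightarrow> nat \<Rightarrow> (real \<Rightarrow> 'a) \<Rightarrow> bool"
  for f k where
  base: "n \<ge> k \<Longrightarrow> midpoint_hull f k (f n)"
| midpoint: "midpoint_hull f k a \<Longrightarrow> midpoint_hull f k b \<Longrightarrow> midpoint_hull f k (\<lambda>x. (1/2) *\<^sub>R (a x + b x))"

lemma midpoint_hull_mono: "midpoint_hull f k a \<Longrightarrow> j \<le> k \<Longrightarrow> midpoint_hull f j a"
  by (induction rule: midpoint_hull.induct) (auto intro: midpoint_hull.intros)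

lemma midpoint_hull_L2:
  assumes "\<And>n. L2fun (f n)" "midpoint_hull f k a" shows "L2fun a"
  using assms(2) by (induction rule: midpoint_hull.induct) (auto intro: assms L2fun_scaleR L2fun_add)

text \<open>The condition confines a linear functional to an interval, hence survives
  midpoints.\<close>

lemma midpoint_hull_ip:
  assumes L: "\<And>n. L2fun (f n)" and w: "L2fun w" and le: "\<And>n. n \<ge> k \<Longrightarrow> \<bar>l2ip (f n) w - t\<bar> \<le> e"
    and "midpoint_hull f k a"
  shows "\<bar>l2ip a w - t\<bar> \<le> e"
  using assms(4)
proof (induction rule: midpoint_hull.induct)
  case (midpoint a b)
  have "l2ip (\<lambda>x. (1/2) *\<^sub>R (a x + b x)) w = (l2ip a w + l2ip b w) / 2"
    using midpoint midpoint_hull_L2[OF L] by (simp only: l2ip_scaleR_left) (simp add: l2ip_add_left w)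
  with midpoint.IH show ?case by (simp add: abs_le_iff)
qed (rule le)

text \<open>Vectors of nearly minimal norm in the hulls of the tails of a bounded sequence form
  a Cauchy sequence, by the parallelogram identity.\<close>

lemma midpoint_hull_limit:
  assumes L: "\<And>n. L2fun (f n)" and C: "\<And>n. l2sq (f n) \<le> C"
  obtains a where "L2fun a"
    "\<And>w t. L2fun w \<Longrightarrow> (\<lambda>n. l2ip (f n) w) \<longlonglongrightarrow> t \<Longrightarrow> l2ip a w = t"
proof -
  define d where "d k = Inf (l2sq ` Collect (midpoint_hull f k))" for k
  have bdd: "bdd_below (l2sq ` Collect (midpoint_hull f k))" for k
    by (rule bdd_belowI[of _ 0]) auto
  have ne: "l2sq ` Collect (midpoint_hull f k) \<noteq> {}" for k
    using midpoint_hull.base[of k k f] by auto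
  have dle: "d k \<le> l2sq a" if "midpoint_hull f k a" for k a
    unfolding d_def by (rule cInf_lower[OF _ bdd]) (use that in auto)
  have "\<exists>a. midpoint_hull f k a \<and> l2sq a < d k + 1 / real (Suc k)" for k
  proof -
    have "\<exists>y\<in>l2sq ` Collect (midpoint_hull f k). y < d k + 1 / real (Suc k)"
      unfolding d_def by (rule cInf_lessD[OF ne]) simp
    then show ?thesis by auto
  qed
  then obtain a where a: "\<And>k. midpoint_hull f k (a k)" "\<And>k. l2sq (a k) < d k + 1 / real (Suc k)" by metis
  have La: "L2fun (a k)" for k by (rule midpoint_hull_L2[OF L a(1)])
  \<comment> \<open>Hulls of later tails are smaller, so their infima increase; \<open>f k\<close>
    itself keeps the k-th one below \<open>C\<close>.\<close>
  have "mono d" unfolding d_def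
    by (intro monoI cInf_superset_mono ne bdd image_mono) (auto intro: midpoint_hull_mono)
  moreover have dC: "d k \<le> C" for k using dle[OF midpoint_hull.base[of k k]] C[of k] by simp
  ultimately have conv: "convergent d"
    unfolding convergent_def by (metis incseq_convergent)
  have key: "l2sq (\<lambda>x. a m x - a n x) \<le> 2 * (d m - d n) + 2 * (1 / real (Suc n)) + 2 * (1 / real (Suc m))" if "n \<le> m" for m n
  proof -
    have "midpoint_hull f n (\<lambda>x. (1/2) *\<^sub>R (a m x + a n x))"
      by (intro midpoint_hull.midpoint midpoint_hull_mono[OF a(1) that] a(1))
    from dle[OF this] have "4 * d n \<le> l2sq (\<lambda>x. a m x + a n x)"
      unfolding l2sq_scaleR by (simp add: power2_eq_square)
    moreover have "l2sq (\<lambda>x. a m x + a n x) + l2sq (\<lambda>x. a m x - a n x) = 2 * l2sq (a m) + 2 * l2sq (a n)"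
      by (simp add: l2sq_add l2sq_diff La)
    ultimately show ?thesis using a(2)[of m] a(2)[of n] by simp
  qed
  have "\<exists>N. \<forall>m\<ge>N. \<forall>n\<ge>N. l2sq (\<lambda>x. a m x - a n x) \<le> e" if e0: "e > 0" for e
  proof -
    from conv have "Cauchy d" by (rule convergent_Cauchy)
    then obtain N1 where N1: "\<And>m n. m \<ge> N1 \<Longrightarrow> n \<ge> N1 \<Longrightarrow> \<bar>d m - d n\<bar> < e / 6"
      using e0 metric_CauchyD[of d "e/6"] by (auto simp: dist_real_def)
    obtain N2 where N2: "1 / real (Suc N2) < e / 6" using e0 nat_approx_posE[of "e/6"] by auto
    have N3: "1 / real (Suc n) < e / 6" if "n \<ge> N2" for n
      using that N2 by (smt (verit) frac_le of_nat_0_less_iff of_nat_mono Suc_le_mono zero_less_Suc)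
    have "l2sq (\<lambda>x. a m x - a n x) \<le> e" if "n \<le> m" "n \<ge> max N1 N2" for m n
    proof -
      have *: "N1 \<le> m" "N2 \<le> m" "N1 \<le> n" "N2 \<le> n" using that by auto
      have arith: "s \<le> e" if "s \<le> 2 * (x - y) + 2 * p + 2 * q" "\<bar>x - y\<bar> < e / 6" "p < e / 6" "q < e / 6" for s x y p q :: real
        using that by argo
      show ?thesis by (rule arith[OF key[OF that(1)] N1[OF *(1,3)] N3[OF *(4)] N3[OF *(2)]])
    qed
    then have "l2sq (\<lambda>x. a m x - a n x) \<le> e" if "m \<ge> max N1 N2" "n \<ge> max N1 N2" for m n
      using that linear[of m n] l2sq_diff_commute[of "a m" "a n"] by metis
    then show ?thesis by blast
  qed
  from L2_complete[OF La this] obtain b where b: "L2fun b" "(\<lambda>n. l2sq (\<lambda>x. a n x - b x)) \<longlonglongrightarrow> 0" by blast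
  show ?thesis
  proof (rule that[OF b(1)])
    fix w t assume w: "L2fun w" and t: "(\<lambda>n. l2ip (f n) w) \<longlonglongrightarrow> t"
    have "(\<lambda>n. l2ip (a n) w) \<longlonglongrightarrow> l2ip b w"
      by (rule l2ip_tendsto[OF b(1) w La w b(2)]) (simp add: l2sq_def)
    moreover have "(\<lambda>n. l2ip (a n) w) \<longlonglongrightarrow> t"
    proof (rule LIMSEQ_I)
      fix e :: real assume "e > 0"
      then obtain N where N: "\<And>n. n \<ge> N \<Longrightarrow> norm (l2ip (f n) w - t) < e/2" using LIMSEQ_D[OF t, of "e/2"] by auto
      have "\<bar>l2ip (a n) w - t\<bar> \<le> e/2" if "n \<ge> N" for n
        by (rule midpoint_hull_ip[OF L w _ midpoint_hull_mono[OF a(1) that]]) (use N in force)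
      then show "\<exists>no. \<forall>n\<ge>no. norm (l2ip (a n) w - t) < e" using \<open>e > 0\<close> by (intro exI[of _ N]) fastforce
    qed
    ultimately show "l2ip b w = t" by (rule LIMSEQ_unique)
  qed
qed

lemma not_tendsto_subseq:
  fixes X :: "nat \<Rightarrow> real"
  assumes "\<not> X \<longlonglongrightarrow> l"
  obtains e and s :: "nat \<Rightarrow> nat" where "e > 0" "strict_mono s" "\<And>n. \<bar>X (s n) - l\<bar> \<ge> (e::real)"
proof -
  obtain e where e: "e > 0" "\<And>N. \<exists>n\<ge>N. \<bar>X n - l\<bar> \<ge> e"
    using assms unfolding LIMSEQ_iff by (auto simp: not_less)
  have "infinite {n. \<bar>X n - l\<bar> \<ge> e}" unfolding infinite_nat_iff_unbounded_le using e(2) by auto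
  from infinite_enumerate[OF this] obtain s :: "nat \<Rightarrow> nat"
    where "strict_mono s" "\<forall>n. s n \<in> {n. \<bar>X n - l\<bar> \<ge> e}" by auto
  then show ?thesis using that[OF e(1)] by simp
qed

text \<open>The diagonal argument runs only over pairings with the members of the sequence, so no
  countable dense set is used. \<open>midpoint_hull_limit\<close> supplies the candidate
  \<open>a\<close>. If a pairing with some w failed to converge to that of \<open>a\<close>, a
  further subsequence would have its own candidate \<open>b\<close> with a different pairing; but
  \<open>a\<close> and \<open>b\<close> coincide almost everywhere.\<close>

theorem L2_weak_compact:
  fixes g :: "nat \<Rightarrow> real \<Rightarrow> 'a::euclidean_space"
  assumes L: "\<And>n. L2fun (g n)" and C: "\<And>n. l2sq (g n) \<le> C"
  obtains k :: "nat \<Rightarrow> nat" and h where "strict_mono k" "L2fun h"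
    "\<And>w. L2fun w \<Longrightarrow> (\<lambda>n. l2ip (g (k n)) w) \<longlonglongrightarrow> l2ip h w"
proof -
  have C0: "0 \<le> C" by (rule order_trans[OF l2sq_nonneg C[of 0]])
  have bd: "\<bar>l2ip (g n) w\<bar> \<le> sqrt C * sqrt (l2sq w)" if "L2fun w" for n w
    by (rule order_trans[OF l2ip_le[OF L that] mult_right_mono]) (auto intro: C)
  have "norm (l2ip (g n) (g m)) \<le> C" if "m \<in> UNIV" for n m
  proof -
    have "sqrt C * sqrt (l2sq (g m)) \<le> sqrt C * sqrt C" by (intro mult_left_mono real_sqrt_le_mono C) (simp add: C0)
    then show ?thesis using bd[OF L, of n m] C0 by simp
  qed
  from function_convergent_subsequence[of UNIV "\<lambda>n m. l2ip (g n) (g m)" C, OF _ this]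
  obtain k where k: "strict_mono k" "\<And>m. \<exists>l. (\<lambda>n. l2ip (g (k n)) (g m)) \<longlonglongrightarrow> l" by auto
  define F where "F n = g (k n)" for n
  have LF: "L2fun (F n)" and CF: "l2sq (F n) \<le> C" for n by (auto simp: F_def L C)
  obtain l where l: "\<And>m. (\<lambda>n. l2ip (F n) (F m)) \<longlonglongrightarrow> l m" unfolding F_def using k(2) by metis
  obtain a where a: "L2fun a" "\<And>w t. L2fun w \<Longrightarrow> (\<lambda>n. l2ip (F n) w) \<longlonglongrightarrow> t \<Longrightarrow> l2ip a w = t"
    using midpoint_hull_limit[of F C, OF LF CF] by blast
  have "(\<lambda>n. l2ip (F n) w) \<longlonglongrightarrow> l2ip a w" if w: "L2fun w" for w
  proof (rule ccontr)
    assume "\<not> ?thesis"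
    from not_tendsto_subseq[OF this] obtain e and s :: "nat \<Rightarrow> nat"
      where e: "e > 0" and s: "strict_mono s" and es: "\<And>n. \<bar>l2ip (F (s n)) w - l2ip a w\<bar> \<ge> e"
      by metis
    have "bounded (range (\<lambda>n. l2ip (F (s n)) w))"
      unfolding bounded_iff using bd[OF w] by (auto simp: F_def)
    from bounded_imp_convergent_subsequence[OF this] obtain t and r :: "nat \<Rightarrow> nat"
      where r: "strict_mono r" and t: "((\<lambda>n. l2ip (F (s n)) w) \<circ> r) \<longlonglongrightarrow> t"
      by metis
    define H where "H n = F (s (r n))" for n
    have sr: "strict_mono (\<lambda>n. s (r n))" using strict_mono_o[OF s r] by (simp add: comp_def)
    obtain b where b: "L2fun b" "\<And>w t. L2fun w \<Longrightarrow> (\<lambda>n. l2ip (H n) w) \<longlonglongrightarrow> t \<Longrightarrow> l2ip b w = t"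
      using midpoint_hull_limit[of H C, unfolded H_def, OF LF CF] unfolding H_def by blast
    have bw: "l2ip b w = t" using b(2)[OF w] t by (simp add: H_def comp_def)
    \<comment> \<open>Pairings with each \<open>F m\<close> converge along the whole sequence, so
      both candidates inherit the same values and a - b is orthogonal to every
      \<open>F m\<close>.\<close>
    have "l2ip b (F m) = l2ip a (F m)" for m
      using b(2)[OF LF] a(2)[OF LF l] LIMSEQ_subseq_LIMSEQ[OF l[of m] sr] by (simp add: H_def comp_def)
    then have 0: "l2ip (F m) (\<lambda>x. a x - b x) = 0" for m
      using l2ip_diff_left[OF a(1) b(1) LF[of m]] by (simp add: l2ip_commute)
    have Ld: "L2fun (\<lambda>x. a x - b x)" by (intro L2fun_diff a b)
    \<comment> \<open>Test against a - b itself: all pairings along the sequence are 0, so those of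
      \<open>a\<close> and of \<open>b\<close> are 0 too, and a - b is orthogonal to itself.\<close>
    have "l2ip a (\<lambda>x. a x - b x) = 0" "l2ip b (\<lambda>x. a x - b x) = 0"
      by (rule a(2)[OF Ld] b(2)[OF Ld]; simp add: 0 H_def)+
    then have "l2sq (\<lambda>x. a x - b x) = 0"
      using l2ip_diff_left[OF a(1) b(1) Ld] by (simp add: l2ip_self)
    then have "l2ip (\<lambda>x. a x - b x) w = 0" using l2ip_le[OF Ld w] by simp
    then have "l2ip a w = t" using l2ip_diff_left[OF a(1) b(1) w] bw by simp
    with t have "((\<lambda>n. l2ip (F (s n)) w) \<circ> r) \<longlonglongrightarrow> l2ip a w" by simp
    from LIMSEQ_D[OF this e] show False using es by (auto simp: not_less[symmetric])
  qed
  with that[OF k(1) a(1)] show ?thesis unfolding F_def by blast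
qed


subsection \<open>The energy space in frequency variables\<close>

text \<open>The choice in \<open>fourier_mult\<close> is over real functions, so a preimage exists
  once the product is Hermitian; this is what the symmetry of \<open>m\<close> provides.\<close>

lemma fourier_mult_spec:
  assumes u: "L2fun u" and L: "L2fun (\<lambda>\<xi>. m \<xi> * fourier u \<xi>)" and herm: "\<And>\<xi>. m (- \<xi>) = cnj (m \<xi>)"
  shows "L2fun (fourier_mult m u)"
    and "AE \<xi> in lborel. fourier (fourier_mult m u) \<xi> = m \<xi> * fourier u \<xi>"
    and "l2sq (fourier_mult m u) = l2sq (\<lambda>\<xi>. m \<xi> * fourier u \<xi>) / (2*pi)"
proof -
  have "AE \<xi> in lborel. m (- \<xi>) * fourier u (- \<xi>) = cnj (m \<xi> * fourier u \<xi>)"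
    using fourier_hermitian[OF u] by eventually_elim (simp add: herm)
  from fourier_surj[OF L this] have "\<exists>v. L2fun v \<and> (AE \<xi> in lborel. fourier v \<xi> = m \<xi> * fourier u \<xi>)" by blast
  then have *: "L2fun (fourier_mult m u) \<and> (AE \<xi> in lborel. fourier (fourier_mult m u) \<xi> = m \<xi> * fourier u \<xi>)"
    unfolding fourier_mult_def by (rule someI_ex)
  then show "L2fun (fourier_mult m u)" "AE \<xi> in lborel. fourier (fourier_mult m u) \<xi> = m \<xi> * fourier u \<xi>"
    by auto
  have "l2sq (fourier (fourier_mult m u)) = l2sq (\<lambda>\<xi>. m \<xi> * fourier u \<xi>)"
    using * L by (intro l2sq_cong_AE L2fun_measurable[OF L2fun_fourier] L2fun_measurable[OF L]) auto
  then show "l2sq (fourier_mult m u) = l2sq (\<lambda>\<xi>. m \<xi> * fourier u \<xi>) / (2*pi)"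
    using * by (simp add: plancherel field_simps)
qed

text \<open>Comparable to sqrt (1 + xi^2) + 1/xi^2, the weight behind the X norm. Division by zero
  gives the values 1 for \<open>weight\<close> and 0 for \<open>dx_inv_symbol\<close> at the origin,
  so the pointwise inequalities hold there as well.\<close>

definition weight :: "real \<Rightarrow> real" where "weight \<xi> = 1 + \<bar>\<xi>\<bar> + 1 / \<xi>^2"

lemma weight_ge_1: "1 \<le> weight \<xi>" and weight_ge_abs: "1 + \<bar>\<xi>\<bar> \<le> weight \<xi>"
  and weight_ge_inv: "1 / \<xi>^2 \<le> weight \<xi>"
  by (auto simp: weight_def)

lemma weight_measurable [measurable]: "weight \<in> borel_measurable borel"
  unfolding weight_def[abs_def] by measurable

lemma integrable_weighted:
  assumes [measurable]: "U \<in> borel_measurable borel" "a \<in> borel_measurable borel" "b \<in> borel_measurable borel"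
    and i: "integrable lborel (\<lambda>\<xi>. a \<xi> * (norm (U \<xi> :: complex))^2)"
    and le: "AE \<xi> in lborel. \<bar>b \<xi>\<bar> \<le> C * a \<xi>"
  shows "integrable lborel (\<lambda>\<xi>. b \<xi> * (norm (U \<xi>))^2)"
proof (rule Bochner_Integration.integrable_bound)
  show "integrable lborel (\<lambda>\<xi>. C * (a \<xi> * (norm (U \<xi>))^2))" using i by simp
  show "AE \<xi> in lborel. norm (b \<xi> * (norm (U \<xi>))^2) \<le> norm (C * (a \<xi> * (norm (U \<xi>))^2))"
    using le
  proof eventually_elim
    case (elim \<xi>)
    then have "\<bar>b \<xi>\<bar> * (norm (U \<xi>))^2 \<le> (C * a \<xi>) * (norm (U \<xi>))^2" by (intro mult_right_mono) auto
    then have "\<bar>b \<xi> * (norm (U \<xi>))^2\<bar> \<le> C * (a \<xi> * (norm (U \<xi>))^2)" by (simp add: abs_mult mult.assoc)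
    then show ?case using abs_ge_self order_trans unfolding real_norm_def by blast
  qed
qed measurable

lemma norm_dx_inv_symbol: "(norm (dx_inv_symbol \<xi> * z))^2 = 1 / \<xi>^2 * (norm z)^2"
  by (simp add: dx_inv_symbol_def norm_mult norm_divide power_mult_distrib power_divide)

lemma dx_inv_symbol_minus: "dx_inv_symbol (- \<xi>) = cnj (dx_inv_symbol \<xi>)"
  by (simp add: dx_inv_symbol_def)

lemma sqrt_1_sq_le: "sqrt (1 + \<xi>^2) \<le> 1 + \<bar>\<xi>\<bar>"
  by (rule real_le_lsqrt) (auto simp: power2_sum)

text \<open>Reduces membership to one weighted integral; the converse direction recovers the
  antiderivative as the multiplier \<open>dx_inv u\<close>, whose symbol is Hermitian.\<close>

lemma Xspace_iff:
  "Xspace u \<longleftrightarrow> L2fun u \<and> integrable lborel (\<lambda>\<xi>. weight \<xi> * (norm (fourier u \<xi>))^2)"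
proof
  assume X: "Xspace u"
  then have L: "L2fun u" and i: "integrable lborel (\<lambda>\<xi>. sqrt (1 + \<xi>^2) * (norm (fourier u \<xi>))^2)"
    by (auto simp: Xspace_def H_half_def)
  note [measurable] = L2fun_measurable[OF L2fun_fourier[OF L]]
  from X obtain v where v: "L2fun v" "AE \<xi> in lborel. fourier v \<xi> = dx_inv_symbol \<xi> * fourier u \<xi>"
    unfolding Xspace_def by auto
  note [measurable] = L2fun_measurable[OF L2fun_fourier[OF v(1)]]
  have "integrable lborel (\<lambda>\<xi>. 1 / \<xi>^2 * (norm (fourier u \<xi>))^2)"
  proof (rule Bochner_Integration.integrable_bound[OF L2fun_integrable[OF L2fun_fourier[OF v(1)]]])
    show "AE \<xi> in lborel. norm (1 / \<xi>^2 * (norm (fourier u \<xi>))^2) \<le> norm ((norm (fourier v \<xi>))^2)"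
      using v(2) by eventually_elim (simp add: norm_dx_inv_symbol)
  qed measurable
  moreover have "integrable lborel (\<lambda>\<xi>. (1 + \<bar>\<xi>\<bar>) * (norm (fourier u \<xi>))^2)"
  proof (rule integrable_weighted[OF _ _ _ i, where C=2])
    have "1 \<le> sqrt (1 + \<xi>^2)" "\<bar>\<xi>\<bar> \<le> sqrt (1 + \<xi>^2)" for \<xi> :: real
      by (auto intro: real_le_rsqrt)
    then show "AE \<xi> in lborel. \<bar>1 + \<bar>\<xi>\<bar>\<bar> \<le> 2 * sqrt (1 + \<xi>\<^sup>2)"
      by (intro AE_I2) (smt (verit))
  qed measurable
  ultimately have "integrable lborel (\<lambda>\<xi>. (1 + \<bar>\<xi>\<bar>) * (norm (fourier u \<xi>))^2 + 1 / \<xi>^2 * (norm (fourier u \<xi>))^2)"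
    by (intro Bochner_Integration.integrable_add)
  then show "L2fun u \<and> integrable lborel (\<lambda>\<xi>. weight \<xi> * (norm (fourier u \<xi>))^2)"
    using L by (simp add: weight_def distrib_right)
next
  assume A: "L2fun u \<and> integrable lborel (\<lambda>\<xi>. weight \<xi> * (norm (fourier u \<xi>))^2)"
  then have L: "L2fun u" and i: "integrable lborel (\<lambda>\<xi>. weight \<xi> * (norm (fourier u \<xi>))^2)" by auto
  note [measurable] = L2fun_measurable[OF L2fun_fourier[OF L]]
  have [measurable]: "dx_inv_symbol \<in> borel_measurable borel" unfolding dx_inv_symbol_def[abs_def] by measurable
  have "integrable lborel (\<lambda>\<xi>. sqrt (1 + \<xi>^2) * (norm (fourier u \<xi>))^2)"
  proof (rule integrable_weighted[OF _ _ _ i, where C=1])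
    show "AE \<xi> in lborel. \<bar>sqrt (1 + \<xi>\<^sup>2)\<bar> \<le> 1 * weight \<xi>"
      using sqrt_1_sq_le weight_ge_abs by (intro AE_I2) (simp, meson order_trans)
  qed measurable
  moreover have "L2fun (\<lambda>\<xi>. dx_inv_symbol \<xi> * fourier u \<xi>)"
  proof (rule L2funI)
    show "integrable lborel (\<lambda>\<xi>. (norm (dx_inv_symbol \<xi> * fourier u \<xi>))^2)"
      unfolding norm_dx_inv_symbol
      by (rule integrable_weighted[OF _ _ _ i, where C=1]) (auto intro: weight_ge_inv)
  qed measurable
  from fourier_mult_spec[OF L this] have "L2fun (fourier_mult dx_inv_symbol u)"
    "AE \<xi> in lborel. fourier (fourier_mult dx_inv_symbol u) \<xi> = dx_inv_symbol \<xi> * fourier u \<xi>"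
    by (simp_all add: dx_inv_symbol_minus)
  ultimately show "Xspace u" using L unfolding Xspace_def H_half_def by blast
qed

lemma Xspace_L2: "Xspace u \<Longrightarrow> L2fun u"
  by (simp add: Xspace_iff)

lemma Xspace_integrable: "Xspace u \<Longrightarrow> integrable lborel (\<lambda>\<xi>. weight \<xi> * (norm (fourier u \<xi>))^2)"
  by (simp add: Xspace_iff)

text \<open>Equivalent to the square of \<open>Xnorm\<close>, but a single integral that is
  quadratic in the transform.\<close>

definition energy :: "(real \<Rightarrow> real) \<Rightarrow> real" where
  "energy u = (LINT \<xi>|lborel. weight \<xi> * (norm (fourier u \<xi>))^2)"

lemma energy_nonneg: "0 \<le> energy u"
  unfolding energy_def using weight_ge_1 by (intro integral_nonneg_AE AE_I2 mult_nonneg_nonneg) (auto intro: order_trans[of 0 1])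

lemma Xspace_integrable_le:
  assumes X: "Xspace u" and [measurable]: "b \<in> borel_measurable borel" and b: "\<And>\<xi>. \<bar>b \<xi>\<bar> \<le> C * weight \<xi>"
  shows "integrable lborel (\<lambda>\<xi>. b \<xi> * (norm (fourier u \<xi>))^2)"
    and "(LINT \<xi>|lborel. b \<xi> * (norm (fourier u \<xi>))^2) \<le> C * energy u"
proof -
  note [measurable] = L2fun_measurable[OF L2fun_fourier[OF Xspace_L2[OF X]]]
  show i: "integrable lborel (\<lambda>\<xi>. b \<xi> * (norm (fourier u \<xi>))^2)"
    by (rule integrable_weighted[OF _ _ _ Xspace_integrable[OF X], where C=C]) (auto intro: b)
  have "(LINT \<xi>|lborel. b \<xi> * (norm (fourier u \<xi>))^2) \<le> (LINT \<xi>|lborel. C * (weight \<xi> * (norm (fourier u \<xi>))^2))"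
  proof (rule integral_mono[OF i])
    fix \<xi>
    have "b \<xi> * (norm (fourier u \<xi>))^2 \<le> (C * weight \<xi>) * (norm (fourier u \<xi>))^2"
      using b[of \<xi>] by (intro mult_right_mono) auto
    then show "b \<xi> * (norm (fourier u \<xi>))^2 \<le> C * (weight \<xi> * (norm (fourier u \<xi>))^2)" by (simp add: mult.assoc)
  qed (use Xspace_integrable[OF X] in simp)
  then show "(LINT \<xi>|lborel. b \<xi> * (norm (fourier u \<xi>))^2) \<le> C * energy u" by (simp add: energy_def)
qed

lemma dx_inv_facts:
  assumes X: "Xspace u"
  shows "L2fun (dx_inv u)" and "l2sq (dx_inv u) = (LINT \<xi>|lborel. 1 / \<xi>^2 * (norm (fourier u \<xi>))^2) / (2*pi)"
proof -
  note L = Xspace_L2[OF X]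
  note [measurable] = L2fun_measurable[OF L2fun_fourier[OF L]]
  have [measurable]: "dx_inv_symbol \<in> borel_measurable borel" unfolding dx_inv_symbol_def[abs_def] by measurable
  have 1: "L2fun (\<lambda>\<xi>. dx_inv_symbol \<xi> * fourier u \<xi>)"
  proof (rule L2funI)
    show "integrable lborel (\<lambda>\<xi>. (norm (dx_inv_symbol \<xi> * fourier u \<xi>))^2)"
      unfolding norm_dx_inv_symbol
      by (rule Xspace_integrable_le[OF X, where C=1]) (auto intro: weight_ge_inv)
  qed measurable
  show "L2fun (dx_inv u)" unfolding dx_inv_def by (rule fourier_mult_spec(1)[OF L 1 dx_inv_symbol_minus])
  show "l2sq (dx_inv u) = (LINT \<xi>|lborel. 1 / \<xi>^2 * (norm (fourier u \<xi>))^2) / (2*pi)"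
    unfolding dx_inv_def fourier_mult_spec(3)[OF L 1 dx_inv_symbol_minus] unfolding l2sq_def norm_dx_inv_symbol ..
qed

lemma D_half_facts:
  assumes X: "Xspace u"
  shows "L2fun (D_half u)" and "l2sq (D_half u) = (LINT \<xi>|lborel. \<bar>\<xi>\<bar> * (norm (fourier u \<xi>))^2) / (2*pi)"
proof -
  note L = Xspace_L2[OF X]
  note [measurable] = L2fun_measurable[OF L2fun_fourier[OF L]]
  have eq: "(norm (complex_of_real (sqrt \<bar>\<xi>\<bar>) * z))^2 = \<bar>\<xi>\<bar> * (norm z)^2" for \<xi> z
    by (simp add: norm_mult power_mult_distrib)
  have 1: "L2fun (\<lambda>\<xi>. complex_of_real (sqrt \<bar>\<xi>\<bar>) * fourier u \<xi>)"
  proof (rule L2funI)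
    show "integrable lborel (\<lambda>\<xi>. (norm (complex_of_real (sqrt \<bar>\<xi>\<bar>) * fourier u \<xi>))^2)"
      unfolding eq by (rule Xspace_integrable_le[OF X, where C=1]) (auto simp: weight_def)
  qed measurable
  have herm: "complex_of_real (sqrt \<bar>- \<xi>\<bar>) = cnj (complex_of_real (sqrt \<bar>\<xi>\<bar>))" for \<xi> by simp
  show "L2fun (D_half u)" unfolding D_half_def by (rule fourier_mult_spec(1)[OF L 1 herm])
  show "l2sq (D_half u) = (LINT \<xi>|lborel. \<bar>\<xi>\<bar> * (norm (fourier u \<xi>))^2) / (2*pi)"
    unfolding D_half_def fourier_mult_spec(3)[OF L 1 herm] unfolding l2sq_def eq ..
qed

text \<open>Each summand of \<open>Xnorm\<close> has a frequency weight bounded by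
  \<open>weight\<close>; thus energies tending to 0 give convergence in X.\<close>

lemma Xnorm_le:
  assumes X: "Xspace u" shows "Xnorm u \<le> 2 * sqrt (energy u / (2*pi))"
proof -
  have "(LINT \<xi>|lborel. sqrt (1 + \<xi>^2) * (norm (fourier u \<xi>))^2) \<le> 1 * energy u"
  proof (rule Xspace_integrable_le[OF X])
    show "\<bar>sqrt (1 + \<xi>\<^sup>2)\<bar> \<le> 1 * weight \<xi>" for \<xi>
      using sqrt_1_sq_le[of \<xi>] weight_ge_abs[of \<xi>] by simp
  qed measurable
  then have "H_half_norm u \<le> sqrt (energy u / (2*pi))"
    unfolding H_half_norm_def by (intro real_sqrt_le_mono) (simp add: divide_right_mono)
  moreover have "(LINT \<xi>|lborel. 1 / \<xi>^2 * (norm (fourier u \<xi>))^2) \<le> 1 * energy u"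
    by (rule Xspace_integrable_le[OF X]) (auto intro: weight_ge_inv)
  then have "l2sq (dx_inv u) \<le> energy u / (2*pi)" unfolding dx_inv_facts(2)[OF X] by (intro divide_right_mono) auto
  then have "sqrt (LINT x|lborel. (dx_inv u x)^2) \<le> sqrt (energy u / (2*pi))"
    by (intro real_sqrt_le_mono) (simp add: l2sq_def)
  ultimately show ?thesis unfolding Xnorm_def by linarith
qed

lemma Xnorm_nonneg: "0 \<le> Xnorm u"
  unfolding Xnorm_def H_half_norm_def by (intro add_nonneg_nonneg real_sqrt_ge_zero mult_nonneg_nonneg integral_nonneg_AE AE_I2) auto

lemma integral_linear3:
  fixes f g h :: "real \<Rightarrow> real"
  assumes "integrable lborel f" "integrable lborel g" "integrable lborel h"
  shows "a * (LINT x|lborel. f x) - b * (LINT x|lborel. g x) + d * (LINT x|lborel. h x)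
    = (LINT x|lborel. a * f x - b * g x + d * h x)"
  using assms by simp

lemma I_fun_eq:
  assumes X: "Xspace u"
  shows "I_fun \<beta> c \<gamma> u = (LINT \<xi>|lborel. (\<beta> * \<bar>\<xi>\<bar> - c + \<gamma> / \<xi>^2) * (norm (fourier u \<xi>))^2) / (2*pi)"
proof -
  note L = Xspace_L2[OF X]
  have i: "integrable lborel (\<lambda>\<xi>. \<bar>\<xi>\<bar> * (norm (fourier u \<xi>))^2)" "integrable lborel (\<lambda>\<xi>. 1 * (norm (fourier u \<xi>))^2)"
    "integrable lborel (\<lambda>\<xi>. 1 / \<xi>^2 * (norm (fourier u \<xi>))^2)"
    by (rule Xspace_integrable_le[OF X, where C=1]; auto simp: weight_def)+
  have "I_fun \<beta> c \<gamma> u = \<beta> * l2sq (D_half u) - c * l2sq u + \<gamma> * l2sq (dx_inv u)"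
    unfolding I_fun_def l2sq_def using L2fun_integrable[OF D_half_facts(1)[OF X]] L2fun_integrable[OF L] L2fun_integrable[OF dx_inv_facts(1)[OF X]]
    by (simp add: power2_abs)
  also have "l2sq u = (LINT \<xi>|lborel. 1 * (norm (fourier u \<xi>))^2) / (2*pi)"
    using plancherel[OF L] by (simp add: l2sq_def)
  finally have "I_fun \<beta> c \<gamma> u = (\<beta> * (LINT \<xi>|lborel. \<bar>\<xi>\<bar> * (norm (fourier u \<xi>))^2)
      - c * (LINT \<xi>|lborel. 1 * (norm (fourier u \<xi>))^2) + \<gamma> * (LINT \<xi>|lborel. 1 / \<xi>^2 * (norm (fourier u \<xi>))^2)) / (2*pi)"
    unfolding D_half_facts(2)[OF X] dx_inv_facts(2)[OF X] by (simp add: diff_divide_distrib add_divide_distrib)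
  also have "\<beta> * (LINT \<xi>|lborel. \<bar>\<xi>\<bar> * (norm (fourier u \<xi>))^2)
      - c * (LINT \<xi>|lborel. 1 * (norm (fourier u \<xi>))^2) + \<gamma> * (LINT \<xi>|lborel. 1 / \<xi>^2 * (norm (fourier u \<xi>))^2)
    = (LINT \<xi>|lborel. \<beta> * (\<bar>\<xi>\<bar> * (norm (fourier u \<xi>))^2) - c * (1 * (norm (fourier u \<xi>))^2) + \<gamma> * (1 / \<xi>^2 * (norm (fourier u \<xi>))^2))"
    by (rule integral_linear3[OF i])
  also have "\<dots> = (LINT \<xi>|lborel. (\<beta> * \<bar>\<xi>\<bar> - c + \<gamma> / \<xi>^2) * (norm (fourier u \<xi>))^2)"
    by (intro Bochner_Integration.integral_cong) (auto simp: algebra_simps)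
  finally show ?thesis .
qed

section \<open>Stability of the space under linear operations and translations\<close>

lemma Xspace_add: assumes "Xspace u" "Xspace v" shows "Xspace (\<lambda>x. u x + v x)"
proof -
  note L = Xspace_L2[OF assms(1)] Xspace_L2[OF assms(2)]
  note [measurable] = L2fun_measurable[OF L2fun_fourier[OF L(1)]] L2fun_measurable[OF L2fun_fourier[OF L(2)]]
    L2fun_measurable[OF L2fun_fourier[OF L2fun_add[OF L]]]
  have "integrable lborel (\<lambda>\<xi>. weight \<xi> * (norm (fourier (\<lambda>x. u x + v x) \<xi>))^2)"
  proof (rule Bochner_Integration.integrable_bound)
    show "integrable lborel (\<lambda>\<xi>. 2 * (weight \<xi> * (norm (fourier u \<xi>))^2) + 2 * (weight \<xi> * (norm (fourier v \<xi>))^2))"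
      using assms by (auto simp: Xspace_iff)
    show "AE \<xi> in lborel. norm (weight \<xi> * (norm (fourier (\<lambda>x. u x + v x) \<xi>))^2)
       \<le> norm (2 * (weight \<xi> * (norm (fourier u \<xi>))^2) + 2 * (weight \<xi> * (norm (fourier v \<xi>))^2))"
      using fourier_add[OF L]
    proof eventually_elim
      case (elim \<xi>)
      have "(norm (fourier u \<xi> + fourier v \<xi>))^2 \<le> (norm (fourier u \<xi>) + norm (fourier v \<xi>))^2"
        by (intro power_mono norm_triangle_ineq) auto
      also have "\<dots> \<le> 2 * (norm (fourier u \<xi>))^2 + 2 * (norm (fourier v \<xi>))^2"
        using sum_squares_bound[of "norm (fourier u \<xi>)" "norm (fourier v \<xi>)"] by (simp add: power2_sum)
      finally have "weight \<xi> * (norm (fourier u \<xi> + fourier v \<xi>))^2 \<le> weight \<xi> * (2 * (norm (fourier u \<xi>))^2 + 2 * (norm (fourier v \<xi>))^2)"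
        using weight_ge_1[of \<xi>] by (intro mult_left_mono) auto
      then show ?case using elim weight_ge_1[of \<xi>] by (simp add: algebra_simps)
    qed
  qed measurable
  then show ?thesis by (simp add: Xspace_iff L2fun_add L)
qed

lemma Xspace_scale: assumes "Xspace u" shows "Xspace (\<lambda>x. a * u x)"
proof -
  note L = Xspace_L2[OF assms]
  have La: "L2fun (\<lambda>x. a * u x)" using L2fun_scaleR[OF L, of a] by simp
  note [measurable] = L2fun_measurable[OF L2fun_fourier[OF L]] L2fun_measurable[OF L2fun_fourier[OF La]]
  have "integrable lborel (\<lambda>\<xi>. weight \<xi> * (norm (fourier (\<lambda>x. a * u x) \<xi>))^2)"
  proof (rule integrable_cong_AE_imp)
    show "integrable lborel (\<lambda>\<xi>. a^2 * (weight \<xi> * (norm (fourier u \<xi>))^2))" using assms by (simp add: Xspace_iff)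
    show "AE \<xi> in lborel. a^2 * (weight \<xi> * (norm (fourier u \<xi>))^2) = weight \<xi> * (norm (fourier (\<lambda>x. a * u x) \<xi>))^2"
      using fourier_scale[OF L, of a] by eventually_elim (simp add: norm_mult power_mult_distrib)
  qed measurable
  then show ?thesis by (simp add: Xspace_iff La)
qed

lemma Xspace_diff: "Xspace u \<Longrightarrow> Xspace v \<Longrightarrow> Xspace (\<lambda>x. u x - v x)"
  using Xspace_add[OF _ Xspace_scale[of v "-1"], of u] by simp

lemma Xspace_shift: assumes "Xspace u" shows "Xspace (\<lambda>x. u (x + y))"
proof -
  note L = Xspace_L2[OF assms]
  note [measurable] = L2fun_measurable[OF L2fun_fourier[OF L]] L2fun_measurable[OF L2fun_fourier[OF L2fun_shift[OF L]]]
  have "integrable lborel (\<lambda>\<xi>. weight \<xi> * (norm (fourier (\<lambda>x. u (x + y)) \<xi>))^2)"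
  proof (rule integrable_cong_AE_imp)
    show "integrable lborel (\<lambda>\<xi>. weight \<xi> * (norm (fourier u \<xi>))^2)" using assms by (simp add: Xspace_iff)
    show "AE \<xi> in lborel. weight \<xi> * (norm (fourier u \<xi>))^2 = weight \<xi> * (norm (fourier (\<lambda>x. u (x + y)) \<xi>))^2"
      using fourier_shift[OF L, of y] by eventually_elim (simp add: norm_mult)
  qed measurable
  then show ?thesis by (simp add: Xspace_iff L2fun_shift L)
qed


subsection \<open>Low-frequency parts and the embedding into Lebesgue spaces\<close>

definition lowfreq :: "real \<Rightarrow> (real \<Rightarrow> real) \<Rightarrow> real \<Rightarrow> complex" where
  "lowfreq N u \<xi> = indicator {-N..N} \<xi> *\<^sub>R fourier u \<xi>"

text \<open>The low-pass part of u, given by an integral, hence defined at every point. Suprema and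
  pointwise limits of it are meaningful, unlike those of u.\<close>

definition band :: "real \<Rightarrow> (real \<Rightarrow> real) \<Rightarrow> real \<Rightarrow> real" where
  "band N u = ift (lowfreq N u)"

lemma L2fun_interval: "L2fun (\<lambda>x. indicator {a..b} x :: real)" for a b :: real
proof (rule L2fun_bound)
  show "integrable lborel (\<lambda>x. indicator {a..b} x * 1 :: real)" by (rule integrable_indicator_interval)
qed (auto simp: indicator_def)

lemma lowfreq_facts:
  assumes L: "L2fun u"
  shows "L2fun (lowfreq N u)" and "integrable lborel (lowfreq N u)"
    and "AE \<xi> in lborel. lowfreq N u (- \<xi>) = cnj (lowfreq N u \<xi>)"
proof -
  note [measurable] = L2fun_measurable[OF L2fun_fourier[OF L]]
  have [measurable]: "lowfreq N u \<in> borel_measurable borel" unfolding lowfreq_def[abs_def] by measurable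
  show "L2fun (lowfreq N u)"
    by (rule L2fun_bound[OF _ L2fun_integrable[OF L2fun_fourier[OF L]]]) (auto simp: lowfreq_def indicator_def)
  show "integrable lborel (lowfreq N u)"
    by (rule Bochner_Integration.integrable_bound[OF L2fun_norm_mult[OF L2fun_interval[of "-N" N] L2fun_fourier[OF L]]])
       (auto simp: lowfreq_def)
  show "AE \<xi> in lborel. lowfreq N u (- \<xi>) = cnj (lowfreq N u \<xi>)"
    using fourier_hermitian[OF L] by eventually_elim (auto simp: lowfreq_def indicator_def)
qed

lemma band_facts:
  assumes L: "L2fun u"
  shows "L2fun (band N u)" and "AE \<xi> in lborel. fourier (band N u) \<xi> = lowfreq N u \<xi>"
  unfolding band_def using fourier_ift[OF lowfreq_facts[OF L]] by auto

text \<open>Beyond frequency N the weight exceeds N. The rate 1/N is used in the embedding, in the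
  exclusion of vanishing and in local compactness.\<close>

lemma l2sq_high:
  assumes X: "Xspace u" and N: "N > 0"
  shows "l2sq (\<lambda>x. u x - band N u x) \<le> energy u / (2 * pi * N)"
proof -
  note L = Xspace_L2[OF X]
  have "2 * pi * l2sq (\<lambda>x. u x - band N u x) = l2sq (\<lambda>\<xi>. fourier u \<xi> - fourier (band N u) \<xi>)"
    by (simp add: l2sq_fourier_diff L band_facts)
  also have "\<dots> = l2sq (\<lambda>\<xi>. fourier u \<xi> - lowfreq N u \<xi>)"
    using band_facts(2)[OF L, of N]
    by (intro l2sq_cong_AE L2fun_measurable[OF L2fun_diff] L2fun_fourier band_facts lowfreq_facts L) auto
  also have "\<dots> = (LINT \<xi>|lborel. indicator (- {-N..N}) \<xi> * (norm (fourier u \<xi>))^2)"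
    unfolding l2sq_def by (intro Bochner_Integration.integral_cong) (auto simp: lowfreq_def indicator_def)
  also have "\<dots> \<le> (1/N) * energy u"
  proof (rule Xspace_integrable_le[OF X])
    fix \<xi>
    show "\<bar>indicator (- {-N..N}) \<xi>\<bar> \<le> (1/N) * weight \<xi>"
      using weight_ge_abs[of \<xi>] N by (auto simp: indicator_def field_simps)
  qed measurable
  finally show ?thesis using N by (simp add: field_simps)
qed

lemma integral_log_weight:
  assumes N: "N \<ge> (0::real)"
  shows "L2fun (\<lambda>x. indicator {-N..N} x / sqrt (1 + \<bar>x\<bar>))"
    and "l2sq (\<lambda>x. indicator {-N..N} x / sqrt (1 + \<bar>x\<bar>)) \<le> 2 * ln (1 + N)"
proof -
  have 1: "has_bochner_integral lborel (\<lambda>x. (1 / (1 + x)) * indicator {0..N} x) (ln (1 + N) - ln (1 + 0))"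
    using N by (intro has_bochner_integral_FTC_Icc_real) (auto intro!: derivative_eq_intros continuous_intros)
  have 2: "has_bochner_integral lborel (\<lambda>x. (1 / (1 - x)) * indicator {-N..0} x) (- ln (1 - 0) - (- ln (1 - (-N))))"
    using N by (intro has_bochner_integral_FTC_Icc_real) (auto intro!: derivative_eq_intros continuous_intros)
  have 3: "has_bochner_integral lborel (\<lambda>x. (1 / (1 + x)) * indicator {0..N} x + (1 / (1 - x)) * indicator {-N..0} x) (2 * ln (1 + N))"
    using has_bochner_integral_add[OF 1 2] by simp
  have le: "(norm (indicator {-N..N} x / sqrt (1 + \<bar>x\<bar>)))^2 \<le> (1 / (1 + x)) * indicator {0..N} x + (1 / (1 - x)) * indicator {-N..0} x" for x
    by (auto simp: indicator_def power_divide)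
  show L: "L2fun (\<lambda>x. indicator {-N..N} x / sqrt (1 + \<bar>x\<bar>))"
    by (rule L2fun_bound[OF _ integrable.intros[OF 3]]) (use le in auto)
  have "l2sq (\<lambda>x. indicator {-N..N} x / sqrt (1 + \<bar>x\<bar>)) \<le> (LINT x|lborel. (1 / (1 + x)) * indicator {0..N} x + (1 / (1 - x)) * indicator {-N..0} x)"
    unfolding l2sq_def by (intro integral_mono L2fun_integrable[OF L] integrable.intros[OF 3] le)
  also have "\<dots> = 2 * ln (1 + N)" by (rule has_bochner_integral_integral_eq[OF 3])
  finally show "l2sq (\<lambda>x. indicator {-N..N} x / sqrt (1 + \<bar>x\<bar>)) \<le> 2 * ln (1 + N)" .
qed

text \<open>Cauchy-Schwarz with sqrt (1 + |xi|) and its inverse; the latter has squared norm 2 ln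
  (1+N) on the band. The logarithm is the price of H^(1/2) being the borderline space for
  boundedness. The factor 1/(2 pi) is dropped.\<close>

lemma band_le:
  assumes X: "Xspace u" and N: "N \<ge> 0"
  shows "\<bar>band N u x\<bar> \<le> sqrt (2 * ln (1 + N) * energy u)"
proof -
  note L = Xspace_L2[OF X]
  note [measurable] = L2fun_measurable[OF L2fun_fourier[OF L]]
  define g where "g \<xi> = sqrt (1 + \<bar>\<xi>\<bar>) *\<^sub>R fourier u \<xi>" for \<xi>
  have g2: "(norm (g \<xi>))^2 = (1 + \<bar>\<xi>\<bar>) * (norm (fourier u \<xi>))^2" for \<xi> by (simp add: g_def power_mult_distrib)
  have b: "\<bar>1 + \<bar>\<xi>\<bar>\<bar> \<le> 1 * weight \<xi>" for \<xi> using weight_ge_abs[of \<xi>] by simp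
  have Lg: "L2fun g"
    by (rule L2funI) (simp add: g_def[abs_def], unfold g2, rule Xspace_integrable_le(1)[OF X _ b], measurable)
  have ge: "l2sq g \<le> energy u" unfolding l2sq_def g2 using Xspace_integrable_le(2)[OF X _ b] by simp
  have "\<bar>Re (LINT \<xi>|lborel. lowfreq N u \<xi> * cis (x * \<xi>))\<bar> \<le> (LINT \<xi>|lborel. norm (lowfreq N u \<xi> * cis (x * \<xi>)))"
    by (rule order_trans[OF abs_Re_le_cmod integral_norm_bound])
  also have "\<dots> = (LINT \<xi>|lborel. norm (indicator {-N..N} \<xi> / sqrt (1 + \<bar>\<xi>\<bar>)) * norm (g \<xi>))"
    by (intro Bochner_Integration.integral_cong) (auto simp: norm_mult lowfreq_def g_def)
  also have "\<dots> \<le> sqrt (l2sq (\<lambda>x. indicator {-N..N} x / sqrt (1 + \<bar>x\<bar>))) * sqrt (l2sq g)"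
    by (rule L2_Cauchy_Schwarz[OF integral_log_weight(1)[OF N] Lg])
  also have "\<dots> \<le> sqrt (2 * ln (1 + N)) * sqrt (energy u)"
    using integral_log_weight(2)[OF N] ge N by (intro mult_mono real_sqrt_le_mono) auto
  finally have 1: "\<bar>Re (LINT \<xi>|lborel. lowfreq N u \<xi> * cis (x * \<xi>))\<bar> \<le> sqrt (2 * ln (1 + N) * energy u)"
    by (simp add: real_sqrt_mult)
  have "\<bar>band N u x\<bar> = \<bar>Re (LINT \<xi>|lborel. lowfreq N u \<xi> * cis (x * \<xi>))\<bar> / (2 * pi)"
    by (simp add: band_def ift_def)
  also have "\<dots> \<le> \<bar>Re (LINT \<xi>|lborel. lowfreq N u \<xi> * cis (x * \<xi>))\<bar>"
    using pi_gt3 by (simp add: divide_le_eq mult_le_cancel_left1)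
  finally show ?thesis using 1 by simp
qed

text \<open>An identity at every point, since almost everywhere knowledge of the transforms suffices
  under the integral. It allows a translation to move a chosen point to the origin.\<close>

lemma band_shift:
  assumes L: "L2fun u" shows "band N (\<lambda>x. u (x + y)) x = band N u (x + y)"
proof -
  note [measurable] = L2fun_measurable[OF L2fun_fourier[OF L]] L2fun_measurable[OF L2fun_fourier[OF L2fun_shift[OF L]]]
  have "(LINT \<xi>|lborel. lowfreq N (\<lambda>x. u (x + y)) \<xi> * cis (x * \<xi>)) = (LINT \<xi>|lborel. lowfreq N u \<xi> * cis ((x + y) * \<xi>))"
  proof (rule integral_cong_AE)
    show "AE \<xi> in lborel. lowfreq N (\<lambda>x. u (x + y)) \<xi> * cis (x * \<xi>) = lowfreq N u \<xi> * cis ((x + y) * \<xi>)"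
      using fourier_shift[OF L, of y] by eventually_elim (simp add: lowfreq_def cis_mult algebra_simps)
  qed (unfold lowfreq_def[abs_def], measurable)
  then show ?thesis by (simp add: band_def ift_def)
qed

text \<open>At height \<open>k\<close> a frequency cutoff growing polynomially in \<open>k\<close> leaves the low-frequency part
  below \<open>k/2\<close>, so that the set where \<open>u\<close> is about \<open>k\<close> is controlled by the high-frequency part
  in mean square.\<close>

lemma embedding_power:
  fixes M :: real
  assumes M: "M \<ge> 0"
  obtains C where "C \<ge> 0" "\<And>u. Xspace u \<Longrightarrow> energy u \<le> M \<Longrightarrow> integrable lborel (\<lambda>x. \<bar>u x\<bar> ^ (j + 2))"
    "\<And>u. Xspace u \<Longrightarrow> energy u \<le> M \<Longrightarrow> (LINT x|lborel. \<bar>u x\<bar> ^ (j + 2)) \<le> C"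
proof -
  define m where "m = j + 2"
  \<comment> \<open>Threshold for \<open>small\<close>. From ln (k+2) <= k+1 <= 2k the bound for the
    band at height k is linear in k under the root, and k >= 32 (m+2) M makes it at most
    (k/2)^2.\<close>
  define k0 :: nat where "k0 = nat \<lceil>8 * (m + 2) * M\<rceil> * 4 + 1"
  have k0: "k0 \<ge> 1" "32 * (m + 2) * M \<le> real k0"
  proof -
    have "8 * (m + 2) * M \<le> real (nat \<lceil>8 * (m + 2) * M\<rceil>)" by (rule real_nat_ceiling_ge)
    then show "32 * (m + 2) * M \<le> real k0" unfolding k0_def of_nat_add of_nat_mult of_nat_numeral of_nat_1 by linarith
  qed (simp add: k0_def)
  \<comment> \<open>Frequency cutoff at height k. The exponent m+2 cancels the factor (k+1)^m that
    u^m costs there and leaves 1/(k+1)^2, which is summable.\<close>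
  define A where "A k = real (k + 1) ^ (m + 2)" for k
  have A: "A k \<ge> 1" for k unfolding A_def by (rule one_le_power) simp
  \<comment> \<open>The first term covers heights below \<open>k0\<close>, where |u|^m <= k0^j u^2;
    the second is the sum of 4 M/(k+1)^2 over all heights.\<close>
  define C where "C = real k0 ^ j * M + 4 * M * (pi^2/6)"
  have C0: "C \<ge> 0" unfolding C_def using M by simp
  have small: "sqrt (2 * ln (1 + A k) * M) \<le> real k / 2" if k: "k \<ge> k0" for k
  proof (rule real_le_lsqrt)
    have "1 + A k \<le> real (k + 2) ^ (m + 2)"
    proof -
      have "(k + 1) ^ (m + 2) < (k + 2) ^ (m + 2)" by (intro power_strict_mono) auto
      then have "real (1 + (k + 1) ^ (m + 2)) \<le> real ((k + 2) ^ (m + 2))" by (intro of_nat_mono) simp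
      then show ?thesis unfolding A_def by (simp only: of_nat_add of_nat_power of_nat_1)
    qed
    then have "ln (1 + A k) \<le> ln (real (k + 2) ^ (m + 2))" using A[of k] by (subst ln_le_cancel_iff) auto
    also have "\<dots> = real (m + 2) * ln (real (k + 2))" by (rule ln_realpow)
    also have "\<dots> \<le> real (m + 2) * (real (k + 2) - 1)" by (intro mult_left_mono ln_le_minus_one) auto
    also have "\<dots> \<le> real (m + 2) * (2 * real k)" using k k0 by (intro mult_left_mono) auto
    finally have "2 * ln (1 + A k) * M \<le> 2 * (real (m + 2) * (2 * real k)) * M" using M by (intro mult_right_mono mult_left_mono) auto
    also have "\<dots> = (32 * (m + 2) * M) * real k / 8" by simp
    also have "\<dots> \<le> real k * real k / 8" using k0(2) k by (intro divide_right_mono mult_right_mono) auto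
    also have "\<dots> \<le> (real k / 2)^2" by (simp add: power2_eq_square)
    finally show "2 * ln (1 + A k) * M \<le> (real k / 2)^2" .
  qed simp
  have main: "(\<integral>\<^sup>+x. ennreal (\<bar>u x\<bar> ^ m) \<partial>lborel) \<le> ennreal C" if X: "Xspace u" and E: "energy u \<le> M" for u
  proof -
    note L = Xspace_L2[OF X]
    note [measurable] = L2fun_measurable[OF L] L2fun_measurable[OF band_facts(1)[OF L]]
    define D where "D k x = u x - band (A k) u x" for k x
    \<comment> \<open>At height k at least half of u comes from \<open>D k\<close>, so 1 <= (4/k^2)
      (D k)^2 there, and |u|^m <= (k+1)^m. For k = 0 division by zero gives \<open>c 0 = 0\<close>,
      while the heights used satisfy k >= k0 >= 1.\<close>
    define c where "c k = 4 * real (k + 1) ^ m / (real k)^2" for k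
    have c0: "0 \<le> c k" for k by (simp add: c_def)
    have [measurable]: "D k \<in> borel_measurable borel" for k unfolding D_def by measurable
    have pt: "ennreal (\<bar>u x\<bar> ^ m) \<le> ennreal (real k0 ^ j * (norm (u x))^2) + (\<Sum>k. ennreal (c k * (norm (D k x))^2))" for x
    proof (cases "\<bar>u x\<bar> < real k0")
      case True
      then have "\<bar>u x\<bar> ^ j * (u x)^2 \<le> real k0 ^ j * (u x)^2" by (intro mult_right_mono power_mono) auto
      then have "\<bar>u x\<bar> ^ m \<le> real k0 ^ j * (norm (u x))^2"
        by (simp only: m_def power_add power2_abs real_norm_def)
      then have "ennreal (\<bar>u x\<bar> ^ m) \<le> ennreal (real k0 ^ j * (norm (u x))^2)" by (rule ennreal_leI)
      then show ?thesis by (simp add: add_increasing2)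
    next
      case False
      define k where "k = nat \<lfloor>\<bar>u x\<bar>\<rfloor>"
      have k: "k \<ge> k0" "real k \<le> \<bar>u x\<bar>" "\<bar>u x\<bar> \<le> real (k + 1)"
        using False by (auto simp: k_def le_nat_floor) linarith+
      have k1: "real k > 0" using k(1) k0(1) by simp
      have "\<bar>band (A k) u x\<bar> \<le> sqrt (2 * ln (1 + A k) * energy u)"
        by (rule band_le[OF X]) (use A[of k] in simp)
      also have "\<dots> \<le> sqrt (2 * ln (1 + A k) * M)" using A[of k] E by (intro real_sqrt_le_mono mult_left_mono) auto
      also have "\<dots> \<le> real k / 2" by (rule small[OF k(1)])
      finally have "real k / 2 \<le> \<bar>D k x\<bar>" unfolding D_def using k(2) by linarith
      then have "(real k / 2)^2 \<le> \<bar>D k x\<bar>^2" by (intro power_mono) auto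
      then have "1 \<le> 4 / (real k)^2 * (D k x)^2" using k1 by (simp add: field_simps)
      then have "\<bar>u x\<bar> ^ m * 1 \<le> real (k + 1) ^ m * (4 / (real k)^2 * (D k x)^2)"
        using k(3) by (intro mult_mono power_mono) auto
      then have "ennreal (\<bar>u x\<bar> ^ m) \<le> ennreal (c k * (norm (D k x))^2)"
        by (intro ennreal_leI) (simp add: c_def mult_ac)
      also have "\<dots> \<le> (\<Sum>k. ennreal (c k * (norm (D k x))^2))"
        using sum_le_suminf[of "\<lambda>k. ennreal (c k * (norm (D k x))^2)" "{k}"] by simp
      finally show ?thesis by (simp add: add_increasing)
    qed
    have termle: "c k * l2sq (D k) \<le> 4 * M * (1 / (real k + 1)^2)" for k
    proof (cases "k = 0")
      case True then show ?thesis using M by (simp add: c_def)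
    next
      case False
      have "l2sq (D k) \<le> energy u / (2 * pi * A k)"
        unfolding D_def by (rule l2sq_high[OF X]) (use A[of k] in simp)
      also have "\<dots> \<le> M / (1 * A k)"
        using A[of k] pi_gt3 E M by (intro frac_le mult_right_mono) auto
      finally have 1: "l2sq (D k) \<le> M / A k" by simp
      have "c k \<le> 4 * real (k + 1) ^ m"
      proof -
        have "1 \<le> (real k)^2" using False by (simp add: one_le_power)
        then have "4 * real (k + 1) ^ m / (real k)^2 \<le> 4 * real (k + 1) ^ m / 1" using False by (intro divide_left_mono) auto
        then show ?thesis by (simp add: c_def)
      qed
      with 1 have "c k * l2sq (D k) \<le> (4 * real (k + 1) ^ m) * (M / A k)"
        by (intro mult_mono) auto
      also have "\<dots> = 4 * M * (1 / (real k + 1)^2)"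
        unfolding A_def power_add by (simp add: divide_simps add.commute)
      finally show ?thesis .
    qed
    have uM: "l2sq u \<le> M"
    proof -
      have "2 * pi * l2sq u \<le> 1 * energy u"
        using Xspace_integrable_le(2)[OF X, of "\<lambda>_. 1" 1] weight_ge_1 plancherel[OF L] by (simp add: l2sq_def)
      moreover have "1 * l2sq u \<le> 2 * pi * l2sq u" using pi_gt3 by (intro mult_right_mono) auto
      ultimately show ?thesis using E by linarith
    qed
    have "(\<integral>\<^sup>+x. ennreal (\<bar>u x\<bar> ^ m) \<partial>lborel)
      \<le> (\<integral>\<^sup>+x. ennreal (real k0 ^ j * (norm (u x))^2) + (\<Sum>k. ennreal (c k * (norm (D k x))^2)) \<partial>lborel)"
      by (intro nn_integral_mono pt)
    also have "\<dots> = (\<integral>\<^sup>+x. ennreal (real k0 ^ j * (norm (u x))^2) \<partial>lborel) + (\<integral>\<^sup>+x. (\<Sum>k. ennreal (c k * (norm (D k x))^2)) \<partial>lborel)"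
      by (rule nn_integral_add) measurable
    also have "(\<integral>\<^sup>+x. ennreal (real k0 ^ j * (norm (u x))^2) \<partial>lborel) = ennreal (real k0 ^ j * l2sq u)"
      using L unfolding l2sq_def by (subst nn_integral_eq_integral) (auto simp: L2fun_def)
    also have "(\<integral>\<^sup>+x. (\<Sum>k. ennreal (c k * (norm (D k x))^2)) \<partial>lborel) = (\<Sum>k. \<integral>\<^sup>+x. ennreal (c k * (norm (D k x))^2) \<partial>lborel)"
      by (rule nn_integral_suminf) measurable
    also have "\<dots> = (\<Sum>k. ennreal (c k * l2sq (D k)))"
    proof -
      have "(\<integral>\<^sup>+x. ennreal (c k * (norm (D k x))^2) \<partial>lborel) = ennreal (c k * l2sq (D k))" for k
      proof -
        have "L2fun (D k)" unfolding D_def by (intro L2fun_diff L band_facts)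
        then show ?thesis unfolding l2sq_def using c0 by (subst nn_integral_eq_integral) (auto simp: L2fun_def)
      qed
      then show ?thesis by simp
    qed
    also have "\<dots> \<le> (\<Sum>k. ennreal (4 * M * (1 / (real k + 1)^2)))"
      by (intro suminf_le ennreal_leI termle) auto
    also have "\<dots> = ennreal (4 * M * (pi^2/6))"
      using sums_mult[OF inverse_squares_sums, of "4 * M"] M by (intro suminf_ennreal_eq) (auto simp: add.commute)
    also have "ennreal (real k0 ^ j * l2sq u) + ennreal (4 * M * (pi^2/6)) = ennreal (real k0 ^ j * l2sq u + 4 * M * (pi^2/6))"
      using M by (subst ennreal_plus) auto
    also have "\<dots> \<le> ennreal C" unfolding C_def using uM by (intro ennreal_leI add_right_mono mult_left_mono) auto
    finally show ?thesis by (simp add: add_right_mono)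
  qed
  have int: "integrable lborel (\<lambda>x. \<bar>u x\<bar> ^ m)" if X: "Xspace u" and E: "energy u \<le> M" for u
  proof (rule integrableI_bounded)
    show "(\<lambda>x. \<bar>u x\<bar> ^ m) \<in> borel_measurable lborel" using L2fun_measurable[OF Xspace_L2[OF X]] by measurable
    show "(\<integral>\<^sup>+x. ennreal (norm (\<bar>u x\<bar> ^ m)) \<partial>lborel) < \<infinity>"
      using le_less_trans[OF main[OF X E] ennreal_less_top] by simp
  qed
  show ?thesis
  proof (rule that[OF C0])
    fix u assume u: "Xspace u" "energy u \<le> M"
    show "integrable lborel (\<lambda>x. \<bar>u x\<bar> ^ (j + 2))" using int[OF u] by (simp only: m_def)
    have "ennreal (LINT x|lborel. \<bar>u x\<bar> ^ m) = (\<integral>\<^sup>+x. ennreal (\<bar>u x\<bar> ^ m) \<partial>lborel)"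
      by (rule nn_integral_eq_integral[symmetric, OF int[OF u]]) simp
    then have "ennreal (LINT x|lborel. \<bar>u x\<bar> ^ m) \<le> ennreal C" using main[OF u] by simp
    then show "(LINT x|lborel. \<bar>u x\<bar> ^ (j + 2)) \<le> C" using C0 by (simp only: m_def) (simp add: ennreal_le_iff)
  qed
qed

text \<open>For t <= 1 the power q is dominated by the square, for t > 1 by an integer power above
  q, so two instances of \<open>embedding_power\<close> suffice.\<close>

lemma embedding_powr:
  fixes M q :: real
  assumes M: "M \<ge> 0" and q: "q \<ge> 2"
  obtains C where "C \<ge> 0" "\<And>u. Xspace u \<Longrightarrow> energy u \<le> M \<Longrightarrow> integrable lborel (\<lambda>x. \<bar>u x\<bar> powr q)"
    "\<And>u. Xspace u \<Longrightarrow> energy u \<le> M \<Longrightarrow> (LINT x|lborel. \<bar>u x\<bar> powr q) \<le> C"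
proof -
  define j where "j = nat \<lceil>q\<rceil>"
  have j: "q \<le> real (j + 2)" unfolding j_def by linarith
  obtain C0 where C0: "C0 \<ge> 0" "\<And>u. Xspace u \<Longrightarrow> energy u \<le> M \<Longrightarrow> integrable lborel (\<lambda>x. \<bar>u x\<bar> ^ (0 + 2))"
    "\<And>u. Xspace u \<Longrightarrow> energy u \<le> M \<Longrightarrow> (LINT x|lborel. \<bar>u x\<bar> ^ (0 + 2)) \<le> C0"
    using embedding_power[OF M, of 0] by blast
  obtain C1 where C1: "C1 \<ge> 0" "\<And>u. Xspace u \<Longrightarrow> energy u \<le> M \<Longrightarrow> integrable lborel (\<lambda>x. \<bar>u x\<bar> ^ (j + 2))"
    "\<And>u. Xspace u \<Longrightarrow> energy u \<le> M \<Longrightarrow> (LINT x|lborel. \<bar>u x\<bar> ^ (j + 2)) \<le> C1"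
    using embedding_power[OF M, of j] by blast
  have le: "t powr q \<le> t ^ (0 + 2) + t ^ (j + 2)" if t: "t \<ge> 0" for t :: real
  proof -
    consider "t = 0" | "0 < t" "t \<le> 1" | "t > 1" using t by linarith
    then show ?thesis
    proof cases
      case 2
      have "t powr q \<le> t powr real (0 + 2)" using 2 q by (intro powr_mono') auto
      then show ?thesis using 2 powr_realpow[of t "0+2"] zero_le_power[of t "j+2"] by linarith
    next
      case 3
      have "t powr q \<le> t powr real (j + 2)" using 3 j by (intro powr_mono) auto
      then show ?thesis using 3 powr_realpow[of t "j+2"] zero_le_power[of t "0+2"] by linarith
    qed (simp add: power_0_left)
  qed
  have int: "integrable lborel (\<lambda>x. \<bar>u x\<bar> powr q)" if u: "Xspace u" "energy u \<le> M" for u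
  proof (rule Bochner_Integration.integrable_bound[OF Bochner_Integration.integrable_add[OF C0(2)[OF u] C1(2)[OF u]]])
    show "(\<lambda>x. \<bar>u x\<bar> powr q) \<in> borel_measurable lborel" using L2fun_measurable[OF Xspace_L2[OF u(1)]] by measurable
    show "AE x in lborel. norm (\<bar>u x\<bar> powr q) \<le> norm (\<bar>u x\<bar> ^ (0 + 2) + \<bar>u x\<bar> ^ (j + 2))"
      using le[OF abs_ge_zero] by (intro AE_I2) (auto intro: order_trans[OF _ abs_ge_self])
  qed
  show ?thesis
  proof (rule that[of "C0 + C1"])
    fix u assume u: "Xspace u" "energy u \<le> M"
    show "integrable lborel (\<lambda>x. \<bar>u x\<bar> powr q)" by (rule int[OF u])
    have "(LINT x|lborel. \<bar>u x\<bar> powr q) \<le> (LINT x|lborel. \<bar>u x\<bar> ^ (0 + 2) + \<bar>u x\<bar> ^ (j + 2))"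
      by (rule integral_mono[OF int[OF u] Bochner_Integration.integrable_add[OF C0(2)[OF u] C1(2)[OF u]]]) (rule le, simp)
    also have "\<dots> = (LINT x|lborel. \<bar>u x\<bar> ^ (0 + 2)) + (LINT x|lborel. \<bar>u x\<bar> ^ (j + 2))"
      by (rule Bochner_Integration.integral_add[OF C0(2)[OF u] C1(2)[OF u]])
    also have "\<dots> \<le> C0 + C1" by (intro add_mono C0(3)[OF u] C1(3)[OF u])
    finally show "(LINT x|lborel. \<bar>u x\<bar> powr q) \<le> C0 + C1" .
  qed (use C0 C1 in simp)
qed


subsection \<open>The quadratic functional as a Hilbert space norm\<close>

lemma AE_nonzero: "AE x in lborel. x \<noteq> (0::real)"
  by (rule AE_lborel_singleton)

lemma l2sq_cutoff_le: "L2fun f \<Longrightarrow> l2sq (cutoff R f) \<le> l2sq f"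
  unfolding l2sq_def
  by (intro integral_mono L2fun_integrable L2fun_cutoff)
     (auto simp: abs_le_square_iff[symmetric] cutoff_le)

text \<open>A Rellich type statement: on a bounded interval the low-frequency parts converge by
  dominated convergence, being uniformly bounded by \<open>band_le\<close>, and the high-frequency
  parts are uniformly small in L2.\<close>

lemma local_L2_convergence:
  assumes X: "\<And>n. Xspace (u n)" and E: "\<And>n. energy (u n) \<le> M" and Xp: "Xspace \<phi>" and Ep: "energy \<phi> \<le> M"
    and lim: "\<And>N x. N > 0 \<Longrightarrow> (\<lambda>n. band N (u n) x) \<longlonglongrightarrow> band N \<phi> x"
  shows "(\<lambda>n. l2sq (cutoff R (\<lambda>x. u n x - \<phi> x))) \<longlonglongrightarrow> 0"
proof -
  note L = Xspace_L2[OF X] and Lp = Xspace_L2[OF Xp]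
  have M: "M \<ge> 0" using energy_nonneg[of \<phi>] Ep by linarith
  have band_tail: "sqrt (l2sq (\<lambda>x. v x - band N v x)) \<le> sqrt (M / N)" if "Xspace v" "energy v \<le> M" "N > 0" for v N
  proof (rule real_sqrt_le_mono)
    have "l2sq (\<lambda>x. v x - band N v x) \<le> energy v / (2 * pi * N)" by (rule l2sq_high[OF that(1,3)])
    also have "\<dots> \<le> M / (1 * N)" using that M pi_gt3 by (intro frac_le mult_right_mono) auto
    finally show "l2sq (\<lambda>x. v x - band N v x) \<le> M / N" by simp
  qed
  have "(\<lambda>n. sqrt (l2sq (cutoff R (\<lambda>x. u n x - \<phi> x)))) \<longlonglongrightarrow> 0"
  proof (rule LIMSEQ_I)
    fix e :: real assume e: "e > 0"
    \<comment> \<open>Chosen so that sqrt (M/N) <= e/3; M + 1 in place of M keeps N positive when M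
      = 0.\<close>
    define N where "N = 9 * (M + 1) / e^2"
    have N: "N > 0" unfolding N_def using M e by simp
    have "M / N \<le> (e/3)^2" unfolding N_def using M e by (simp add: field_simps power2_eq_square)
    then have MN: "sqrt (M / N) \<le> e / 3" using e by (intro real_le_lsqrt) auto
    define B where "B = sqrt (2 * ln (1 + N) * M)"
    have B: "\<bar>band N v x\<bar> \<le> B" if "Xspace v" "energy v \<le> M" for v x
    proof -
      have "\<bar>band N v x\<bar> \<le> sqrt (2 * ln (1 + N) * energy v)" using band_le[OF that(1)] N by simp
      also have "\<dots> \<le> B" unfolding B_def using N that by (intro real_sqrt_le_mono mult_left_mono) auto
      finally show ?thesis .
    qed
    define d where "d n x = cutoff R (\<lambda>x. band N (u n) x - band N \<phi> x) x" for n x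
    note [measurable] = L2fun_measurable[OF band_facts(1)[OF L]] L2fun_measurable[OF band_facts(1)[OF Lp]]
    have Lb: "L2fun (\<lambda>x. band N (u n) x - band N \<phi> x)" for n by (intro L2fun_diff band_facts L Lp)
    have Ld: "L2fun (d n)" for n unfolding d_def by (rule L2fun_cutoff[OF Lb])
    have "(\<lambda>n. l2sq (d n)) \<longlonglongrightarrow> 0"
    proof (rule l2_dominated)
      show "d n \<in> borel_measurable borel" for n by (rule L2fun_measurable[OF Ld])
      show "integrable lborel (\<lambda>x. indicator {-R..R} x * (2 * B)^2)" by (rule integrable_indicator_interval)
      show "AE x in lborel. (\<lambda>n. d n x) \<longlonglongrightarrow> 0"
      proof (rule AE_I2)
        fix x
        have "(\<lambda>n. indicator {-R..R} x * (band N (u n) x - band N \<phi> x)) \<longlonglongrightarrow> indicator {-R..R} x * (band N \<phi> x - band N \<phi> x)"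
          by (intro tendsto_intros lim N)
        then show "(\<lambda>n. d n x) \<longlonglongrightarrow> 0" by (simp add: d_def cutoff_def)
      qed
      show "AE x in lborel. (norm (d n x))^2 \<le> indicator {-R..R} x * (2 * B)^2" for n
      proof (rule AE_I2)
        fix x
        have "\<bar>band N (u n) x - band N \<phi> x\<bar> \<le> 2 * B" using B[OF X E, of n x] B[OF Xp Ep, of x] by linarith
        then have "\<bar>band N (u n) x - band N \<phi> x\<bar>^2 \<le> (2 * B)^2" by (intro power_mono) auto
        then show "(norm (d n x))^2 \<le> indicator {-R..R} x * (2 * B)^2" by (auto simp: d_def cutoff_def indicator_def)
      qed
    qed
    then have "(\<lambda>n. sqrt (l2sq (d n))) \<longlonglongrightarrow> sqrt 0" by (intro tendsto_intros)
    then have "\<forall>\<^sub>F n in sequentially. sqrt (l2sq (d n)) < e / 3" using e by (intro order_tendstoD) auto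
    then have "\<forall>\<^sub>F n in sequentially. sqrt (l2sq (cutoff R (\<lambda>x. u n x - \<phi> x))) < e"
    proof eventually_elim
      case (elim n)
      define p where "p = cutoff R (\<lambda>x. u n x - band N (u n) x)"
      define q where "q = cutoff R (\<lambda>x. \<phi> x - band N \<phi> x)"
      have Lp': "L2fun p" and Lq: "L2fun q" unfolding p_def q_def by (intro L2fun_cutoff L2fun_diff band_facts L Lp)+
      have eq: "cutoff R (\<lambda>x. u n x - \<phi> x) = (\<lambda>x. (p x + d n x) - q x)"
        by (auto simp: p_def q_def d_def cutoff_def algebra_simps)
      have "sqrt (l2sq (\<lambda>x. (p x + d n x) - q x)) \<le> sqrt (l2sq (\<lambda>x. p x + d n x)) + sqrt (l2sq q)"
        using l2norm_triangle[OF L2fun_add[OF Lp' Ld[of n]] L2fun_minus[OF Lq]] by (simp add: l2sq_minus)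
      moreover have "sqrt (l2sq (\<lambda>x. p x + d n x)) \<le> sqrt (l2sq p) + sqrt (l2sq (d n))"
        by (rule l2norm_triangle[OF Lp' Ld])
      moreover have "sqrt (l2sq p) \<le> e / 3"
        unfolding p_def by (rule order_trans[OF real_sqrt_le_mono[OF l2sq_cutoff_le] order_trans[OF band_tail[OF X E N] MN]])
          (intro L2fun_diff band_facts L)
      moreover have "sqrt (l2sq q) \<le> e / 3"
        unfolding q_def by (rule order_trans[OF real_sqrt_le_mono[OF l2sq_cutoff_le] order_trans[OF band_tail[OF Xp Ep N] MN]])
          (intro L2fun_diff band_facts Lp)
      ultimately show ?case unfolding eq using elim by linarith
    qed
    then show "\<exists>no. \<forall>n\<ge>no. norm (sqrt (l2sq (cutoff R (\<lambda>x. u n x - \<phi> x))) - 0) < e"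
      by (auto simp: eventually_sequentially)
  qed
  from tendsto_power[OF this, of 2] show ?thesis by simp
qed

locale subcritical_speed =
  fixes \<beta> c \<gamma> :: real
  assumes \<beta>_pos: "\<beta> > 0" and \<gamma>_pos: "\<gamma> > 0"
    and c_lt: "c < 3 * (\<beta>^2 * \<gamma> / 4) powr (1/3)"
begin

text \<open>At the origin the last term is 0 by convention and the value is -c, possibly negative.
  Lower bounds are therefore stated for nonzero xi and used almost everywhere.\<close>

definition symbol :: "real \<Rightarrow> real" where "symbol \<xi> = \<beta> * \<bar>\<xi>\<bar> - c + \<gamma> / \<xi>^2"

lemma symbol_measurable [measurable]: "symbol \<in> borel_measurable borel"
  unfolding symbol_def[abs_def] by measurable

lemma symbol_even [simp]: "symbol (- \<xi>) = symbol \<xi>"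
  by (simp add: symbol_def)

lemma symbol_upper: "\<bar>symbol \<xi>\<bar> \<le> (\<beta> + \<bar>c\<bar> + \<gamma>) * weight \<xi>"
proof -
  have "\<bar>symbol \<xi>\<bar> \<le> \<beta> * \<bar>\<xi>\<bar> + \<bar>c\<bar> * 1 + \<gamma> * (1 / \<xi>^2)"
    unfolding symbol_def using \<beta>_pos \<gamma>_pos by (intro order_trans[OF abs_triangle_ineq] add_mono order_trans[OF abs_triangle_ineq4]) (auto simp: abs_mult)
  also have "\<dots> \<le> \<beta> * weight \<xi> + \<bar>c\<bar> * weight \<xi> + \<gamma> * weight \<xi>"
    using \<beta>_pos \<gamma>_pos weight_ge_1[of \<xi>] weight_ge_abs[of \<xi>] weight_ge_inv[of \<xi>]
    by (intro add_mono mult_left_mono) auto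
  finally show ?thesis by (simp add: distrib_right)
qed

text \<open>With a = beta |xi| / 2 and t^3 = beta^2 gamma / 4, the arithmetic-geometric inequality
  for a, a, t^3/a^2 gives beta |xi| + gamma/xi^2 >= 3t; here it is read off from (a - t)^2 (2a + t)
  >= 0. The assumption on c is precisely c < 3t.\<close>

lemma symbol_coercive: "\<exists>\<kappa>>0. \<forall>\<xi>. \<xi> \<noteq> 0 \<longrightarrow> \<kappa> * weight \<xi> \<le> symbol \<xi>"
proof -
  define t where "t = (\<beta>^2 * \<gamma> / 4) powr (1/3)"
  have t: "t > 0" unfolding t_def using \<beta>_pos \<gamma>_pos by simp
  have t3: "t^3 = \<beta>^2 * \<gamma> / 4"
    unfolding t_def using \<beta>_pos \<gamma>_pos by (simp add: powr_powr flip: powr_numeral)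
  have amgm: "3 * t \<le> \<beta> * \<bar>\<xi>\<bar> + \<gamma> / \<xi>^2" if \<xi>: "\<xi> \<noteq> 0" for \<xi>
  proof -
    define a where "a = \<beta> * \<bar>\<xi>\<bar> / 2"
    have a: "a > 0" unfolding a_def using \<xi> \<beta>_pos by simp
    have g: "\<gamma> / \<xi>^2 = t^3 / a^2" unfolding t3 a_def using \<xi> \<beta>_pos by (simp add: field_simps power2_eq_square)
    have "0 \<le> (a - t)^2 * (2 * a + t) / a^2" using a t by simp
    also have "(a - t)^2 * (2 * a + t) = (2 * a - 3 * t) * a^2 + t^3" by (simp add: algebra_simps power2_eq_square power3_eq_cube)
    also have "((2 * a - 3 * t) * a^2 + t^3) / a^2 = 2 * a - 3 * t + t^3 / a^2" using a by (simp add: field_simps)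
    finally show ?thesis unfolding g by (simp add: a_def)
  qed
  \<comment> \<open>The largest share of W = beta |xi| + gamma/xi^2 that the term c can consume; it
    is below 1, and the part 1 - theta remains.\<close>
  define \<theta> where "\<theta> = max c 0 / (3 * t)"
  have \<theta>: "0 \<le> \<theta>" "\<theta> < 1" unfolding \<theta>_def using t c_lt by (auto simp: t_def[symmetric])
  \<comment> \<open>Half of W controls the |xi| and 1/xi^2 terms of \<open>weight\<close>; the
    constant term is paid by 3t/2, which is at most the other half.\<close>
  define m where "m = min (min (\<beta>/2) (\<gamma>/2)) (3 * t/2)"
  have m: "m > 0" "m \<le> \<beta>/2" "m \<le> \<gamma>/2" "m \<le> 3*t/2" unfolding m_def using t \<beta>_pos \<gamma>_pos by auto
  have "(1 - \<theta>) * m * weight \<xi> \<le> symbol \<xi>" if \<xi>: "\<xi> \<noteq> 0" for \<xi>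
  proof -
    define W where "W = \<beta> * \<bar>\<xi>\<bar> + \<gamma> / \<xi>^2"
    have W: "3 * t \<le> W" unfolding W_def by (rule amgm[OF \<xi>])
    have "m * weight \<xi> = m * \<bar>\<xi>\<bar> + m * (1 / \<xi>^2) + m" by (simp add: weight_def algebra_simps)
    also have "\<dots> \<le> \<beta>/2 * \<bar>\<xi>\<bar> + \<gamma>/2 * (1 / \<xi>^2) + 3*t/2" using m by (intro add_mono mult_right_mono) auto
    also have "\<dots> = W/2 + 3*t/2" by (simp add: W_def field_simps)
    also have "\<dots> \<le> W" using W by simp
    finally have 1: "m * weight \<xi> \<le> W" .
    have "c \<le> \<theta> * (3 * t)" unfolding \<theta>_def using t by simp
    also have "\<dots> \<le> \<theta> * W" using W \<theta> by (intro mult_left_mono) auto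
    finally have "c \<le> \<theta> * W" .
    moreover have "symbol \<xi> = W - c" by (simp add: symbol_def W_def)
    ultimately have "(1 - \<theta>) * W \<le> symbol \<xi>" by (simp add: left_diff_distrib)
    moreover have "(1 - \<theta>) * (m * weight \<xi>) \<le> (1 - \<theta>) * W" using 1 \<theta> by (intro mult_left_mono) auto
    ultimately show ?thesis by (simp add: mult.assoc)
  qed
  moreover have "(1 - \<theta>) * m > 0" using \<theta> m by simp
  ultimately show ?thesis by blast
qed

definition \<kappa> :: real where
  "\<kappa> = (SOME k. k > 0 \<and> (\<forall>\<xi>. \<xi> \<noteq> 0 \<longrightarrow> k * weight \<xi> \<le> symbol \<xi>))"

lemma \<kappa>_pos: "\<kappa> > 0" and symbol_lower: "\<xi> \<noteq> 0 \<Longrightarrow> \<kappa> * weight \<xi> \<le> symbol \<xi>"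
proof -
  have "\<kappa> > 0 \<and> (\<forall>\<xi>. \<xi> \<noteq> 0 \<longrightarrow> \<kappa> * weight \<xi> \<le> symbol \<xi>)"
    unfolding \<kappa>_def by (rule someI_ex[OF symbol_coercive])
  then show "\<kappa> > 0" "\<xi> \<noteq> 0 \<Longrightarrow> \<kappa> * weight \<xi> \<le> symbol \<xi>" by auto
qed

lemma symbol_ge_\<kappa>: "\<xi> \<noteq> 0 \<Longrightarrow> \<kappa> \<le> symbol \<xi>"
  using symbol_lower[of \<xi>] mult_left_mono[OF weight_ge_1[of \<xi>], of \<kappa>] \<kappa>_pos by linarith

abbreviation I where "I \<equiv> I_fun \<beta> c \<gamma>"

lemma integrable_symbol:
  assumes X: "Xspace u" shows "integrable lborel (\<lambda>\<xi>. symbol \<xi> * (norm (fourier u \<xi>))^2)"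
  by (rule Xspace_integrable_le(1)[OF X _ symbol_upper]) measurable

lemma I_eq: "Xspace u \<Longrightarrow> I u = (LINT \<xi>|lborel. symbol \<xi> * (norm (fourier u \<xi>))^2) / (2*pi)"
  by (simp add: I_fun_eq symbol_def)

lemma energy_le_I:
  assumes X: "Xspace u" shows "\<kappa> * energy u \<le> 2 * pi * I u"
proof -
  have "\<kappa> * energy u = (LINT \<xi>|lborel. \<kappa> * (weight \<xi> * (norm (fourier u \<xi>))^2))" by (simp add: energy_def)
  also have "\<dots> \<le> (LINT \<xi>|lborel. symbol \<xi> * (norm (fourier u \<xi>))^2)"
  proof (rule integral_mono_AE)
    show "AE \<xi> in lborel. \<kappa> * (weight \<xi> * (norm (fourier u \<xi>))^2) \<le> symbol \<xi> * (norm (fourier u \<xi>))^2"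
      using AE_nonzero
    proof eventually_elim
      case (elim \<xi>)
      have "(\<kappa> * weight \<xi>) * (norm (fourier u \<xi>))^2 \<le> symbol \<xi> * (norm (fourier u \<xi>))^2"
        by (intro mult_right_mono symbol_lower elim) auto
      then show ?case by (simp add: mult.assoc)
    qed
  qed (use Xspace_integrable[OF X] integrable_symbol[OF X] in auto)
  finally show ?thesis by (simp add: I_eq X)
qed

lemma I_nonneg: "Xspace u \<Longrightarrow> 0 \<le> I u"
proof -
  assume X: "Xspace u"
  have "0 \<le> 2 * pi * I u"
    by (rule order_trans[OF _ energy_le_I[OF X]]) (use \<kappa>_pos energy_nonneg in simp)
  then show "0 \<le> I u" using pi_gt_zero by (simp add: zero_le_mult_iff)
qed

text \<open>The isometry carrying the energy space, normed by 2 pi I, into L2, where weak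
  compactness is available.\<close>

definition hX :: "(real \<Rightarrow> real) \<Rightarrow> real \<Rightarrow> complex" where
  "hX u \<xi> = sqrt (symbol \<xi>) *\<^sub>R fourier u \<xi>"

lemma hX_facts:
  assumes X: "Xspace u"
  shows "L2fun (hX u)" and "l2sq (hX u) = 2 * pi * I u" and "AE \<xi> in lborel. hX u (- \<xi>) = cnj (hX u \<xi>)"
proof -
  note L = Xspace_L2[OF X]
  note [measurable] = L2fun_measurable[OF L2fun_fourier[OF L]]
  have [measurable]: "hX u \<in> borel_measurable borel" unfolding hX_def[abs_def] by measurable
  have eq: "AE \<xi> in lborel. (norm (hX u \<xi>))^2 = symbol \<xi> * (norm (fourier u \<xi>))^2"
    using AE_nonzero
  proof eventually_elim
    case (elim \<xi>)
    have "0 \<le> symbol \<xi>" using symbol_ge_\<kappa>[OF elim] \<kappa>_pos by simp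
    then show ?case by (simp add: hX_def power_mult_distrib)
  qed
  show "L2fun (hX u)"
    by (rule L2fun_bound[OF _ integrable_symbol[OF X]]) (use eq in auto)
  have "l2sq (hX u) = (LINT \<xi>|lborel. symbol \<xi> * (norm (fourier u \<xi>))^2)"
    unfolding l2sq_def by (rule integral_cong_AE) (use eq in auto)
  then show "l2sq (hX u) = 2 * pi * I u" by (simp add: I_eq X)
  show "AE \<xi> in lborel. hX u (- \<xi>) = cnj (hX u \<xi>)"
    using fourier_hermitian[OF L] by eventually_elim (simp add: hX_def)
qed

text \<open>Polarisation without error terms: under weak convergence of the images under
  \<open>hX\<close> only the cross term has to be passed to the limit.\<close>

lemma I_diff:
  assumes "Xspace u" "Xspace v"
  shows "I (\<lambda>x. u x - v x) = I u - l2ip (hX u) (hX v) / pi + I v"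
proof -
  have "AE \<xi> in lborel. hX (\<lambda>x. u x - v x) \<xi> = hX u \<xi> - hX v \<xi>"
    using fourier_diff[OF Xspace_L2[OF assms(1)] Xspace_L2[OF assms(2)]]
    by eventually_elim (simp add: hX_def scaleR_diff_right)
  then have "l2sq (hX (\<lambda>x. u x - v x)) = l2sq (\<lambda>\<xi>. hX u \<xi> - hX v \<xi>)"
    by (intro l2sq_cong_AE L2fun_measurable[OF hX_facts(1)] L2fun_measurable[OF L2fun_diff] hX_facts Xspace_diff assms)
  also have "\<dots> = l2sq (hX u) - 2 * l2ip (hX u) (hX v) + l2sq (hX v)"
    by (intro l2sq_diff hX_facts assms)
  finally have "2 * pi * I (\<lambda>x. u x - v x) = 2 * pi * I u - 2 * l2ip (hX u) (hX v) + 2 * pi * I v"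
    by (simp add: hX_facts assms Xspace_diff)
  then show ?thesis by (simp add: field_simps)
qed

lemma I_scale:
  assumes X: "Xspace u" shows "I (\<lambda>x. a * u x) = a^2 * I u"
proof -
  have "(LINT \<xi>|lborel. symbol \<xi> * (norm (fourier (\<lambda>x. a * u x) \<xi>))^2) = (LINT \<xi>|lborel. a^2 * (symbol \<xi> * (norm (fourier u \<xi>))^2))"
  proof (rule integral_cong_AE)
    show "AE \<xi> in lborel. symbol \<xi> * (norm (fourier (\<lambda>x. a * u x) \<xi>))^2 = a^2 * (symbol \<xi> * (norm (fourier u \<xi>))^2)"
      using fourier_scale[OF Xspace_L2[OF X], of a] by eventually_elim (simp add: norm_mult power_mult_distrib)
  qed (use integrable_symbol[OF Xspace_scale[OF X, of a]] integrable_symbol[OF X] in auto)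
  then show ?thesis by (simp add: I_eq X Xspace_scale)
qed

lemma I_shift:
  assumes X: "Xspace u" shows "I (\<lambda>x. u (x + y)) = I u"
proof -
  have "(LINT \<xi>|lborel. symbol \<xi> * (norm (fourier (\<lambda>x. u (x + y)) \<xi>))^2) = (LINT \<xi>|lborel. symbol \<xi> * (norm (fourier u \<xi>))^2)"
  proof (rule integral_cong_AE)
    show "AE \<xi> in lborel. symbol \<xi> * (norm (fourier (\<lambda>x. u (x + y)) \<xi>))^2 = symbol \<xi> * (norm (fourier u \<xi>))^2"
      using fourier_shift[OF Xspace_L2[OF X], of y] by eventually_elim (simp add: norm_mult)
  qed (use integrable_symbol[OF Xspace_shift[OF X, of y]] integrable_symbol[OF X] in auto)
  then show ?thesis by (simp add: I_eq X Xspace_shift)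
qed

text \<open>Up to 2 pi, the vector representing evaluation of \<open>band N u\<close> at x in terms
  of \<open>hX u\<close>: its factor 1/sqrt (symbol) cancels that of \<open>hX\<close>. Weak
  convergence thus implies convergence of the bands at every point.\<close>

definition band_test :: "real \<Rightarrow> real \<Rightarrow> real \<Rightarrow> complex" where
  "band_test N x \<xi> = (indicator {-N..N} \<xi> / sqrt (symbol \<xi>)) *\<^sub>R cis (- (x * \<xi>))"

lemma band_test_facts:
  shows "L2fun (band_test N x)" and "band_test N x (- \<xi>) = cnj (band_test N x \<xi>)"
proof -
  have [measurable]: "band_test N x \<in> borel_measurable borel" unfolding band_test_def[abs_def] by measurable
  show "L2fun (band_test N x)"
  proof (rule L2fun_bound)
    show "integrable lborel (\<lambda>\<xi>. indicator {-N..N} \<xi> * (1 / \<kappa>))" by (rule integrable_indicator_interval)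
    show "AE \<xi> in lborel. (norm (band_test N x \<xi>))^2 \<le> indicator {-N..N} \<xi> * (1 / \<kappa>)"
      using AE_nonzero
    proof eventually_elim
      case (elim \<xi>)
      have "0 < symbol \<xi>" "1 / symbol \<xi> \<le> 1 / \<kappa>" using symbol_ge_\<kappa>[OF elim] \<kappa>_pos by (auto simp: frac_le)
      then show ?case by (auto simp: band_test_def indicator_def power_divide)
    qed
  qed measurable
  show "band_test N x (- \<xi>) = cnj (band_test N x \<xi>)"
    by (auto simp: band_test_def indicator_def cis_cnj)
qed

lemma band_eq_l2ip:
  assumes X: "Xspace u" shows "band N u x = l2ip (hX u) (band_test N x) / (2*pi)"
proof -
  note L = Xspace_L2[OF X]
  note [measurable] = L2fun_measurable[OF lowfreq_facts(1)[OF L]] L2fun_measurable[OF hX_facts(1)[OF X]]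
     L2fun_measurable[OF band_test_facts(1)]
  have i: "integrable lborel (\<lambda>\<xi>. lowfreq N u \<xi> * cis (x * \<xi>))"
    by (intro integrable_mult_cis lowfreq_facts L) measurable
  have "Re (LINT \<xi>|lborel. lowfreq N u \<xi> * cis (x * \<xi>)) = (LINT \<xi>|lborel. Re (lowfreq N u \<xi> * cis (x * \<xi>)))"
    by (rule integral_Re[OF i, symmetric])
  also have "\<dots> = l2ip (hX u) (band_test N x)"
    unfolding l2ip_def
  proof (rule integral_cong_AE)
    show "AE \<xi> in lborel. Re (lowfreq N u \<xi> * cis (x * \<xi>)) = hX u \<xi> \<bullet> band_test N x \<xi>"
      using AE_nonzero
    proof eventually_elim
      case (elim \<xi>)
      have "0 < symbol \<xi>" using symbol_ge_\<kappa>[OF elim] \<kappa>_pos by simp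
      then show ?case by (auto simp: lowfreq_def hX_def band_test_def inner_complex_def indicator_def)
    qed
  qed measurable
  finally show ?thesis by (simp add: band_def ift_def)
qed

text \<open>An L2 weak limit of the \<open>hX (u n)\<close> has to be recognised as
  \<open>hX\<close> of a real function. It is made Hermitian, divided by sqrt (symbol), which is
  bounded away from 0, and then inverted by \<open>fourier_surj\<close>.\<close>

lemma weak_compact:
  fixes u :: "nat \<Rightarrow> real \<Rightarrow> real"
  assumes X: "\<And>n. Xspace (u n)" and C: "\<And>n. I (u n) \<le> C"
  obtains k :: "nat \<Rightarrow> nat" and \<phi> where "strict_mono k" "Xspace \<phi>"
    "\<And>v. Xspace v \<Longrightarrow> (\<lambda>n. l2ip (hX (u (k n))) (hX v)) \<longlonglongrightarrow> l2ip (hX \<phi>) (hX v)"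
    "\<And>N x. (\<lambda>n. band N (u (k n)) x) \<longlonglongrightarrow> band N \<phi> x"
proof -
  have "l2sq (hX (u n)) \<le> 2 * pi * C" for n using C[of n] by (simp add: hX_facts X)
  from L2_weak_compact[of "\<lambda>n. hX (u n)", OF hX_facts(1)[OF X] this]
  obtain k :: "nat \<Rightarrow> nat" and h where k: "strict_mono k" and h: "L2fun h"
    and lim: "\<And>w. L2fun w \<Longrightarrow> (\<lambda>n. l2ip (hX (u (k n))) w) \<longlonglongrightarrow> l2ip h w" by metis
  define hr where "hr \<xi> = cnj (h (- \<xi>))" for \<xi>
  have Lhr: "L2fun hr" unfolding hr_def[abs_def]
    using L2fun_reflect[OF h] by (auto simp: L2fun_def intro: borel_measurable_cnj)
  \<comment> \<open>Averaging with the reflected conjugate produces a Hermitian function having the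
    same pairing with every Hermitian test function; all tests of interest, \<open>hX v\<close> and
    \<open>band_test\<close>, are of that kind.\<close>
  define hs where "hs \<xi> = (1/2) *\<^sub>R (h \<xi> + hr \<xi>)" for \<xi>
  have Lhs: "L2fun hs" unfolding hs_def by (intro L2fun_scaleR L2fun_add h Lhr)
  have hs_sym: "hs (- \<xi>) = cnj (hs \<xi>)" for \<xi> by (simp add: hs_def hr_def scaleR_conv_of_real)
  note [measurable] = L2fun_measurable[OF h] L2fun_measurable[OF Lhr] L2fun_measurable[OF Lhs]
  have ip: "l2ip hs G = l2ip h G" if G: "L2fun G" "AE \<xi> in lborel. G (- \<xi>) = cnj (G \<xi>)" for G
  proof -
    have "l2ip hr G = (LINT \<xi>|lborel. hr (- \<xi>) \<bullet> G (- \<xi>))" unfolding l2ip_def by (rule integral_reflect[symmetric])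
    also have "\<dots> = l2ip h G" unfolding l2ip_def
    proof (rule integral_cong_AE)
      show "AE \<xi> in lborel. hr (- \<xi>) \<bullet> G (- \<xi>) = h \<xi> \<bullet> G \<xi>"
        using G(2) by eventually_elim (simp add: hr_def inner_complex_def)
    qed (use L2fun_measurable[OF G(1)] in measurable)
    finally have "l2ip hr G = l2ip h G" .
    moreover have "l2ip hs G = (1/2) * (l2ip h G + l2ip hr G)"
      unfolding hs_def l2ip_scaleR_left l2ip_add_left[OF h Lhr G(1)] ..
    ultimately show ?thesis by simp
  qed
  define P where "P \<xi> = (1 / sqrt (symbol \<xi>)) *\<^sub>R hs \<xi>" for \<xi>
  have [measurable]: "P \<in> borel_measurable borel" unfolding P_def[abs_def] by measurable
  have P2: "AE \<xi> in lborel. weight \<xi> * (norm (P \<xi>))^2 \<le> (1/\<kappa>) * (norm (hs \<xi>))^2"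
    using AE_nonzero
  proof eventually_elim
    case (elim \<xi>)
    have s: "0 < symbol \<xi>" using symbol_ge_\<kappa>[OF elim] \<kappa>_pos by simp
    have "weight \<xi> / symbol \<xi> \<le> 1/\<kappa>" using symbol_lower[OF elim] s \<kappa>_pos by (simp add: field_simps)
    then have "weight \<xi> / symbol \<xi> * (norm (hs \<xi>))^2 \<le> (1/\<kappa>) * (norm (hs \<xi>))^2" by (intro mult_right_mono) auto
    then show ?case using s by (simp add: P_def power_mult_distrib power_divide)
  qed
  have iP: "integrable lborel (\<lambda>\<xi>. weight \<xi> * (norm (P \<xi>))^2)"
  proof (rule Bochner_Integration.integrable_bound)
    show "integrable lborel (\<lambda>\<xi>. (1/\<kappa>) * (norm (hs \<xi>))^2)" using Lhs by (simp add: L2fun_def)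
    show "AE \<xi> in lborel. norm (weight \<xi> * (norm (P \<xi>))^2) \<le> norm ((1/\<kappa>) * (norm (hs \<xi>))^2)"
      using P2
    proof eventually_elim
      case (elim \<xi>)
      have "0 \<le> weight \<xi>" using weight_ge_1[of \<xi>] by simp
      then show ?case using elim \<kappa>_pos by simp
    qed
  qed measurable
  have LP: "L2fun P"
  proof (rule L2fun_bound[OF _ iP])
    show "AE \<xi> in lborel. (norm (P \<xi>))^2 \<le> weight \<xi> * (norm (P \<xi>))^2"
      using weight_ge_1 by (intro AE_I2) (simp add: mult_le_cancel_right1)
  qed measurable
  have "AE \<xi> in lborel. P (- \<xi>) = cnj (P \<xi>)" by (simp add: P_def hs_sym)
  from fourier_surj[OF LP this] obtain \<phi> where \<phi>: "L2fun \<phi>" "AE \<xi> in lborel. fourier \<phi> \<xi> = P \<xi>" by blast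
  note [measurable] = L2fun_measurable[OF L2fun_fourier[OF \<phi>(1)]]
  have X\<phi>: "Xspace \<phi>" unfolding Xspace_iff
  proof (intro conjI \<phi>(1) integrable_cong_AE_imp[OF iP])
    show "AE \<xi> in lborel. weight \<xi> * (norm (P \<xi>))^2 = weight \<xi> * (norm (fourier \<phi> \<xi>))^2"
      using \<phi>(2) by eventually_elim simp
  qed measurable
  have hs: "AE \<xi> in lborel. hX \<phi> \<xi> = hs \<xi>"
    using \<phi>(2) AE_nonzero
  proof eventually_elim
    case (elim \<xi>)
    have "0 < symbol \<xi>" using symbol_ge_\<kappa>[OF elim(2)] \<kappa>_pos by simp
    then show ?case using elim(1) by (simp add: hX_def P_def)
  qed
  have conv: "(\<lambda>n. l2ip (hX (u (k n))) G) \<longlonglongrightarrow> l2ip (hX \<phi>) G"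
    if G: "L2fun G" "AE \<xi> in lborel. G (- \<xi>) = cnj (G \<xi>)" for G
  proof -
    have "l2ip (hX \<phi>) G = l2ip hs G" unfolding l2ip_def
    proof (rule integral_cong_AE)
      show "AE \<xi> in lborel. hX \<phi> \<xi> \<bullet> G \<xi> = hs \<xi> \<bullet> G \<xi>" using hs by eventually_elim simp
    qed (use L2fun_measurable[OF G(1)] L2fun_measurable[OF hX_facts(1)[OF X\<phi>]] in measurable)
    then show ?thesis using lim[OF G(1)] ip[OF G] by simp
  qed
  show ?thesis
  proof (rule that[OF k X\<phi>])
    show "(\<lambda>n. l2ip (hX (u (k n))) (hX v)) \<longlonglongrightarrow> l2ip (hX \<phi>) (hX v)" if "Xspace v" for v
      by (rule conv[OF hX_facts(1,3)[OF that]])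
    show "(\<lambda>n. band N (u (k n)) x) \<longlonglongrightarrow> band N \<phi> x" for N x
      unfolding band_eq_l2ip[OF X] band_eq_l2ip[OF X\<phi>]
      by (intro tendsto_divide tendsto_const conv band_test_facts) (auto simp: band_test_facts)
  qed
qed

end


subsection \<open>The homogeneous nonlinearity\<close>

text \<open>Isolates what the compactness proof uses of the nonlinearity. Powers p+1 are written as
  a product of a p-th power and a first power, ready for Cauchy-Schwarz with |u|^p and u both in
  L2.\<close>

locale variational = subcritical_speed +
  fixes p :: real and F :: "real \<Rightarrow> real" and C :: real
  assumes p_ge: "p \<ge> 2" and F_meas [measurable]: "F \<in> borel_measurable borel"
    and F_hom: "\<And>l s. l > 0 \<Longrightarrow> F (l * s) = l powr (p + 1) * F s"
    and F_bound: "\<And>s. \<bar>F s\<bar> \<le> C * (\<bar>s\<bar> powr p * \<bar>s\<bar>)"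
    and F_split: "\<And>a b. \<bar>F (a + b) - F a - F b\<bar> \<le> C * (\<bar>a\<bar> powr p * \<bar>b\<bar> + \<bar>a\<bar> * \<bar>b\<bar> powr p)"
    and C_nonneg: "C \<ge> 0"
begin

abbreviation K where "K \<equiv> K_fun F p"

lemma powr_L2:
  assumes X: "Xspace u" shows "L2fun (\<lambda>x. \<bar>u x\<bar> powr p)"
    and "l2sq (\<lambda>x. \<bar>u x\<bar> powr p) = (LINT x|lborel. \<bar>u x\<bar> powr (2 * p))"
proof -
  note [measurable] = L2fun_measurable[OF Xspace_L2[OF X]]
  have eq: "(norm (\<bar>u x\<bar> powr p))^2 = \<bar>u x\<bar> powr (2 * p)" for x
    by (simp add: power2_eq_square flip: powr_add)
  have q: "2 \<le> 2 * p" using p_ge by simp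
  obtain B where "B \<ge> 0" and c: "\<And>v. Xspace v \<Longrightarrow> energy v \<le> energy u \<Longrightarrow> integrable lborel (\<lambda>x. \<bar>v x\<bar> powr (2 * p))"
    "\<And>v. Xspace v \<Longrightarrow> energy v \<le> energy u \<Longrightarrow> (LINT x|lborel. \<bar>v x\<bar> powr (2 * p)) \<le> B"
    by (rule embedding_powr[OF energy_nonneg[of u] q]) blast
  from c(1)[OF X order_refl] show "L2fun (\<lambda>x. \<bar>u x\<bar> powr p)"
    by (intro L2funI) (simp_all only: eq, measurable)
  show "l2sq (\<lambda>x. \<bar>u x\<bar> powr p) = (LINT x|lborel. \<bar>u x\<bar> powr (2 * p))"
    unfolding l2sq_def eq ..
qed

lemma powr_bound:
  assumes M: "M \<ge> 0"
  obtains B where "B \<ge> 0" "\<And>u. Xspace u \<Longrightarrow> energy u \<le> M \<Longrightarrow> sqrt (l2sq (\<lambda>x. \<bar>u x\<bar> powr p)) \<le> B"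
proof -
  have q: "2 \<le> 2 * p" using p_ge by simp
  obtain B where "B \<ge> 0" "\<And>u. Xspace u \<Longrightarrow> energy u \<le> M \<Longrightarrow> integrable lborel (\<lambda>x. \<bar>u x\<bar> powr (2 * p))"
    "\<And>u. Xspace u \<Longrightarrow> energy u \<le> M \<Longrightarrow> (LINT x|lborel. \<bar>u x\<bar> powr (2 * p)) \<le> B"
    by (rule embedding_powr[OF M q]) blast
  then show ?thesis by (intro that[of "sqrt B"]) (auto simp: powr_L2)
qed

lemma integrable_powr_mult:
  assumes X: "Xspace u" and v: "L2fun v"
  shows "integrable lborel (\<lambda>x. \<bar>u x\<bar> powr p * \<bar>v x\<bar>)"
    and "(LINT x|lborel. \<bar>u x\<bar> powr p * \<bar>v x\<bar>) \<le> sqrt (l2sq (\<lambda>x. \<bar>u x\<bar> powr p)) * sqrt (l2sq v)"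
  using L2fun_norm_mult[OF powr_L2(1)[OF X] v] L2_Cauchy_Schwarz[OF powr_L2(1)[OF X] v] by simp_all

lemma integrable_F:
  assumes X: "Xspace u" shows "integrable lborel (\<lambda>x. F (u x))"
proof (rule Bochner_Integration.integrable_bound)
  show "integrable lborel (\<lambda>x. C * (\<bar>u x\<bar> powr p * \<bar>u x\<bar>))"
    by (intro integrable_mult_right integrable_powr_mult X Xspace_L2)
  show "AE x in lborel. norm (F (u x)) \<le> norm (C * (\<bar>u x\<bar> powr p * \<bar>u x\<bar>))"
    using F_bound by (intro AE_I2) (auto intro: order_trans[OF _ abs_ge_self])
qed (use L2fun_measurable[OF Xspace_L2[OF X]] in measurable)

lemma K_shift: "K (\<lambda>x. u (x + y)) = K u"
  unfolding K_fun_def by (simp add: integral_shift[of "\<lambda>x. F (u x)"])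

lemma K_scale: "a > 0 \<Longrightarrow> K (\<lambda>x. a * u x) = a powr (p + 1) * K u"
  unfolding K_fun_def by (simp add: F_hom)

text \<open>Rules out vanishing. One factor of |u|^(p+1) is replaced by e + |u - band N u|: the
  first term is paid by the L^p bound, which requires p >= 2, the second by Cauchy-Schwarz against
  the high-frequency tail of order 1/sqrt N. If all values of the band are small and N is large, K
  cannot be large.\<close>

lemma K_le_band:
  assumes M: "M \<ge> 0"
  obtains B where "B \<ge> 0"
    "\<And>u N e. Xspace u \<Longrightarrow> energy u \<le> M \<Longrightarrow> N > 0 \<Longrightarrow> (\<And>x. \<bar>band N u x\<bar> \<le> e) \<Longrightarrow> K u \<le> B * (e + 1 / sqrt N)"
proof -
  obtain B1 where B1: "B1 \<ge> 0" "\<And>u. Xspace u \<Longrightarrow> energy u \<le> M \<Longrightarrow> integrable lborel (\<lambda>x. \<bar>u x\<bar> powr p)"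
    "\<And>u. Xspace u \<Longrightarrow> energy u \<le> M \<Longrightarrow> (LINT x|lborel. \<bar>u x\<bar> powr p) \<le> B1"
    by (rule embedding_powr[OF M p_ge]) blast
  obtain B2 where B2: "B2 \<ge> 0" "\<And>u. Xspace u \<Longrightarrow> energy u \<le> M \<Longrightarrow> sqrt (l2sq (\<lambda>x. \<bar>u x\<bar> powr p)) \<le> B2"
    by (rule powr_bound[OF M]) blast
  define B where "B = (p + 1) * C * (B1 + B2 * sqrt M)"
  show ?thesis
  proof (rule that[of B])
    show "B \<ge> 0" unfolding B_def using p_ge C_nonneg B1 B2 M by simp
    fix u N e assume X: "Xspace u" and E: "energy u \<le> M" and N: "N > 0" and e: "\<And>x. \<bar>band N u x\<bar> \<le> e"
    note L = Xspace_L2[OF X]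
    have e0: "e \<ge> 0" using e[of 0] by linarith
    have Lh: "L2fun (\<lambda>x. u x - band N u x)" by (intro L2fun_diff L band_facts)
    have "l2sq (\<lambda>x. u x - band N u x) \<le> energy u / (2 * pi * N)" by (rule l2sq_high[OF X N])
    also have "\<dots> \<le> M / (1 * N)" using E M pi_gt3 N by (intro frac_le mult_right_mono) auto
    finally have h: "sqrt (l2sq (\<lambda>x. u x - band N u x)) \<le> sqrt M * (1 / sqrt N)"
      using real_sqrt_le_mono by (fastforce simp: real_sqrt_divide)
    have i1: "integrable lborel (\<lambda>x. e * (\<bar>u x\<bar> powr p))" using B1(2)[OF X E] by simp
    have i2: "integrable lborel (\<lambda>x. \<bar>u x\<bar> powr p * \<bar>u x - band N u x\<bar>)" by (rule integrable_powr_mult(1)[OF X Lh])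
    have "- (LINT x|lborel. F (u x)) = (LINT x|lborel. - F (u x))" by simp
    also have "\<dots> \<le> (LINT x|lborel. C * (e * (\<bar>u x\<bar> powr p) + \<bar>u x\<bar> powr p * \<bar>u x - band N u x\<bar>))"
    proof (rule integral_mono)
      show "integrable lborel (\<lambda>x. - F (u x))" using integrable_F[OF X] by simp
      show "integrable lborel (\<lambda>x. C * (e * (\<bar>u x\<bar> powr p) + \<bar>u x\<bar> powr p * \<bar>u x - band N u x\<bar>))"
        by (intro integrable_mult_right Bochner_Integration.integrable_add i1 i2)
      fix x
      have "\<bar>u x\<bar> \<le> e + \<bar>u x - band N u x\<bar>" using e[of x] by linarith
      then have "\<bar>u x\<bar> powr p * \<bar>u x\<bar> \<le> \<bar>u x\<bar> powr p * (e + \<bar>u x - band N u x\<bar>)" by (intro mult_left_mono) auto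
      then have "C * (\<bar>u x\<bar> powr p * \<bar>u x\<bar>) \<le> C * (e * (\<bar>u x\<bar> powr p) + \<bar>u x\<bar> powr p * \<bar>u x - band N u x\<bar>)"
        using C_nonneg by (intro mult_left_mono) (auto simp: algebra_simps)
      then show "- F (u x) \<le> C * (e * (\<bar>u x\<bar> powr p) + \<bar>u x\<bar> powr p * \<bar>u x - band N u x\<bar>)"
        using F_bound[of "u x"] by linarith
    qed
    also have "\<dots> = C * (e * (LINT x|lborel. \<bar>u x\<bar> powr p) + (LINT x|lborel. \<bar>u x\<bar> powr p * \<bar>u x - band N u x\<bar>))"
      using i2 B1(2)[OF X E] by simp
    also have "\<dots> \<le> C * (e * B1 + B2 * (sqrt M * (1 / sqrt N)))"
    proof (intro mult_left_mono add_mono C_nonneg B1(3)[OF X E] e0)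
      have "(LINT x|lborel. \<bar>u x\<bar> powr p * \<bar>u x - band N u x\<bar>) \<le> sqrt (l2sq (\<lambda>x. \<bar>u x\<bar> powr p)) * sqrt (l2sq (\<lambda>x. u x - band N u x))"
        by (rule integrable_powr_mult(2)[OF X Lh])
      also have "\<dots> \<le> B2 * (sqrt M * (1 / sqrt N))" using h B2(1) B2(2)[OF X E] by (intro mult_mono) auto
      finally show "(LINT x|lborel. \<bar>u x\<bar> powr p * \<bar>u x - band N u x\<bar>) \<le> B2 * (sqrt M * (1 / sqrt N))" .
    qed
    also have "\<dots> \<le> C * ((B1 + B2 * sqrt M) * (e + 1 / sqrt N))"
    proof (rule mult_left_mono[OF _ C_nonneg])
      have "0 \<le> B1 * (1 / sqrt N)" "0 \<le> B2 * sqrt M * e" using B1 B2 M N e0 by auto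
      then show "e * B1 + B2 * (sqrt M * (1 / sqrt N)) \<le> (B1 + B2 * sqrt M) * (e + 1 / sqrt N)"
        by (simp add: algebra_simps)
    qed
    finally have "(p + 1) * (- (LINT x|lborel. F (u x))) \<le> (p + 1) * (C * ((B1 + B2 * sqrt M) * (e + 1 / sqrt N)))"
      using p_ge by (intro mult_left_mono) auto
    moreover have "K u = (p + 1) * (- (LINT x|lborel. F (u x)))" unfolding K_fun_def by (simp add: algebra_simps)
    ultimately show "K u \<le> B * (e + 1 / sqrt N)" unfolding B_def by (simp only: mult.assoc)
  qed
qed

text \<open>Moves the mixed term to a form with a single first power of b, the function that is
  small in L2 on bounded intervals. For a <= b the second summand suffices, otherwise the
  first.\<close>

lemma powr_interpolate: "a \<ge> 0 \<Longrightarrow> b \<ge> 0 \<Longrightarrow> a * b powr p \<le> (a powr p + b powr p) * b" for a b :: real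
proof -
  assume a: "a \<ge> 0" and b: "b \<ge> 0"
  show ?thesis
  proof (cases "a \<le> b")
    case True
    then have "a * b powr p \<le> b * b powr p" by (intro mult_right_mono) auto
    also have "\<dots> \<le> (a powr p + b powr p) * b" using b by (simp add: algebra_simps)
    finally show ?thesis .
  next
    case False
    have split: "t powr p = t powr (p - 1) * t" if "t \<ge> 0" for t
      using that p_ge by (cases "t = 0") (auto simp: powr_mult_base' powr_diff)
    have "b powr (p - 1) \<le> a powr (p - 1)" using False b p_ge by (intro powr_mono2) auto
    then have "a * b powr (p - 1) * b \<le> a * a powr (p - 1) * b" using a b by (intro mult_right_mono mult_left_mono) auto
    also have "a * a powr (p - 1) = a powr p" using split[OF a] by (simp add: mult.commute)
    finally have "a * b powr p \<le> a powr p * b" using split[OF b] by (simp add: mult.assoc)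
    then show ?thesis using b by (simp add: algebra_simps add_increasing2)
  qed
qed

text \<open>A splitting in the spirit of Brezis and Lieb, from local strong convergence alone:
  inside \<open>{-R..R}\<close> the remainder is small, outside the limit is.\<close>

lemma K_splitting:
  assumes X: "\<And>n. Xspace (v n)" and E: "\<And>n. energy (v n) \<le> M" and Xp: "Xspace \<phi>"
    and loc: "\<And>R. (\<lambda>n. l2sq (cutoff R (v n))) \<longlonglongrightarrow> 0"
  shows "(\<lambda>n. K (\<lambda>x. \<phi> x + v n x) - K \<phi> - K (v n)) \<longlonglongrightarrow> 0"
proof -
  note L = Xspace_L2[OF X] and Lp = Xspace_L2[OF Xp]
  have M: "M \<ge> 0" using energy_nonneg[of "v 0"] E[of 0] by linarith
  obtain B where B0: "B \<ge> 0" "\<And>u. Xspace u \<Longrightarrow> energy u \<le> M \<Longrightarrow> sqrt (l2sq (\<lambda>x. \<bar>u x\<bar> powr p)) \<le> B"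
    by (rule powr_bound[OF M]) blast
  have B: "B \<ge> 0" "\<And>n. sqrt (l2sq (\<lambda>x. \<bar>v n x\<bar> powr p)) \<le> B"
    by (rule B0(1), rule B0(2)[OF X E])
  obtain B' where B': "B' \<ge> 0" "\<And>n. sqrt (l2sq (v n)) \<le> B'"
  proof -
    have "l2sq (v n) \<le> M" for n
    proof -
      have "2 * pi * l2sq (v n) \<le> 1 * energy (v n)"
        using Xspace_integrable_le(2)[OF X[of n], of "\<lambda>_. 1" 1] weight_ge_1 plancherel[OF L[of n]] by (simp add: l2sq_def)
      moreover have "1 * l2sq (v n) \<le> 2 * pi * l2sq (v n)" using pi_gt3 by (intro mult_right_mono) auto
      ultimately show ?thesis using E[of n] by linarith
    qed
    then show ?thesis using that[of "sqrt M"] M by simp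
  qed
  define P where "P x = \<bar>\<phi> x\<bar> powr p" for x
  have LP: "L2fun P" unfolding P_def[abs_def] by (rule powr_L2(1)[OF Xp])
  define A where "A = sqrt (l2sq P)"
  \<comment> \<open>A bound free of case distinctions: inside the window the two differences vanish
    and \<open>powr_interpolate\<close> puts the cut remainder into every term, hence the factor 2;
    outside, the cutoffs vanish and the differences carry the tail of the limit.\<close>
  have pt: "\<bar>\<phi> x\<bar> powr p * \<bar>v n x\<bar> + \<bar>\<phi> x\<bar> * \<bar>v n x\<bar> powr p
    \<le> 2 * (\<bar>\<phi> x\<bar> powr p * \<bar>cutoff R (v n) x\<bar>) + \<bar>v n x\<bar> powr p * \<bar>cutoff R (v n) x\<bar>
      + norm (cutoff R P x - P x) * norm (v n x) + \<bar>v n x\<bar> powr p * \<bar>cutoff R \<phi> x - \<phi> x\<bar>" for n R x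
  proof (cases "x \<in> {-R..R}")
    case True
    then have "cutoff R g x = g x" for g by (simp add: cutoff_def)
    then show ?thesis using powr_interpolate[of "\<bar>\<phi> x\<bar>" "\<bar>v n x\<bar>"] by (simp add: algebra_simps)
  next
    case False
    then have "cutoff R g x = 0" for g by (simp add: cutoff_def)
    then show ?thesis by (simp add: P_def algebra_simps)
  qed
  \<comment> \<open>The contribution from outside the window, uniform in n. \<open>R\<close> is
    fixed first to make it small; only then does n grow.\<close>
  define T where "T R = sqrt (l2sq (\<lambda>x. cutoff R P x - P x)) * B' + B * sqrt (l2sq (\<lambda>x. cutoff R \<phi> x - \<phi> x))" for R
  have bound: "\<bar>K (\<lambda>x. \<phi> x + v n x) - K \<phi> - K (v n)\<bar> \<le> (p + 1) * (C * ((2 * A + B) * sqrt (l2sq (cutoff R (v n))) + T R))" for n R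
  proof -
    let ?c = "cutoff R (v n)"
    have Lc: "L2fun ?c" by (rule L2fun_cutoff[OF L])
    have i1: "integrable lborel (\<lambda>x. \<bar>\<phi> x\<bar> powr p * \<bar>?c x\<bar>)" by (rule integrable_powr_mult[OF Xp Lc])
    have i2: "integrable lborel (\<lambda>x. \<bar>v n x\<bar> powr p * \<bar>?c x\<bar>)" by (rule integrable_powr_mult[OF X Lc])
    have LPc: "L2fun (\<lambda>x. cutoff R P x - P x)" by (intro L2fun_diff L2fun_cutoff LP)
    have Lpc: "L2fun (\<lambda>x. cutoff R \<phi> x - \<phi> x)" by (intro L2fun_diff L2fun_cutoff Lp)
    have i3: "integrable lborel (\<lambda>x. norm (cutoff R P x - P x) * norm (v n x))" by (rule L2fun_norm_mult[OF LPc L])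
    have i4: "integrable lborel (\<lambda>x. \<bar>v n x\<bar> powr p * \<bar>cutoff R \<phi> x - \<phi> x\<bar>)" by (rule integrable_powr_mult[OF X Lpc])
    have iF: "integrable lborel (\<lambda>x. F (\<phi> x + v n x))" "integrable lborel (\<lambda>x. F (\<phi> x))" "integrable lborel (\<lambda>x. F (v n x))"
      by (intro integrable_F Xspace_add X Xp)+
    have eqK: "\<bar>K (\<lambda>x. \<phi> x + v n x) - K \<phi> - K (v n)\<bar> = (p + 1) * \<bar>LINT x|lborel. F (\<phi> x + v n x) - F (\<phi> x) - F (v n x)\<bar>"
    proof -
      have "K (\<lambda>x. \<phi> x + v n x) - K \<phi> - K (v n) = - ((p + 1) * (LINT x|lborel. F (\<phi> x + v n x) - F (\<phi> x) - F (v n x)))"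
        unfolding K_fun_def using iF by (simp add: algebra_simps)
      then show ?thesis using p_ge by (simp add: abs_mult)
    qed
    have "\<bar>LINT x|lborel. F (\<phi> x + v n x) - F (\<phi> x) - F (v n x)\<bar> \<le> (LINT x|lborel. \<bar>F (\<phi> x + v n x) - F (\<phi> x) - F (v n x)\<bar>)"
      by (rule integral_abs_bound)
    also have "\<dots> \<le> (LINT x|lborel. C * (2 * (\<bar>\<phi> x\<bar> powr p * \<bar>?c x\<bar>) + \<bar>v n x\<bar> powr p * \<bar>?c x\<bar>
      + norm (cutoff R P x - P x) * norm (v n x) + \<bar>v n x\<bar> powr p * \<bar>cutoff R \<phi> x - \<phi> x\<bar>))"
    proof (rule integral_mono)
      show "integrable lborel (\<lambda>x. \<bar>F (\<phi> x + v n x) - F (\<phi> x) - F (v n x)\<bar>)"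
        by (intro integrable_abs Bochner_Integration.integrable_diff iF)
      show "integrable lborel (\<lambda>x. C * (2 * (\<bar>\<phi> x\<bar> powr p * \<bar>?c x\<bar>) + \<bar>v n x\<bar> powr p * \<bar>?c x\<bar>
        + norm (cutoff R P x - P x) * norm (v n x) + \<bar>v n x\<bar> powr p * \<bar>cutoff R \<phi> x - \<phi> x\<bar>))"
        by (intro integrable_mult_right Bochner_Integration.integrable_add i1 i2 i3 i4)
      show "\<bar>F (\<phi> x + v n x) - F (\<phi> x) - F (v n x)\<bar> \<le> C * (2 * (\<bar>\<phi> x\<bar> powr p * \<bar>?c x\<bar>) + \<bar>v n x\<bar> powr p * \<bar>?c x\<bar>
        + norm (cutoff R P x - P x) * norm (v n x) + \<bar>v n x\<bar> powr p * \<bar>cutoff R \<phi> x - \<phi> x\<bar>)" for x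
        by (rule order_trans[OF F_split mult_left_mono[OF pt C_nonneg]])
    qed
    also have "\<dots> = C * (2 * (LINT x|lborel. \<bar>\<phi> x\<bar> powr p * \<bar>?c x\<bar>) + (LINT x|lborel. \<bar>v n x\<bar> powr p * \<bar>?c x\<bar>)
      + (LINT x|lborel. norm (cutoff R P x - P x) * norm (v n x)) + (LINT x|lborel. \<bar>v n x\<bar> powr p * \<bar>cutoff R \<phi> x - \<phi> x\<bar>))"
      using i1 i2 i3 i4 by simp
    also have "\<dots> \<le> C * (2 * (A * sqrt (l2sq ?c)) + B * sqrt (l2sq ?c)
      + sqrt (l2sq (\<lambda>x. cutoff R P x - P x)) * B' + B * sqrt (l2sq (\<lambda>x. cutoff R \<phi> x - \<phi> x)))"
    proof (intro mult_left_mono add_mono C_nonneg)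
      show "(LINT x|lborel. \<bar>\<phi> x\<bar> powr p * \<bar>?c x\<bar>) \<le> A * sqrt (l2sq ?c)"
        using integrable_powr_mult(2)[OF Xp Lc] unfolding A_def P_def[abs_def] .
      show "(LINT x|lborel. \<bar>v n x\<bar> powr p * \<bar>?c x\<bar>) \<le> B * sqrt (l2sq ?c)"
        by (rule order_trans[OF integrable_powr_mult(2)[OF X Lc] mult_right_mono[OF B(2)]]) simp
      show "(LINT x|lborel. norm (cutoff R P x - P x) * norm (v n x)) \<le> sqrt (l2sq (\<lambda>x. cutoff R P x - P x)) * B'"
        by (rule order_trans[OF L2_Cauchy_Schwarz[OF LPc L] mult_left_mono[OF B'(2)]]) simp
      show "(LINT x|lborel. \<bar>v n x\<bar> powr p * \<bar>cutoff R \<phi> x - \<phi> x\<bar>) \<le> B * sqrt (l2sq (\<lambda>x. cutoff R \<phi> x - \<phi> x))"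
        by (rule order_trans[OF integrable_powr_mult(2)[OF X Lpc] mult_right_mono[OF B(2)]]) simp
    qed simp
    also have "\<dots> = C * ((2 * A + B) * sqrt (l2sq ?c) + T R)" by (simp add: T_def distrib_right add.assoc)
    finally show ?thesis unfolding eqK using p_ge by (intro mult_left_mono) auto
  qed
  have T0: "((\<lambda>R. (p + 1) * (C * T R)) \<longlongrightarrow> 0) at_top"
  proof -
    have "((\<lambda>R. (p + 1) * (C * T R)) \<longlongrightarrow> (p + 1) * (C * (sqrt 0 * B' + B * sqrt 0))) at_top"
      unfolding T_def by (intro tendsto_intros cutoff_tendsto LP Lp)
    then show ?thesis by simp
  qed
  show ?thesis
  proof (rule LIMSEQ_I)
    fix e :: real assume e: "e > 0"
    have "\<forall>\<^sub>F R in at_top. (p + 1) * (C * T R) < e/2" using T0 e by (intro order_tendstoD) auto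
    then obtain R where R: "(p + 1) * (C * T R) < e/2" using eventually_happens'[OF trivial_limit_at_top_linorder] by blast
    have "(\<lambda>n. (p + 1) * (C * ((2 * A + B) * sqrt (l2sq (cutoff R (v n)))))) \<longlonglongrightarrow> (p + 1) * (C * ((2 * A + B) * sqrt 0))"
      by (intro tendsto_intros loc)
    then have "\<forall>\<^sub>F n in sequentially. (p + 1) * (C * ((2 * A + B) * sqrt (l2sq (cutoff R (v n))))) < e/2"
      using e by (intro order_tendstoD) auto
    then have "\<forall>\<^sub>F n in sequentially. \<bar>K (\<lambda>x. \<phi> x + v n x) - K \<phi> - K (v n)\<bar> < e"
    proof eventually_elim
      case (elim n)
      then show ?case using bound[of n R] R by (simp add: distrib_left)
    qed
    then show "\<exists>no. \<forall>n\<ge>no. norm (K (\<lambda>x. \<phi> x + v n x) - K \<phi> - K (v n) - 0) < e"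
      by (auto simp: eventually_sequentially)
  qed
qed

end


subsection \<open>Compactness of minimizing sequences\<close>

context variational begin

text \<open>Multiplying u by \<open>a\<close> moves it to the level \<open>lam\<close>: K scales
  with exponent p+1 and I with exponent 2. This is the scaling law for M_t, phrased as a lower bound
  for I at any positive level in terms of the one value at \<open>lam\<close>. The rescaled function
  also shows that the constraint set is nonempty, so the infimum is genuine.\<close>

lemma M_lam_le:
  assumes lam: "lam > 0" and X: "Xspace u" and K: "K u > 0"
  shows "(K u / lam) powr (2 / (p + 1)) * M_lam \<beta> c \<gamma> F p lam \<le> I u"
proof -
  define a where "a = (lam / K u) powr (1 / (p + 1))"
  have a: "a > 0" unfolding a_def using lam K by simp
  have "K (\<lambda>x. a * u x) = a powr (p + 1) * K u" by (rule K_scale[OF a])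
  also have "a powr (p + 1) = lam / K u" unfolding a_def using p_ge lam K by (simp add: powr_powr)
  also have "lam / K u * K u = lam" using K by simp
  finally have Ka: "K (\<lambda>x. a * u x) = lam" .
  have "M_lam \<beta> c \<gamma> F p lam \<le> I (\<lambda>x. a * u x)"
    unfolding M_lam_def
  proof (rule cInf_lower)
    show "I (\<lambda>x. a * u x) \<in> {I u |u. Xspace u \<and> K u = lam}" using Ka Xspace_scale[OF X] by blast
    show "bdd_below {I u |u. Xspace u \<and> K u = lam}" by (rule bdd_belowI[of _ 0]) (auto intro: I_nonneg)
  qed
  also have "\<dots> = a^2 * I u" by (rule I_scale[OF X])
  also have "a^2 = (lam / K u) powr (2 / (p + 1))"
    unfolding a_def using lam K by (simp add: power2_eq_square flip: powr_add)
  finally have "(K u / lam) powr (2 / (p + 1)) * M_lam \<beta> c \<gamma> F p lam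
      \<le> (K u / lam) powr (2 / (p + 1)) * ((lam / K u) powr (2 / (p + 1)) * I u)"
    by (intro mult_left_mono) auto
  also have "\<dots> = ((K u / lam) * (lam / K u)) powr (2 / (p + 1)) * I u"
    using lam K by (subst powr_mult) (auto simp: mult.assoc)
  also have "\<dots> = I u" using lam K by simp
  finally show ?thesis .
qed

text \<open>A number strictly between 0 and 1 increases when its exponent drops below 1. This is the
  strict subadditivity, with exponent 2/(p+1).\<close>

lemma powr_strict_concave_sum:
  fixes s \<theta> :: real
  assumes "0 < s" "s < 1" "\<theta> < 1" shows "1 < s powr \<theta> + (1 - s) powr \<theta>"
proof -
  have gt: "t < t powr \<theta>" if "0 < t" "t < 1" for t :: real
  proof -
    have "t powr 1 < t powr \<theta>" using that assms by (intro powr_less_mono') auto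
    then show ?thesis using that by simp
  qed
  show ?thesis using gt[of s] gt[of "1 - s"] assms by simp
qed

theorem minimizing_sequence_compact:
  assumes lam: "lam > 0" and X: "\<And>n. Xspace (\<psi> n)"
    and K_lim: "(\<lambda>n. K (\<psi> n)) \<longlonglongrightarrow> lam" and I_lim: "(\<lambda>n. I (\<psi> n)) \<longlonglongrightarrow> M_lam \<beta> c \<gamma> F p lam"
  shows "\<exists>r y \<phi>. strict_mono r \<and> Xspace \<phi> \<and> (\<lambda>n. Xnorm (\<lambda>x. \<psi> (r n) (x + y n) - \<phi> x)) \<longlonglongrightarrow> 0 \<and>
    K \<phi> = lam \<and> I \<phi> = M_lam \<beta> c \<gamma> F p lam"
proof -
  define M where "M = M_lam \<beta> c \<gamma> F p lam"
  define \<theta> where "\<theta> = 2 / (p + 1)"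
  have \<theta>: "0 < \<theta>" "\<theta> < 1" unfolding \<theta>_def using p_ge by auto
  have key: "(K u / lam) powr \<theta> * M \<le> I u" if "Xspace u" "K u > 0" for u
    unfolding M_def \<theta>_def by (rule M_lam_le[OF lam that])
  obtain B where B: "\<And>n. \<bar>I (\<psi> n)\<bar> \<le> B"
    using convergent_imp_Bseq[OF convergentI[OF I_lim]] by (auto simp: Bseq_def)
  define E where "E = 2 * pi * B / \<kappa>"
  have energy_E: "energy u \<le> E" if "Xspace u" "I u \<le> B" for u
  proof -
    have "\<kappa> * energy u \<le> 2 * pi * I u" by (rule energy_le_I[OF that(1)])
    also have "\<dots> \<le> 2 * pi * B" using that(2) by simp
    finally show ?thesis unfolding E_def using \<kappa>_pos by (simp add: field_simps)
  qed
  have E0: "E \<ge> 0" using energy_E[OF X[of 0]] B[of 0] energy_nonneg[of "\<psi> 0"] by force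
  obtain D where D: "D \<ge> 0" "\<And>u N e. Xspace u \<Longrightarrow> energy u \<le> E \<Longrightarrow> N > 0 \<Longrightarrow> (\<And>x. \<bar>band N u x\<bar> \<le> e) \<Longrightarrow> K u \<le> D * (e + 1 / sqrt N)"
    by (rule K_le_band[OF E0]) blast
  \<comment> \<open>With N = 1/e^2 both terms of \<open>K_le_band\<close> equal D e, and their sum
    is at most lam/2, too small for a late member of the sequence; D + 1 guards against D =
    0.\<close>
  define e where "e = lam / (4 * (D + 1))"
  have e: "e > 0" unfolding e_def using lam D by simp
  define N where "N = 1 / e^2"
  have N: "N > 0" "1 / sqrt N = e" unfolding N_def using e by (auto simp: real_sqrt_divide)
  have De: "D * (e + 1 / sqrt N) \<le> lam / 2"
  proof -
    have "D * (e + 1 / sqrt N) = 2 * (D * e)" unfolding N(2) by simp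
    also have "\<dots> \<le> 2 * ((D + 1) * e)" using e by simp
    also have "(D + 1) * e = lam / 4" unfolding e_def using D by (simp add: field_simps)
    finally show ?thesis by simp
  qed
  \<comment> \<open>The translation is chosen for every member before any subsequence is taken. For
    the finitely many n lacking such a point it is an arbitrary real, which affects no
    limit.\<close>
  define Y where "Y n = (SOME y. \<bar>band N (\<psi> n) y\<bar> > e)" for n
  have Kbig: "\<forall>\<^sub>F n in sequentially. K (\<psi> n) > lam / 2" using K_lim lam by (intro order_tendstoD) auto
  have Y: "\<forall>\<^sub>F n in sequentially. \<bar>band N (\<psi> n) (Y n)\<bar> > e"
    using Kbig
  proof eventually_elim
    case (elim n)
    have "\<exists>y. \<bar>band N (\<psi> n) y\<bar> > e"
    proof (rule ccontr)
      assume "\<not> ?thesis"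
      then have "\<bar>band N (\<psi> n) x\<bar> \<le> e" for x by (auto simp: not_less)
      moreover have "energy (\<psi> n) \<le> E" using energy_E[OF X] B[of n] by auto
      ultimately have "K (\<psi> n) \<le> D * (e + 1 / sqrt N)" using D(2)[OF X _ N(1)] by blast
      then show False using De elim by simp
    qed
    then show ?case unfolding Y_def by (rule someI_ex)
  qed
  \<comment> \<open>The large value of the band now sits at 0 for all late n; as bands converge
    pointwise along the weakly convergent subsequence, it persists and makes the limit
    nonzero.\<close>
  define u where "u n x = \<psi> n (x + Y n)" for n x
  have Xu: "Xspace (u n)" for n unfolding u_def by (rule Xspace_shift[OF X])
  have Iu: "I (u n) = I (\<psi> n)" for n unfolding u_def by (rule I_shift[OF X])
  have Ku: "K (u n) = K (\<psi> n)" for n unfolding u_def by (rule K_shift)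
  have bu: "band N (u n) 0 = band N (\<psi> n) (Y n)" for n
    unfolding u_def using band_shift[OF Xspace_L2[OF X], of N n "Y n" 0] by simp
  have IuB: "I (u n) \<le> B" for n using B[of n] Iu[of n] by simp
  obtain k :: "nat \<Rightarrow> nat" and \<phi> where k: "strict_mono k" and X\<phi>: "Xspace \<phi>"
    and weak: "\<And>v. Xspace v \<Longrightarrow> (\<lambda>n. l2ip (hX (u (k n))) (hX v)) \<longlonglongrightarrow> l2ip (hX \<phi>) (hX v)"
    and bands: "\<And>N x. (\<lambda>n. band N (u (k n)) x) \<longlonglongrightarrow> band N \<phi> x"
    by (rule weak_compact[of u B, OF Xu IuB]) blast
  define w where "w n = u (k n)" for n
  have Xw: "Xspace (w n)" for n unfolding w_def by (rule Xu)
  have Iw: "(\<lambda>n. I (w n)) \<longlonglongrightarrow> M"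
    using LIMSEQ_subseq_LIMSEQ[OF I_lim k] by (simp add: w_def Iu M_def comp_def)
  have Kw: "(\<lambda>n. K (w n)) \<longlonglongrightarrow> lam"
    using LIMSEQ_subseq_LIMSEQ[OF K_lim k] by (simp add: w_def Ku comp_def)
  have "\<forall>\<^sub>F n in sequentially. e \<le> \<bar>band N (u (k n)) 0\<bar>"
    using eventually_subseq[OF k Y] by eventually_elim (simp add: bu)
  then have "e \<le> \<bar>band N \<phi> 0\<bar>"
    by (intro tendsto_lowerbound[OF tendsto_rabs[OF bands]]) auto
  also have "\<dots> \<le> sqrt (2 * ln (1 + N) * energy \<phi>)" by (rule band_le[OF X\<phi>]) (use N in simp)
  finally have "energy \<phi> \<noteq> 0" using e by auto
  then have "energy \<phi> > 0" using energy_nonneg[of \<phi>] by simp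
  then have "0 < \<kappa> * energy \<phi>" using \<kappa>_pos by simp
  also have "\<dots> \<le> 2 * pi * I \<phi>" by (rule energy_le_I[OF X\<phi>])
  finally have I\<phi>: "I \<phi> > 0" using pi_gt_zero by (simp add: zero_less_mult_iff)
  define v where "v n x = w n x - \<phi> x" for n x
  have Xv: "Xspace (v n)" for n unfolding v_def by (rule Xspace_diff[OF Xw X\<phi>])
  have Iv: "(\<lambda>n. I (v n)) \<longlonglongrightarrow> M - I \<phi>"
  proof -
    have "(\<lambda>n. I (w n) - l2ip (hX (w n)) (hX \<phi>) / pi + I \<phi>) \<longlonglongrightarrow> M - l2ip (hX \<phi>) (hX \<phi>) / pi + I \<phi>"
      unfolding w_def by (intro tendsto_intros Iw[unfolded w_def] weak X\<phi>) simp
    also have "l2ip (hX \<phi>) (hX \<phi>) / pi = 2 * I \<phi>" by (simp add: l2ip_self hX_facts X\<phi>)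
    finally show ?thesis unfolding v_def I_diff[OF Xw X\<phi>] by simp
  qed
  obtain B2 where B2: "\<And>n. \<bar>I (v n)\<bar> \<le> B2"
    using convergent_imp_Bseq[OF convergentI[OF Iv]] by (auto simp: Bseq_def)
  define E2 where "E2 = 2 * pi * B2 / \<kappa>"
  have Ev: "energy (v n) \<le> E2" for n
  proof -
    have "\<kappa> * energy (v n) \<le> 2 * pi * I (v n)" by (rule energy_le_I[OF Xv])
    also have "\<dots> \<le> 2 * pi * B2" using B2[of n] by simp
    finally show ?thesis unfolding E2_def using \<kappa>_pos by (simp add: field_simps)
  qed
  \<comment> \<open>The local convergence lemma takes one energy bound for the sequence and its
    limit, hence the maximum.\<close>
  have Ew: "energy (w n) \<le> max E (energy \<phi>)" for n
    using energy_E[OF Xw, of n] IuB unfolding w_def by (simp add: le_max_iff_disj)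
  have loc: "(\<lambda>n. l2sq (cutoff R (v n))) \<longlonglongrightarrow> 0" for R
    unfolding v_def
    by (rule local_L2_convergence[OF Xw Ew X\<phi>]) (auto simp: w_def intro: bands)
  have "(\<lambda>n. K (\<lambda>x. \<phi> x + v n x) - K \<phi> - K (v n)) \<longlonglongrightarrow> 0"
    by (rule K_splitting[OF Xv Ev X\<phi> loc])
  moreover have "(\<lambda>x. \<phi> x + v n x) = w n" for n by (simp add: v_def)
  ultimately have "(\<lambda>n. K (w n) - K \<phi> - K (v n)) \<longlonglongrightarrow> 0" by simp
  then have "(\<lambda>n. (K (w n) - K \<phi>) - (K (w n) - K \<phi> - K (v n))) \<longlonglongrightarrow> (lam - K \<phi>) - 0"
    by (intro tendsto_intros Kw)
  then have Kv: "(\<lambda>n. K (v n)) \<longlonglongrightarrow> lam - K \<phi>" by simp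
  \<comment> \<open>The remainder has nonnegative energy in the limit. Together with I phi > 0 this
    also gives M > 0, which the strict inequalities rely on.\<close>
  have M_ge: "I \<phi> \<le> M"
    using tendsto_lowerbound[OF Iv, of 0] I_nonneg[OF Xv] by simp
  then have M_pos: "M > 0" using I\<phi> by simp
  \<comment> \<open>Positivity of the limit makes K (v n) eventually positive, so that
    \<open>key\<close> applies to the remainder, and lets the powers converge.\<close>
  have rest: "((lam - K \<phi>) / lam) powr \<theta> * M \<le> M - I \<phi>" if pos: "lam - K \<phi> > 0"
  proof (rule tendsto_le[OF sequentially_bot Iv])
    show "(\<lambda>n. (K (v n) / lam) powr \<theta> * M) \<longlonglongrightarrow> ((lam - K \<phi>) / lam) powr \<theta> * M"
      using pos lam by (intro tendsto_intros Kv) auto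
    show "\<forall>\<^sub>F n in sequentially. (K (v n) / lam) powr \<theta> * M \<le> I (v n)"
      using order_tendstoD(1)[OF Kv pos] by eventually_elim (rule key[OF Xv])
  qed
  \<comment> \<open>If K phi <= 0, the remainder carries at least the level lam and costs at least
    M, leaving nothing for I phi > 0. If K phi lies strictly between 0 and lam, the two parts
    together cost more than M by strict subadditivity. If K phi > lam, phi alone costs more than
    M.\<close>
  have "K \<phi> = lam"
  proof (rule ccontr)
    assume ne: "K \<phi> \<noteq> lam"
    consider "K \<phi> \<le> 0" | "0 < K \<phi>" "K \<phi> < lam" | "K \<phi> > lam" using ne by linarith
    then show False
    proof cases
      case 1
      have "1 \<le> (lam - K \<phi>) / lam" using 1 lam by (simp add: field_simps)
      then have "1 \<le> ((lam - K \<phi>) / lam) powr \<theta>" using \<theta> by (intro ge_one_powr_ge_zero) auto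
      then have "1 * M \<le> ((lam - K \<phi>) / lam) powr \<theta> * M" using M_pos by (intro mult_right_mono) auto
      then show False using rest I\<phi> 1 lam by linarith
    next
      case 2
      have "1 < (K \<phi> / lam) powr \<theta> + (1 - K \<phi> / lam) powr \<theta>"
        using 2 \<theta> lam by (intro powr_strict_concave_sum) auto
      also have "1 - K \<phi> / lam = (lam - K \<phi>) / lam" using lam by (simp add: field_simps)
      finally have "1 * M < ((K \<phi> / lam) powr \<theta> + ((lam - K \<phi>) / lam) powr \<theta>) * M"
        using M_pos by (intro mult_strict_right_mono) auto
      then show False using rest 2 key[OF X\<phi> 2(1)] by (simp add: distrib_right)
    next
      case 3
      have "1 powr \<theta> < (K \<phi> / lam) powr \<theta>" using 3 lam \<theta> by (intro powr_less_mono2) auto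
      then have "1 * M < (K \<phi> / lam) powr \<theta> * M" using M_pos by (intro mult_strict_right_mono) auto
      then show False using key[OF X\<phi>] 3 lam M_ge by linarith
    qed
  qed
  moreover have "I \<phi> = M" using key[OF X\<phi>] \<open>K \<phi> = lam\<close> lam M_ge by simp
  \<comment> \<open>Coercivity once more: the limit of I (v n) is M - I phi = 0, and it controls the
    energy, hence the X norm.\<close>
  moreover have "(\<lambda>n. Xnorm (v n)) \<longlonglongrightarrow> 0"
  proof (rule Lim_null_comparison)
    have "(\<lambda>n. 2 * sqrt (I (v n) / \<kappa>)) \<longlonglongrightarrow> 2 * sqrt ((M - I \<phi>) / \<kappa>)"
      using \<kappa>_pos by (intro tendsto_intros Iv) auto
    then show "(\<lambda>n. 2 * sqrt (I (v n) / \<kappa>)) \<longlonglongrightarrow> 0" using \<open>I \<phi> = M\<close> by simp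
    show "\<forall>\<^sub>F n in sequentially. norm (Xnorm (v n)) \<le> 2 * sqrt (I (v n) / \<kappa>)"
    proof (rule always_eventually, rule allI)
      fix n
      have "energy (v n) / (2 * pi) \<le> I (v n) / \<kappa>"
        using energy_le_I[OF Xv[of n]] \<kappa>_pos by (simp add: field_simps)
      then have "2 * sqrt (energy (v n) / (2 * pi)) \<le> 2 * sqrt (I (v n) / \<kappa>)" by simp
      then show "norm (Xnorm (v n)) \<le> 2 * sqrt (I (v n) / \<kappa>)"
        unfolding real_norm_def abs_of_nonneg[OF Xnorm_nonneg] by (rule order_trans[OF Xnorm_le[OF Xv]])
    qed
  qed
  then have "(\<lambda>n. Xnorm (\<lambda>x. \<psi> (k n) (x + Y (k n)) - \<phi> x)) \<longlonglongrightarrow> 0"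
    by (simp add: v_def[abs_def] w_def u_def)
  ultimately show ?thesis using k X\<phi> unfolding M_def
    by (intro exI[of _ k] exI[of _ "\<lambda>n. Y (k n)"] exI[of _ \<phi>]) simp
qed

end

text \<open>Homogeneity bounds f by its values at 1 and -1, the mean value inequality turns this
  into bounds for increments of F, and F inherits homogeneity because the difference of the two
  sides has zero derivative and vanishes at 0.\<close>

lemma homogeneous_antiderivative:
  fixes p :: real and f F :: "real \<Rightarrow> real"
  assumes p: "p \<ge> 2" and f_hom: "\<forall>l s. l > 0 \<longrightarrow> f (l * s) = l powr p * f s"
    and F': "\<forall>s. (F has_real_derivative f s) (at s)" and F0: "F 0 = 0"
  obtains C where "C \<ge> 0" "\<And>l s. l > 0 \<Longrightarrow> F (l * s) = l powr (p + 1) * F s"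
    "\<And>s. \<bar>F s\<bar> \<le> C * (\<bar>s\<bar> powr p * \<bar>s\<bar>)"
    "\<And>a b. \<bar>F (a + b) - F a - F b\<bar> \<le> C * (\<bar>a\<bar> powr p * \<bar>b\<bar> + \<bar>a\<bar> * \<bar>b\<bar> powr p)"
proof -
  define C0 where "C0 = max \<bar>f 1\<bar> \<bar>f (-1)\<bar>"
  have C0: "C0 \<ge> 0" by (simp add: C0_def)
  \<comment> \<open>Homogeneity speaks only of positive factors, so the value at 0 is obtained from
    scaling by 2.\<close>
  have "f 0 = 2 powr p * f 0" using f_hom[rule_format, of 2 0] by simp
  moreover have "2 powr p > (1::real)" using p by simp
  ultimately have f0: "f 0 = 0" using p by auto
  have fb: "\<bar>f s\<bar> \<le> C0 * \<bar>s\<bar> powr p" for s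
  proof -
    consider "s = 0" | "s > 0" | "s < 0" by linarith
    then show ?thesis
    proof cases
      case 2
      have "f s = \<bar>s\<bar> powr p * f 1" using f_hom[rule_format, of "\<bar>s\<bar>" 1] 2 by simp
      moreover have "\<bar>s\<bar> powr p * \<bar>f 1\<bar> \<le> \<bar>s\<bar> powr p * C0" by (intro mult_left_mono) (auto simp: C0_def)
      ultimately show ?thesis by (simp add: abs_mult mult.commute)
    next
      case 3
      have "f s = \<bar>s\<bar> powr p * f (-1)" using f_hom[rule_format, of "\<bar>s\<bar>" "-1"] 3 by simp
      moreover have "\<bar>s\<bar> powr p * \<bar>f (-1)\<bar> \<le> \<bar>s\<bar> powr p * C0" by (intro mult_left_mono) (auto simp: C0_def)
      ultimately show ?thesis by (simp add: abs_mult mult.commute)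
    qed (simp add: f0)
  qed
  have incr: "\<bar>F (a + b) - F a\<bar> \<le> C0 * (\<bar>a\<bar> + \<bar>b\<bar>) powr p * \<bar>b\<bar>" for a b
  proof -
    have "norm (F (a + b) - F a) \<le> (C0 * (\<bar>a\<bar> + \<bar>b\<bar>) powr p) * norm ((a + b) - a)"
    proof (rule field_differentiable_bound[of "closed_segment a (a + b)" F f])
      fix z assume z: "z \<in> closed_segment a (a + b)"
      show "(F has_field_derivative f z) (at z within closed_segment a (a + b))"
        using F' by (auto intro: has_field_derivative_at_within)
      have "\<bar>z\<bar> \<le> \<bar>a\<bar> + \<bar>b\<bar>" using z by (auto simp: closed_segment_eq_real_ivl split: if_splits)
      then have "\<bar>z\<bar> powr p \<le> (\<bar>a\<bar> + \<bar>b\<bar>) powr p" using p by (intro powr_mono2) auto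
      then show "norm (f z) \<le> C0 * (\<bar>a\<bar> + \<bar>b\<bar>) powr p"
        using fb[of z] mult_left_mono[of "\<bar>z\<bar> powr p" "(\<bar>a\<bar> + \<bar>b\<bar>) powr p" C0] C0 by simp
    qed auto
    then show ?thesis by simp
  qed
  have Fb: "\<bar>F s\<bar> \<le> C0 * (\<bar>s\<bar> powr p * \<bar>s\<bar>)" for s
    using incr[of 0 s] F0 by (simp add: mult.assoc)
  have hom: "F (l * s) = l powr (p + 1) * F s" if l: "l > 0" for l s
  proof -
    have "((\<lambda>s. F (l * s) - l powr (p + 1) * F s) has_real_derivative 0) (at s)" for s
    proof -
      have "((\<lambda>s. F (l * s) - l powr (p + 1) * F s) has_real_derivative (f (l * s) * l - l powr (p + 1) * f s)) (at s)"
        using F' by (auto intro!: derivative_eq_intros DERIV_chain'[where f="\<lambda>s. l * s" and g=F])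
      moreover have "f (l * s) * l - l powr (p + 1) * f s = 0"
        using f_hom[rule_format, OF l, of s] l by (simp add: powr_add)
      ultimately show ?thesis by simp
    qed
    then have "F (l * s) - l powr (p + 1) * F s = F (l * 0) - l powr (p + 1) * F 0"
      using DERIV_isconst_all[of "\<lambda>s. F (l * s) - l powr (p + 1) * F s" s 0] by blast
    then show ?thesis by (simp add: F0)
  qed
  \<comment> \<open>For |b| <= |a| the increment from a to a + b costs C0 2^p |a|^p |b|, and F b
    itself at most C0 |a|^p |b|. The other case follows by exchanging a and b.\<close>
  define C where "C = C0 * (2 powr p + 1)"
  have C: "C \<ge> 0" "C0 \<le> C" unfolding C_def using C0 by (auto simp: mult_le_cancel_left1)
  have half: "\<bar>F (a + b) - F a - F b\<bar> \<le> C * (\<bar>a\<bar> powr p * \<bar>b\<bar>)" if "\<bar>b\<bar> \<le> \<bar>a\<bar>" for a b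
  proof -
    have "\<bar>F (a + b) - F a\<bar> \<le> C0 * (2 * \<bar>a\<bar>) powr p * \<bar>b\<bar>"
      using that C0 p by (intro order_trans[OF incr] mult_right_mono mult_left_mono powr_mono2) auto
    moreover have "(2 * \<bar>a\<bar>) powr p = 2 powr p * \<bar>a\<bar> powr p" by (simp add: powr_mult)
    moreover have "\<bar>F b\<bar> \<le> C0 * (\<bar>a\<bar> powr p * \<bar>b\<bar>)"
      using that C0 p by (intro order_trans[OF Fb] mult_right_mono mult_left_mono powr_mono2) auto
    moreover have "C * (\<bar>a\<bar> powr p * \<bar>b\<bar>) = C0 * (2 powr p * \<bar>a\<bar> powr p) * \<bar>b\<bar> + C0 * (\<bar>a\<bar> powr p * \<bar>b\<bar>)"
      by (simp add: C_def algebra_simps)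
    moreover have "\<bar>F (a + b) - F a - F b\<bar> \<le> \<bar>F (a + b) - F a\<bar> + \<bar>F b\<bar>"
      by (rule abs_triangle_ineq4)
    ultimately show ?thesis by simp
  qed
  show ?thesis
  proof (rule that[OF C(1) hom])
    show "\<bar>F s\<bar> \<le> C * (\<bar>s\<bar> powr p * \<bar>s\<bar>)" for s
      by (rule order_trans[OF Fb mult_right_mono[OF C(2)]]) simp
    show "\<bar>F (a + b) - F a - F b\<bar> \<le> C * (\<bar>a\<bar> powr p * \<bar>b\<bar> + \<bar>a\<bar> * \<bar>b\<bar> powr p)" for a b
    proof (cases "\<bar>b\<bar> \<le> \<bar>a\<bar>")
      case True
      have "C * (\<bar>a\<bar> powr p * \<bar>b\<bar>) \<le> C * (\<bar>a\<bar> powr p * \<bar>b\<bar> + \<bar>a\<bar> * \<bar>b\<bar> powr p)"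
        using C by (intro mult_left_mono) auto
      then show ?thesis using half[OF True] by linarith
    next
      case False
      have "C * (\<bar>b\<bar> powr p * \<bar>a\<bar>) \<le> C * (\<bar>a\<bar> powr p * \<bar>b\<bar> + \<bar>a\<bar> * \<bar>b\<bar> powr p)"
        using C by (intro mult_left_mono) (auto simp: mult.commute)
      moreover have "\<bar>F (a + b) - F a - F b\<bar> \<le> C * (\<bar>b\<bar> powr p * \<bar>a\<bar>)"
        using half[of a b] False by (simp add: add.commute algebra_simps)
      ultimately show ?thesis by linarith
    qed
  qed
qed

theorem theorem2p1:
  fixes p \<beta> c \<gamma> lam :: real and f F :: "real \<Rightarrow> real" and \<psi> :: "nat \<Rightarrow> real \<Rightarrow> real"
  assumes p_ge: "p \<ge> 2"
    and f_C2: "\<exists>f' f''. (\<forall>s. (f has_real_derivative f' s) (at s)) \<and>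
                        (\<forall>s. (f' has_real_derivative f'' s) (at s)) \<and> continuous_on UNIV f''"
    and f_hom: "\<forall>l s. l > 0 \<longrightarrow> f (l * s) = l powr p * f s"
    and F_deriv: "\<forall>s. (F has_real_derivative f s) (at s)"
    and F_0: "F 0 = 0"
    and \<beta>_pos: "\<beta> > 0" and \<gamma>_pos: "\<gamma> > 0"
    and c_lt: "c < 3 * (\<beta>^2 * \<gamma> / 4) powr (1/3)"
    and lam_pos: "lam > 0"
    and \<psi>_X: "\<forall>n. Xspace (\<psi> n)"
    and K_lim: "(\<lambda>n. K_fun F p (\<psi> n)) \<longlonglongrightarrow> lam"
    and I_lim: "(\<lambda>n. I_fun \<beta> c \<gamma> (\<psi> n)) \<longlonglongrightarrow> M_lam \<beta> c \<gamma> F p lam"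
  shows "\<exists>r y \<phi>. strict_mono r \<and> Xspace \<phi> \<and>
           (\<lambda>n. Xnorm (\<lambda>x. \<psi> (r n) (x + y n) - \<phi> x)) \<longlonglongrightarrow> 0 \<and>
           K_fun F p \<phi> = lam \<and> I_fun \<beta> c \<gamma> \<phi> = M_lam \<beta> c \<gamma> F p lam"
proof -
  obtain C where C: "C \<ge> 0" "\<And>l s. l > 0 \<Longrightarrow> F (l * s) = l powr (p + 1) * F s"
    "\<And>s. \<bar>F s\<bar> \<le> C * (\<bar>s\<bar> powr p * \<bar>s\<bar>)"
    "\<And>a b. \<bar>F (a + b) - F a - F b\<bar> \<le> C * (\<bar>a\<bar> powr p * \<bar>b\<bar> + \<bar>a\<bar> * \<bar>b\<bar> powr p)"
    using homogeneous_antiderivative[OF p_ge f_hom F_deriv F_0] by blast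
  have "continuous_on UNIV F"
    using F_deriv by (auto intro!: continuous_at_imp_continuous_on DERIV_isCont)
  then have "F \<in> borel_measurable borel" by (rule borel_measurable_continuous_onI)
  then interpret variational \<beta> c \<gamma> p F C
    using assms C by unfold_locales auto
  show ?thesis
    using minimizing_sequence_compact[OF lam_pos _ K_lim I_lim] \<psi>_X by blast
qed

end
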